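(* Let $(E,\tau,M,\rho)$ be a Lie algebroid on a smooth manifold $M$. The Lie derivative on $A(M,E)$ with respect to sections of $E$ has the following properties. 1. For each $V,W\in A^1(M,E)$, $\mathcal L_\rho(V)(W)=\{V,W\}$. 2. For $V,V_1,\dots,V_p\in A^1(M,E)$, $$\mathcal L_\rho(V)(V_1\wedge\cdots\wedge V_p)=\sum_{i=1}^pV_1\wedge\cdots\wedge V_{i-1}\wedge\{V,V_i\}\wedge V_{i+1}\wedge\cdots\wedge V_p.$$ 3. For each $V\in A^1(M,E)$, $\mathcal L_\rho(V)$ is a derivation of degree $0$ of the exterior algebra $A(M,E)$: for all $P,Q\in A(M,E)$, $\mathcal L_\rho(V)(P\wedge Q)=\bigl(\mathcal L_\rho(V)P\bigr)\wedge Q+P\wedge\mathcal L_\rho(V)Q$. 4. For each $V\in A^1(M,E)$, $P\in A(M,E)$ and $\eta\in\Omega(M,E)$, $\mathcal L_\rho(V)\bigl(i(P)\eta\bigr)=i\bigl(\mathcal L_\rho(V)P\bigr)\eta+i(P)\bigl(\mathcal L_\rho(V)\eta\bigr)$. 5. For each $V\in A^1(M,E)$, $P\in A(M,E)$ and $\eta\in\Omega(M,E)$, $\mathcal L_\rho(V)\bigl(\langle\eta,P\rangle\bigr)=\bigl\langle\mathcal L_\rho(V)\eta,P\bigr\rangle+\bigl\langle\eta,\mathcal L_\rho(V)P\bigr\rangle$. 6. For each $V,W\in A^1(M,E)$ and $P\in A(M,E)$, $\mathcal L_\rho\bigl(\{V,W\}\bigr)P=\bigl(\mathcal L_\rho(V)\circ\mathcal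 L_\rho(W)-\mathcal L_\rho(W)\circ\mathcal L_\rho(V)\bigr)P$. 7. For each $V\in A^1(M,E)$, $f\in C^\infty(M,\mathbb R)$, $P\in A(M,E)$ and $\eta\in\Omega(M,E)$, $\bigl\langle\eta,\mathcal L_\rho(fV)P\bigr\rangle=f\bigl\langle\eta,\mathcal L_\rho(V)P\bigr\rangle-\bigl\langle d_\rho f\wedge i(V)\eta,P\bigr\rangle$.
   Context: A Lie algebroid $(E,\tau,M,\rho)$ is a smooth real vector bundle $\tau:E\to M$ of finite rank over a smooth manifold, with a real Lie algebra bracket $\{\ ,\ \}$ on its smooth sections and a smooth vector bundle map $\rho:E\to TM$ over $\mathrm{id}_M$ (anchor) such that $\{s_1,fs_2\}=f\{s_1,s_2\}+(\mathcal L(\rho\circ s_1)f)s_2$. $A^p(M,E)$ and $\Omega^p(M,E)$ are the spaces of smooth sections of $\bigwedge^pE$ and $\bigwedge^pE^*$ (both $C^\infty(M,\mathbb R)$ for $p=0$, $\{0\}$ for $p<0$); $A(M,E)=\bigoplus_pA^p(M,E)$, $\Omega(M,E)=\bigoplus_p\Omega^p(M,E)$. The wedge product of forms is given by the sum over $(p,q)$-shuffles (no normalizing factor). The pairing is the $C^\infty(M,\mathbb R)$-bilinear map with $\langle\eta,V_1\wedge\cdots\wedge V_p\rangle=\eta(V_1,\dots,V_p)$ for $\eta\in\Omega^p(M,E)$, $\langle f,g\rangle=fg$ in degree $0$, and $\langle\eta,P\rangle=0$ for homogeneous elements of different degrees. Interior product: $i(f)\eta=f\eta$; $i(V)$ inserts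 $V\in A^1(M,E)$ as first argument (zero on $\Omega^0$); $i(V_1\wedge\cdots\wedge V_p)=i(V_1)\circ\cdots\circ i(V_p)$, extended linearly. $d_\rho f\in\Omega^1(M,E)$ is defined by $\langle d_\rho f,V\rangle=\langle df,\rho\circ V\rangle$. Lie derivative $\mathcal L_\rho(V)$, $V\in A^1(M,E)$: on functions $\mathcal L_\rho(V)f=\mathcal L(\rho\circ V)f$; on $\eta\in\Omega^p(M,E)$, $p\geq 1$, $(\mathcal L_\rho(V)\eta)(V_1,\dots,V_p)=\mathcal L_\rho(V)(\eta(V_1,\dots,V_p))-\sum_i\eta(V_1,\dots,\{V,V_i\},\dots,V_p)$; on $P\in A^p(M,E)$, $p\ge1$, $\mathcal L_\rho(V)P\in A^p(M,E)$ is determined by $\langle\eta,\mathcal L_\rho(V)P\rangle=\mathcal L_\rho(V)(\langle\eta,P\rangle)-\langle\mathcal L_\rho(V)\eta,P\rangle$ for all $\eta\in\Omega^p(M,E)$; extended linearly. *)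

theory Defs
  imports "HOL-Analysis.Analysis" "HOL-Library.Function_Algebras"
begin

section \<open>Functions into a real vector space\<close>

text \<open>Sections, forms, multivectors and tangent vectors are functions and are added and scaled
  pointwise. The additive structure comes from Function-Algebras.\<close>

instantiation "fun" :: (type, real_vector) real_vector
begin

definition scaleR_fun :: "real \<Rightarrow> ('a \<Rightarrow> 'b) \<Rightarrow> 'a \<Rightarrow> 'b"
  where "scaleR_fun r f = (\<lambda>x. r *\<^sub>R f x)"

instance
  by standard (simp_all add: scaleR_fun_def fun_eq_iff scaleR_add_right scaleR_add_left)

end

lemma scaleR_fun_apply [simp]: "(r *\<^sub>R f) x = r *\<^sub>R f x"
  by (simp add: scaleR_fun_def)

lemma sum_fun_apply: "(\<Sum>i\<in>I. f i) x = (\<Sum>i\<in>I. f i x)"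
  by (induction I rule: infinite_finite_induct) auto


section \<open>Smooth functions on open subsets of \<open>\<real>\<^sup>n\<close>\<close>

text \<open>Points of \<open>\<real>\<^sup>n\<close> are the functions \<open>nat \<Rightarrow> real\<close> in the topspace of \<^term>\<open>Euclidean_space n\<close>,
  i.e. those vanishing from index \<open>n\<close> on. This includes \<open>n = 0\<close>.
  A function is of class \<open>C\<^sup>k\<close> if its iterated partial derivatives up to
  order \<open>k\<close> exist and are continuous.\<close>

definition partial_deriv :: "nat \<Rightarrow> ((nat \<Rightarrow> real) \<Rightarrow> real) \<Rightarrow> (nat \<Rightarrow> real) \<Rightarrow> real"
  where "partial_deriv i f x = deriv (\<lambda>t. f (x(i := t))) (x i)"

primrec Ck_on :: "nat \<Rightarrow> nat \<Rightarrow> (nat \<Rightarrow> real) set \<Rightarrow> ((nat \<Rightarrow> real) \<Rightarrow> real) \<Rightarrow> bool"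
  where
    "Ck_on n 0 S f \<longleftrightarrow> continuous_on S f"
  | "Ck_on n (Suc k) S f \<longleftrightarrow> continuous_on S f \<and>
       (\<forall>i<n. (\<forall>x\<in>S. (\<lambda>t. f (x(i := t))) differentiable (at (x i))) \<and>
              Ck_on n k S (partial_deriv i f))"

definition Cinf_on :: "nat \<Rightarrow> (nat \<Rightarrow> real) set \<Rightarrow> ((nat \<Rightarrow> real) \<Rightarrow> real) \<Rightarrow> bool"
  where "Cinf_on n S f \<longleftrightarrow> (\<forall>k. Ck_on n k S f)"


section \<open>Smooth manifolds\<close>

text \<open>The underlying set is the whole type \<open>'m\<close>; a chart is a pair of its domain and its
  coordinate map, whose values off the domain are irrelevant. The atlas need not be maximal.\<close>

record 'm mfd =
  mdim :: nat
  atlas :: "('m set \<times> ('m \<Rightarrow> nat \<Rightarrow> real)) set"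

locale smooth_manifold =
  fixes M :: "('m::{t2_space,second_countable_topology}) mfd"
  assumes atlas_cover: "\<Union>(fst ` atlas M) = UNIV"
    and chart_open: "(U, \<phi>) \<in> atlas M \<Longrightarrow> open U"
    and chart_image_open: "(U, \<phi>) \<in> atlas M \<Longrightarrow> openin (Euclidean_space (mdim M)) (\<phi> ` U)"
    and chart_homeo: "(U, \<phi>) \<in> atlas M \<Longrightarrow> homeomorphism U (\<phi> ` U) \<phi> (inv_into U \<phi>)"
    and chart_compat: "(U, \<phi>) \<in> atlas M \<Longrightarrow> (W, \<psi>) \<in> atlas M \<Longrightarrow> i < mdim M \<Longrightarrow>
        Cinf_on (mdim M) (\<phi> ` (U \<inter> W)) (\<lambda>y. \<psi> (inv_into U \<phi> y) i)"

text \<open>To be used for open \<open>S\<close>.\<close>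

definition smooth_fun_on :: "'m mfd \<Rightarrow> 'm set \<Rightarrow> ('m \<Rightarrow> real) \<Rightarrow> bool"
  where "smooth_fun_on M S f \<longleftrightarrow>
    (\<forall>(W, \<phi>)\<in>atlas M. Cinf_on (mdim M) (\<phi> ` (S \<inter> W)) (f \<circ> inv_into W \<phi>))"

definition Cinf :: "'m mfd \<Rightarrow> ('m \<Rightarrow> real) set"
  where "Cinf M = {f. smooth_fun_on M UNIV f}"


section \<open>Smooth vector bundles\<close>

text \<open>The fibres are finite-dimensional linear subspaces of a real vector space \<open>'v\<close>; the total space is
  \<open>{(x, v). v \<in> fibre B x}\<close> with the first projection. A local trivialization over \<open>U\<close> is given
  by its frame \<open>e\<close>: it is inverse to \<open>(x, c) \<mapsto> (x, \<Sum>i. c i *\<^sub>R e i x)\<close>. So \<^term>\<open>frames\<close> is a vector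
  bundle atlas, whose transition functions are required to be smooth. The rank is \<open>card (idx B)\<close>
  and may be 0.\<close>

record ('m, 'v, 'i) vbundle =
  fibre :: "'m \<Rightarrow> 'v set"
  idx :: "'i set"
  frames :: "('m set \<times> ('i \<Rightarrow> 'm \<Rightarrow> 'v)) set"

definition smooth_section_on ::
    "'m mfd \<Rightarrow> ('m, 'v::real_vector, 'i) vbundle \<Rightarrow> 'm set \<Rightarrow> ('m \<Rightarrow> 'v) \<Rightarrow> bool"
  where "smooth_section_on M B S s \<longleftrightarrow> (\<forall>x\<in>S. s x \<in> fibre B x) \<and>
    (\<forall>(U, e)\<in>frames B. \<exists>c. (\<forall>i\<in>idx B. smooth_fun_on M (S \<inter> U) (c i)) \<and>
       (\<forall>x\<in>S \<inter> U. s x = (\<Sum>i\<in>idx B. c i x *\<^sub>R e i x)))"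

definition smooth_sections :: "'m mfd \<Rightarrow> ('m, 'v::real_vector, 'i) vbundle \<Rightarrow> ('m \<Rightarrow> 'v) set"
  where "smooth_sections M B = {s. smooth_section_on M B UNIV s}"

locale smooth_vector_bundle =
  fixes M :: "('m::{t2_space,second_countable_topology}) mfd"
    and B :: "('m, 'v::real_vector, 'i) vbundle"
  assumes finite_idx: "finite (idx B)"
    and frames_cover: "\<Union>(fst ` frames B) = UNIV"
    and frame_open: "(U, e) \<in> frames B \<Longrightarrow> open U"
    and frame_basis: "(U, e) \<in> frames B \<Longrightarrow> x \<in> U \<Longrightarrow>
        inj_on (\<lambda>i. e i x) (idx B) \<and> independent ((\<lambda>i. e i x) ` idx B) \<and>
        span ((\<lambda>i. e i x) ` idx B) = fibre B x"
    and frame_compat: "(U, e) \<in> frames B \<Longrightarrow> i \<in> idx B \<Longrightarrow> smooth_section_on M B U (e i)"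

text \<open>Tangent vectors at \<open>x\<close> are the derivations at \<open>x\<close> of the algebra \<open>C\<^sup>\<infinity>(M)\<close> (put to 0 on non-smooth
  functions), and a chart induces the frame of its coordinate vector fields.\<close>

definition tangent_space :: "'m mfd \<Rightarrow> 'm \<Rightarrow> (('m \<Rightarrow> real) \<Rightarrow> real) set"
  where "tangent_space M x = {D.
    (\<forall>f\<in>Cinf M. \<forall>g\<in>Cinf M. \<forall>a b. D (a *\<^sub>R f + b *\<^sub>R g) = a * D f + b * D g) \<and>
    (\<forall>f\<in>Cinf M. \<forall>g\<in>Cinf M. D (\<lambda>y. f y * g y) = f x * D g + g x * D f) \<and>
    (\<forall>f. f \<notin> Cinf M \<longrightarrow> D f = 0)}"

definition coord_vector ::
    "'m mfd \<Rightarrow> 'm set \<Rightarrow> ('m \<Rightarrow> nat \<Rightarrow> real) \<Rightarrow> nat \<Rightarrow> 'm \<Rightarrow> ('m \<Rightarrow> real) \<Rightarrow> real"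
  where "coord_vector M W \<phi> i x =
    (\<lambda>f. if f \<in> Cinf M then partial_deriv i (f \<circ> inv_into W \<phi>) (\<phi> x) else 0)"

definition tangent_bundle :: "'m mfd \<Rightarrow> ('m, ('m \<Rightarrow> real) \<Rightarrow> real, nat) vbundle"
  where "tangent_bundle M =
    \<lparr> fibre = tangent_space M, idx = {..<mdim M},
      frames = (\<lambda>(W, \<phi>). (W, coord_vector M W \<phi>)) ` atlas M \<rparr>"

text \<open>Bundle maps over the identity; smoothness is smoothness of the matrix entries in local
  trivializations.\<close>

definition smooth_bundle_map :: "'m mfd \<Rightarrow> ('m, 'v::real_vector, 'i) vbundle \<Rightarrow>
    ('m, 'w::real_vector, 'j) vbundle \<Rightarrow> ('m \<Rightarrow> 'v \<Rightarrow> 'w) \<Rightarrow> bool"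
  where "smooth_bundle_map M B C \<rho> \<longleftrightarrow>
    (\<forall>x. \<forall>v\<in>fibre B x. \<rho> x v \<in> fibre C x) \<and>
    (\<forall>x. \<forall>v\<in>fibre B x. \<forall>w\<in>fibre B x. \<forall>a b.
       \<rho> x (a *\<^sub>R v + b *\<^sub>R w) = a *\<^sub>R \<rho> x v + b *\<^sub>R \<rho> x w) \<and>
    (\<forall>(U, e)\<in>frames B. \<forall>i\<in>idx B. smooth_section_on M C U (\<lambda>x. \<rho> x (e i x)))"


section \<open>Lie algebroids\<close>

record ('m, 'v) algebroid =
  base :: "'m mfd"
  ebundle :: "('m, 'v, nat) vbundle"
  bracket :: "('m \<Rightarrow> 'v) \<Rightarrow> ('m \<Rightarrow> 'v) \<Rightarrow> 'm \<Rightarrow> 'v"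
  anchor :: "'m \<Rightarrow> 'v \<Rightarrow> ('m \<Rightarrow> real) \<Rightarrow> real"

abbreviation Sec :: "('m, 'v::real_vector) algebroid \<Rightarrow> ('m \<Rightarrow> 'v) set"
  where "Sec L \<equiv> smooth_sections (base L) (ebundle L)"

abbreviation efib :: "('m, 'v) algebroid \<Rightarrow> 'm \<Rightarrow> 'v set"
  where "efib L \<equiv> fibre (ebundle L)"

text \<open>Derivative of a function along the vector field \<open>\<rho> \<circ> V\<close>.\<close>

definition Lie_fun :: "('m, 'v) algebroid \<Rightarrow> ('m \<Rightarrow> 'v) \<Rightarrow> ('m \<Rightarrow> real) \<Rightarrow> 'm \<Rightarrow> real"
  where "Lie_fun L V f = (\<lambda>x. anchor L x (V x) f)"

definition sec_scale :: "('m \<Rightarrow> real) \<Rightarrow> ('m \<Rightarrow> 'v::real_vector) \<Rightarrow> 'm \<Rightarrow> 'v"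
  where "sec_scale f s = (\<lambda>x. f x *\<^sub>R s x)"

locale lie_algebroid =
  fixes L :: "('m::{t2_space,second_countable_topology}, 'v::real_vector) algebroid"
  assumes base_manifold: "smooth_manifold (base L)"
    and vector_bundle: "smooth_vector_bundle (base L) (ebundle L)"
    and bracket_closed: "V \<in> Sec L \<Longrightarrow> W \<in> Sec L \<Longrightarrow> bracket L V W \<in> Sec L"
    and bracket_linear: "U \<in> Sec L \<Longrightarrow> V \<in> Sec L \<Longrightarrow> W \<in> Sec L \<Longrightarrow>
        bracket L (a *\<^sub>R U + b *\<^sub>R V) W = a *\<^sub>R bracket L U W + b *\<^sub>R bracket L V W"
    and bracket_skew: "V \<in> Sec L \<Longrightarrow> W \<in> Sec L \<Longrightarrow> bracket L V W = - bracket L W V"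
    and bracket_jacobi: "U \<in> Sec L \<Longrightarrow> V \<in> Sec L \<Longrightarrow> W \<in> Sec L \<Longrightarrow>
        bracket L U (bracket L V W) + bracket L V (bracket L W U) + bracket L W (bracket L U V) = 0"
    and anchor_map: "smooth_bundle_map (base L) (ebundle L) (tangent_bundle (base L)) (anchor L)"
    and bracket_leibniz: "V \<in> Sec L \<Longrightarrow> W \<in> Sec L \<Longrightarrow> f \<in> Cinf (base L) \<Longrightarrow>
        bracket L V (sec_scale f W) = sec_scale f (bracket L V W) + sec_scale (Lie_fun L V f) W"


section \<open>Alternating forms and the exterior algebra of a vector space\<close>

text \<open>All degrees are treated at once: an element of \<open>\<Oplus>\<^sub>p \<And>\<^sup>pV*\<close> is a function on lists of
  vectors of \<open>V\<close> (put to 0 on other lists), its degree \<open>p\<close> component being the restriction to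
  lists of length \<open>p\<close>. For finite-dimensional \<open>V\<close> this is the direct sum, since the components in
  degrees above the dimension vanish.\<close>

definition alt_forms :: "'v::real_vector set \<Rightarrow> ('v list \<Rightarrow> real) set"
  where "alt_forms V = {\<omega>.
    (\<forall>vs. \<not> set vs \<subseteq> V \<longrightarrow> \<omega> vs = 0) \<and>
    (\<forall>us ws. set us \<subseteq> V \<and> set ws \<subseteq> V \<longrightarrow>
       (\<forall>v\<in>V. \<forall>w\<in>V. \<forall>a b. \<omega> (us @ (a *\<^sub>R v + b *\<^sub>R w) # ws) =
          a * \<omega> (us @ v # ws) + b * \<omega> (us @ w # ws))) \<and>
    (\<forall>vs. set vs \<subseteq> V \<and> \<not> distinct vs \<longrightarrow> \<omega> vs = 0)}"

definition alt_forms_deg :: "nat \<Rightarrow> 'v::real_vector set \<Rightarrow> ('v list \<Rightarrow> real) set"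
  where "alt_forms_deg p V = {\<omega> \<in> alt_forms V. \<forall>vs. length vs \<noteq> p \<longrightarrow> \<omega> vs = 0}"

text \<open>The product \<open>v\<^sub>1 \<and> \<dots> \<and> v\<^sub>p\<close> is realized as the evaluation \<open>\<omega> \<mapsto> \<omega>(v\<^sub>1,\<dots>,v\<^sub>p)\<close> on
  alternating forms, and the exterior power is spanned by these. By \<open>wedge_vecs_universal\<close> below
  all alternating multilinear maps satisfy all linear relations between such products, which is
  the universal property of the exterior power.\<close>

definition wedge_vecs :: "'v::real_vector set \<Rightarrow> 'v list \<Rightarrow> ('v list \<Rightarrow> real) \<Rightarrow> real"
  where "wedge_vecs V vs = (\<lambda>\<omega>. if \<omega> \<in> alt_forms V then \<omega> vs else 0)"

definition ext_power :: "nat \<Rightarrow> 'v::real_vector set \<Rightarrow> (('v list \<Rightarrow> real) \<Rightarrow> real) set"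
  where "ext_power p V = span {wedge_vecs V vs | vs. set vs \<subseteq> V \<and> length vs = p}"

definition ext_algebra :: "'v::real_vector set \<Rightarrow> (('v list \<Rightarrow> real) \<Rightarrow> real) set"
  where "ext_algebra V = span {wedge_vecs V vs | vs. set vs \<subseteq> V}"

text \<open>Bilinear extension of concatenation, see \<open>ext_wedge_vecs\<close>.\<close>

definition ext_wedge :: "'v::real_vector set \<Rightarrow> (('v list \<Rightarrow> real) \<Rightarrow> real) \<Rightarrow>
    (('v list \<Rightarrow> real) \<Rightarrow> real) \<Rightarrow> ('v list \<Rightarrow> real) \<Rightarrow> real"
  where "ext_wedge V P Q =
    (\<lambda>\<omega>. if \<omega> \<in> alt_forms V then P (\<lambda>vs. Q (\<lambda>ws. \<omega> (vs @ ws))) else 0)"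

definition ext_part :: "'v::real_vector set \<Rightarrow> nat \<Rightarrow> (('v list \<Rightarrow> real) \<Rightarrow> real) \<Rightarrow>
    ('v list \<Rightarrow> real) \<Rightarrow> real"
  where "ext_part V p P =
    (\<lambda>\<omega>. if \<omega> \<in> alt_forms V then P (\<lambda>vs. if length vs = p then \<omega> vs else 0) else 0)"

text \<open>The linear extension of \<open>i(v\<^sub>1 \<and> \<dots> \<and> v\<^sub>p) = i(v\<^sub>1) \<circ> \<dots> \<circ> i(v\<^sub>p)\<close>, see \<open>int_prod_vecs\<close>. As
  \<open>v\<^sub>p\<close> is inserted first, the list is reversed.\<close>

definition ext_int :: "(('v list \<Rightarrow> real) \<Rightarrow> real) \<Rightarrow> ('v list \<Rightarrow> real) \<Rightarrow> 'v list \<Rightarrow> real"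
  where "ext_int P \<omega> = (\<lambda>ws. P (\<lambda>vs. \<omega> (rev vs @ ws)))"

definition shuffle_perms :: "nat \<Rightarrow> nat \<Rightarrow> (nat \<Rightarrow> nat) set"
  where "shuffle_perms p q = {\<sigma>. \<sigma> permutes {..<p + q} \<and>
    strict_mono_on {..<p} \<sigma> \<and> strict_mono_on {p..<p + q} \<sigma>}"

text \<open>The summand for \<open>p\<close> is the product of the degree \<open>p\<close> component of the first factor and the
  degree \<open>length vs - p\<close> component of the second.\<close>

definition alt_wedge :: "('v list \<Rightarrow> real) \<Rightarrow> ('v list \<Rightarrow> real) \<Rightarrow> 'v list \<Rightarrow> real"
  where "alt_wedge \<omega> \<theta> = (\<lambda>vs. \<Sum>p\<le>length vs. \<Sum>\<sigma>\<in>shuffle_perms p (length vs - p).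
    of_int (sign \<sigma>) * \<omega> (map (\<lambda>i. vs ! \<sigma> i) [0..<p]) * \<theta> (map (\<lambda>i. vs ! \<sigma> i) [p..<length vs]))"


section \<open>The exterior algebra of sections and its dual\<close>

text \<open>For a local frame \<open>e\<close> and a set \<open>I\<close> of indices \<open>i\<^sub>1 < \<dots> < i\<^sub>p\<close>, the list of the
  \<open>e i\<^sub>j x\<close>.\<close>

definition frame_list :: "(nat \<Rightarrow> 'm \<Rightarrow> 'v) \<Rightarrow> nat set \<Rightarrow> 'm \<Rightarrow> 'v list"
  where "frame_list e I x = map (\<lambda>i. e i x) (sorted_list_of_set I)"

definition ext_bundle :: "('m, 'v::real_vector, nat) vbundle \<Rightarrow>
    ('m, ('v list \<Rightarrow> real) \<Rightarrow> real, nat set) vbundle"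
  where "ext_bundle B =
    \<lparr> fibre = (\<lambda>x. ext_algebra (fibre B x)), idx = Pow (idx B),
      frames = (\<lambda>(U, e). (U, \<lambda>I x. wedge_vecs (fibre B x) (frame_list e I x))) ` frames B \<rparr>"

type_synonym ('m, 'v) mvec = "'m \<Rightarrow> ('v list \<Rightarrow> real) \<Rightarrow> real"
type_synonym ('m, 'v) form = "'m \<Rightarrow> 'v list \<Rightarrow> real"

definition Avec :: "('m, 'v::real_vector) algebroid \<Rightarrow> ('m, 'v) mvec set"
  where "Avec L = smooth_sections (base L) (ext_bundle (ebundle L))"

definition Avec_deg :: "('m, 'v::real_vector) algebroid \<Rightarrow> nat \<Rightarrow> ('m, 'v) mvec set"
  where "Avec_deg L p = {P \<in> Avec L. \<forall>x. P x \<in> ext_power p (efib L x)}"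

text \<open>The functions \<open>\<eta>(e\<^sub>i\<^sub>1,\<dots>,e\<^sub>i\<^sub>p)\<close> are the components of \<open>\<eta>\<close> in the frame induced by \<open>e\<close>
  on the exterior powers of the dual bundle.\<close>

definition Omega :: "('m, 'v::real_vector) algebroid \<Rightarrow> ('m, 'v) form set"
  where "Omega L = {\<eta>. (\<forall>x. \<eta> x \<in> alt_forms (efib L x)) \<and>
    (\<forall>(U, e)\<in>frames (ebundle L). \<forall>I\<subseteq>idx (ebundle L).
       smooth_fun_on (base L) U (\<lambda>x. \<eta> x (frame_list e I x)))}"

definition Omega_deg :: "('m, 'v::real_vector) algebroid \<Rightarrow> nat \<Rightarrow> ('m, 'v) form set"
  where "Omega_deg L p = {\<eta> \<in> Omega L. \<forall>x. \<eta> x \<in> alt_forms_deg p (efib L x)}"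

text \<open>\<open>V\<^sub>1 \<and> \<dots> \<and> V\<^sub>p\<close> for a list of sections; \<open>mvec_of L [V]\<close> is \<open>V\<close> as an element of \<open>A\<^sup>1\<close>, and
  \<open>mvec_fun L f\<close> is \<open>f\<close> as an element of \<open>A\<^sup>0\<close>.\<close>

definition mvec_of :: "('m, 'v::real_vector) algebroid \<Rightarrow> ('m \<Rightarrow> 'v) list \<Rightarrow> ('m, 'v) mvec"
  where "mvec_of L Vs = (\<lambda>x. wedge_vecs (efib L x) (map (\<lambda>V. V x) Vs))"

definition mvec_fun :: "('m, 'v::real_vector) algebroid \<Rightarrow> ('m \<Rightarrow> real) \<Rightarrow> ('m, 'v) mvec"
  where "mvec_fun L f = sec_scale f (mvec_of L [])"

definition mvec_wedge :: "('m, 'v::real_vector) algebroid \<Rightarrow> ('m, 'v) mvec \<Rightarrow> ('m, 'v) mvec \<Rightarrow>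
    ('m, 'v) mvec"
  where "mvec_wedge L P Q = (\<lambda>x. ext_wedge (efib L x) (P x) (Q x))"

definition mvec_part :: "('m, 'v::real_vector) algebroid \<Rightarrow> nat \<Rightarrow> ('m, 'v) mvec \<Rightarrow> ('m, 'v) mvec"
  where "mvec_part L p P = (\<lambda>x. ext_part (efib L x) p (P x))"

definition form_wedge :: "('m, 'v) form \<Rightarrow> ('m, 'v) form \<Rightarrow> ('m, 'v) form"
  where "form_wedge \<eta> \<theta> = (\<lambda>x. alt_wedge (\<eta> x) (\<theta> x))"

definition form_eval :: "('m, 'v) form \<Rightarrow> ('m \<Rightarrow> 'v) list \<Rightarrow> 'm \<Rightarrow> real"
  where "form_eval \<eta> Vs = (\<lambda>x. \<eta> x (map (\<lambda>V. V x) Vs))"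

text \<open>Since a product of \<open>p\<close> vectors only sees the values of a form on lists of length \<open>p\<close>,
  components of different degrees pair to 0.\<close>

definition pairing :: "('m, 'v) form \<Rightarrow> ('m, 'v) mvec \<Rightarrow> 'm \<Rightarrow> real"
  where "pairing \<eta> P = (\<lambda>x. P x (\<eta> x))"

definition int_prod :: "('m, 'v) mvec \<Rightarrow> ('m, 'v) form \<Rightarrow> ('m, 'v) form"
  where "int_prod P \<eta> = (\<lambda>x. ext_int (P x) (\<eta> x))"

definition d_anchor :: "('m, 'v) algebroid \<Rightarrow> ('m \<Rightarrow> real) \<Rightarrow> ('m, 'v) form"
  where "d_anchor L f =
    (\<lambda>x vs. if length vs = 1 \<and> set vs \<subseteq> efib L x then anchor L x (hd vs) f else 0)"


section \<open>Lie derivatives\<close>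

text \<open>The condition on lists \<open>Vs\<close> of length \<open>p\<close> is the one for the degree \<open>p\<close> component of \<open>\<eta>\<close>;
  for the empty list it is the formula \<open>\<L>\<^sub>\<rho>(V)f = \<L>(\<rho> \<circ> V)f\<close> for functions.\<close>

definition Lie_form :: "('m, 'v::real_vector) algebroid \<Rightarrow> ('m \<Rightarrow> 'v) \<Rightarrow> ('m, 'v) form \<Rightarrow>
    ('m, 'v) form"
  where "Lie_form L V \<eta> = (THE \<theta>. \<theta> \<in> Omega L \<and> (\<forall>Vs. set Vs \<subseteq> Sec L \<longrightarrow>
    form_eval \<theta> Vs = Lie_fun L V (form_eval \<eta> Vs) -
      (\<Sum>i<length Vs. form_eval \<eta> (Vs[i := bracket L V (Vs ! i)]))))"

text \<open>In degree 0, the function belonging to \<open>P\<close> is its pairing with the constant 0-form 1.\<close>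

definition Lie_mvec_deg :: "('m, 'v::real_vector) algebroid \<Rightarrow> nat \<Rightarrow> ('m \<Rightarrow> 'v) \<Rightarrow>
    ('m, 'v) mvec \<Rightarrow> ('m, 'v) mvec"
  where "Lie_mvec_deg L p V P =
    (if p = 0 then mvec_fun L (Lie_fun L V (pairing (\<lambda>x vs. if vs = [] then 1 else 0) P))
     else (THE Q. Q \<in> Avec_deg L p \<and> (\<forall>\<eta>\<in>Omega_deg L p.
       pairing \<eta> Q = Lie_fun L V (pairing \<eta> P) - pairing (Lie_form L V \<eta>) P)))"

definition Lie_mvec :: "('m, 'v::real_vector) algebroid \<Rightarrow> ('m \<Rightarrow> 'v) \<Rightarrow> ('m, 'v) mvec \<Rightarrow>
    ('m, 'v) mvec"
  where "Lie_mvec L V P = (\<Sum>p\<le>card (idx (ebundle L)). Lie_mvec_deg L p V (mvec_part L p P))"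


section \<open>Checks of the definitions\<close>

lemma alt_formsI:
  assumes "\<And>vs. \<not> set vs \<subseteq> V \<Longrightarrow> \<omega> vs = 0"
    and "\<And>us ws v w a b. set us \<subseteq> V \<Longrightarrow> set ws \<subseteq> V \<Longrightarrow> v \<in> V \<Longrightarrow> w \<in> V \<Longrightarrow>
      \<omega> (us @ (a *\<^sub>R v + b *\<^sub>R w) # ws) = a * \<omega> (us @ v # ws) + b * \<omega> (us @ w # ws)"
    and "\<And>vs. set vs \<subseteq> V \<Longrightarrow> \<not> distinct vs \<Longrightarrow> \<omega> vs = 0"
  shows "\<omega> \<in> alt_forms V"
  using assms unfolding alt_forms_def by blast

lemma alt_formsD:
  assumes "\<omega> \<in> alt_forms V"
  shows "\<not> set vs \<subseteq> V \<Longrightarrow> \<omega> vs = 0"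
    and "set us \<subseteq> V \<Longrightarrow> set ws \<subseteq> V \<Longrightarrow> v \<in> V \<Longrightarrow> w \<in> V \<Longrightarrow>
      \<omega> (us @ (a *\<^sub>R v + b *\<^sub>R w) # ws) = a * \<omega> (us @ v # ws) + b * \<omega> (us @ w # ws)"
    and "set vs \<subseteq> V \<Longrightarrow> \<not> distinct vs \<Longrightarrow> \<omega> vs = 0"
  using assms unfolding alt_forms_def by blast+

lemma alt_forms_append_left:
  assumes w: "\<omega> \<in> alt_forms V" and us: "set us \<subseteq> V"
  shows "(\<lambda>vs. \<omega> (us @ vs)) \<in> alt_forms V"
proof (rule alt_formsI)
  fix xs ws :: "'a list" and v w a b
  assume *: "set xs \<subseteq> V" "set ws \<subseteq> V" "v \<in> V" "w \<in> V"
  then have "set (us @ xs) \<subseteq> V" using us by auto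
  from alt_formsD(2)[OF w this *(2-4)]
  show "\<omega> (us @ xs @ (a *\<^sub>R v + b *\<^sub>R w) # ws) =
      a * \<omega> (us @ xs @ v # ws) + b * \<omega> (us @ xs @ w # ws)" by simp
next
  fix vs
  show "\<omega> (us @ vs) = 0" if "\<not> set vs \<subseteq> V"
    by (rule alt_formsD(1)[OF w]) (use that in auto)
  show "\<omega> (us @ vs) = 0" if "set vs \<subseteq> V" "\<not> distinct vs"
    by (rule alt_formsD(3)[OF w]) (use that us in auto)
qed

lemma alt_forms_append_right:
  assumes w: "\<omega> \<in> alt_forms V" and us: "set us \<subseteq> V"
  shows "(\<lambda>vs. \<omega> (vs @ us)) \<in> alt_forms V"
proof (rule alt_formsI)
  fix xs ws :: "'a list" and v w a b
  assume *: "set xs \<subseteq> V" "set ws \<subseteq> V" "v \<in> V" "w \<in> V"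
  then have "set (ws @ us) \<subseteq> V" using us by auto
  from alt_formsD(2)[OF w *(1) this *(3-4)]
  show "\<omega> ((xs @ (a *\<^sub>R v + b *\<^sub>R w) # ws) @ us) =
      a * \<omega> ((xs @ v # ws) @ us) + b * \<omega> ((xs @ w # ws) @ us)" by simp
next
  fix vs
  show "\<omega> (vs @ us) = 0" if "\<not> set vs \<subseteq> V"
    by (rule alt_formsD(1)[OF w]) (use that in auto)
  show "\<omega> (vs @ us) = 0" if "set vs \<subseteq> V" "\<not> distinct vs"
    by (rule alt_formsD(3)[OF w]) (use that us in auto)
qed

lemma alt_forms_rev:
  assumes w: "\<omega> \<in> alt_forms V"
  shows "(\<lambda>vs. \<omega> (rev vs)) \<in> alt_forms V"
proof (rule alt_formsI)
  fix xs ws :: "'a list" and v w a b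
  assume *: "set xs \<subseteq> V" "set ws \<subseteq> V" "v \<in> V" "w \<in> V"
  then have "set (rev ws) \<subseteq> V" "set (rev xs) \<subseteq> V" by auto
  from alt_formsD(2)[OF w this *(3-4)]
  show "\<omega> (rev (xs @ (a *\<^sub>R v + b *\<^sub>R w) # ws)) =
      a * \<omega> (rev (xs @ v # ws)) + b * \<omega> (rev (xs @ w # ws))" by simp
next
  fix vs
  show "\<omega> (rev vs) = 0" if "\<not> set vs \<subseteq> V"
    by (rule alt_formsD(1)[OF w]) (use that in auto)
  show "\<omega> (rev vs) = 0" if "set vs \<subseteq> V" "\<not> distinct vs"
    by (rule alt_formsD(3)[OF w]) (use that in auto)
qed

lemma alt_forms_zero: "(\<lambda>vs. 0) \<in> alt_forms V"
  by (rule alt_formsI) auto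

lemma ext_wedge_vecs:
  assumes "set vs \<subseteq> V" "set ws \<subseteq> V"
  shows "ext_wedge V (wedge_vecs V vs) (wedge_vecs V ws) = wedge_vecs V (vs @ ws)"
proof
  fix \<omega>
  show "ext_wedge V (wedge_vecs V vs) (wedge_vecs V ws) \<omega> = wedge_vecs V (vs @ ws) \<omega>"
  proof (cases "\<omega> \<in> alt_forms V")
    case True
    have "wedge_vecs V ws (\<lambda>ws. \<omega> (us @ ws)) = \<omega> (us @ ws)" for us
    proof (cases "set us \<subseteq> V")
      case True
      then show ?thesis using alt_forms_append_left[OF \<open>\<omega> \<in> alt_forms V\<close>]
        by (simp add: wedge_vecs_def)
    next
      case False
      then have "\<omega> (us @ xs) = 0" for xs
        by (intro alt_formsD(1)[OF \<open>\<omega> \<in> alt_forms V\<close>]) auto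
      then show ?thesis by (simp add: wedge_vecs_def)
    qed
    then show ?thesis using True alt_forms_append_right[OF True assms(2)]
      by (simp add: ext_wedge_def wedge_vecs_def)
  qed (simp add: ext_wedge_def wedge_vecs_def)
qed

lemma ext_int_vecs:
  assumes "\<omega> \<in> alt_forms V" "set ws \<subseteq> V"
  shows "ext_int (wedge_vecs V vs) \<omega> ws = \<omega> (rev vs @ ws)"
  using alt_forms_rev[OF alt_forms_append_right[OF assms]]
  by (simp add: ext_int_def wedge_vecs_def)

lemma mvec_wedge_of:
  assumes "set Vs \<subseteq> Sec L" "set Ws \<subseteq> Sec L"
  shows "mvec_wedge L (mvec_of L Vs) (mvec_of L Ws) = mvec_of L (Vs @ Ws)"
proof
  fix x
  have "set (map (\<lambda>V. V x) Vs) \<subseteq> efib L x" "set (map (\<lambda>V. V x) Ws) \<subseteq> efib L x"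
    using assms by (auto simp: smooth_sections_def smooth_section_on_def)
  then show "mvec_wedge L (mvec_of L Vs) (mvec_of L Ws) x = mvec_of L (Vs @ Ws) x"
    by (simp add: mvec_wedge_def mvec_of_def ext_wedge_vecs)
qed

lemma pairing_mvec_of:
  "\<eta> \<in> Omega L \<Longrightarrow> pairing \<eta> (mvec_of L Vs) = form_eval \<eta> Vs"
  by (simp add: Omega_def pairing_def mvec_of_def form_eval_def wedge_vecs_def)

lemma int_prod_mvec_of:
  assumes eta: "\<eta> x \<in> alt_forms (efib L x)"
  shows "int_prod (mvec_of L Vs) \<eta> x ws = \<eta> x (rev (map (\<lambda>V. V x) Vs) @ ws)"
proof (cases "set ws \<subseteq> efib L x")
  case True
  then show ?thesis using ext_int_vecs[OF eta True] by (simp add: int_prod_def mvec_of_def)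
next
  case False
  then have "\<eta> x (us @ ws) = 0" for us by (intro alt_formsD(1)[OF eta]) auto
  then show ?thesis by (simp add: int_prod_def ext_int_def mvec_of_def wedge_vecs_def)
qed

lemma int_prod_sec:
  "\<eta> \<in> Omega L \<Longrightarrow> int_prod (mvec_of L [V]) \<eta> x ws = \<eta> x (V x # ws)"
  by (simp add: Omega_def int_prod_mvec_of)

lemma int_prod_vecs:
  assumes "\<eta> \<in> Omega L" "set Vs \<subseteq> Sec L"
  shows "int_prod (mvec_of L (V # Vs)) \<eta> =
    int_prod (mvec_of L [V]) (int_prod (mvec_of L Vs) \<eta>)"
proof (intro ext)
  fix x ws
  have eta: "\<eta> x \<in> alt_forms (efib L x)" using assms by (simp add: Omega_def)
  have "int_prod (mvec_of L Vs) \<eta> x = (\<lambda>ws. \<eta> x (rev (map (\<lambda>V. V x) Vs) @ ws))"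
    by (simp add: fun_eq_iff int_prod_mvec_of eta)
  also have "\<dots> \<in> alt_forms (efib L x)"
    using assms(2)
    by (intro alt_forms_append_left[OF eta]) (auto simp: smooth_sections_def smooth_section_on_def)
  finally show "int_prod (mvec_of L (V # Vs)) \<eta> x ws =
      int_prod (mvec_of L [V]) (int_prod (mvec_of L Vs) \<eta>) x ws"
    by (simp add: int_prod_mvec_of eta)
qed

lemma wedge_vecs_universal:
  fixes f :: "'v::real_vector list \<Rightarrow> 'w::real_vector"
  assumes lin: "\<And>us ws v w a b. set us \<subseteq> V \<Longrightarrow> set ws \<subseteq> V \<Longrightarrow> v \<in> V \<Longrightarrow> w \<in> V \<Longrightarrow>
      f (us @ (a *\<^sub>R v + b *\<^sub>R w) # ws) = a *\<^sub>R f (us @ v # ws) + b *\<^sub>R f (us @ w # ws)"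
    and alt: "\<And>vs. set vs \<subseteq> V \<Longrightarrow> \<not> distinct vs \<Longrightarrow> f vs = 0"
    and V: "subspace V" and F: "finite F" "\<And>vs. vs \<in> F \<Longrightarrow> set vs \<subseteq> V"
    and rel: "(\<Sum>vs\<in>F. c vs *\<^sub>R wedge_vecs V vs) = 0"
  shows "(\<Sum>vs\<in>F. c vs *\<^sub>R f vs) = 0"
proof (rule ccontr)
  define w0 where "w0 = (\<Sum>vs\<in>F. c vs *\<^sub>R f vs)"
  assume "(\<Sum>vs\<in>F. c vs *\<^sub>R f vs) \<noteq> 0"
  then have "independent {w0}" by (simp add: w0_def)
  then obtain g :: "'w \<Rightarrow> real" where g: "linear g" "g w0 = 1"
    using linear_independent_extend[of "{w0}" "\<lambda>_. 1 :: real"] by auto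
  let ?om = "\<lambda>vs. if set vs \<subseteq> V then g (f vs) else 0"
  have om: "?om \<in> alt_forms V"
  proof (rule alt_formsI)
    fix us ws v w a b
    assume *: "set us \<subseteq> V" "set ws \<subseteq> V" "v \<in> V" "w \<in> V"
    have "a *\<^sub>R v + b *\<^sub>R w \<in> V" using V * by (simp add: subspace_add subspace_scale)
    then show "?om (us @ (a *\<^sub>R v + b *\<^sub>R w) # ws) = a * ?om (us @ v # ws) + b * ?om (us @ w # ws)"
      using * by (simp add: lin linear_add[OF g(1)] linear_scale[OF g(1)])
  qed (auto simp: alt linear_0[OF g(1)])
  have "0 = (\<Sum>vs\<in>F. c vs *\<^sub>R wedge_vecs V vs) ?om" by (simp add: rel)
  also have "\<dots> = (\<Sum>vs\<in>F. c vs * g (f vs))"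
    using om F(2) by (simp add: sum_fun_apply wedge_vecs_def)
  also have "\<dots> = g w0"
    by (simp add: w0_def linear_sum[OF g(1)] linear_scale[OF g(1)])
  finally show False using g(2) by simp
qed

end

theory Submission
  imports Defs
begin

text \<open>The expression defining \<open>\<L>\<^sub>\<rho>(V)\<eta>\<close> on sections is multilinear over the smooth functions, so by bump
  functions its value at a point only depends on the values of the sections there, and it is a form.
  A multivector field is determined by its pairings with all forms, since each alternating form on a
  fibre extends to a global one. Hence \<open>\<L>\<^sub>\<rho>(V)P\<close> is the unique \<open>Q\<close> with
  \<open>\<langle>\<eta>, Q\<rangle> = \<L>\<^sub>\<rho>(V)\<langle>\<eta>, P\<rangle> - \<langle>\<L>\<^sub>\<rho>(V)\<eta>, P\<rangle>\<close> for all \<open>\<eta>\<close>; near a point such a \<open>Q\<close> is given by the Leibniz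
  formula in a frame, and uniqueness glues the local solutions. All other statements follow from this
  characterization by duality: for the wedge product one uses \<open>\<langle>\<eta>, P \<and> Q\<rangle> = \<langle>j(Q)\<eta>, P\<rangle>\<close> with the right
  contraction \<open>j(Q)\<close>, for the bracket the commutator of Lie derivatives of forms, and for \<open>f V\<close> the
  formula \<open>\<L>\<^sub>\<rho>(fV)\<eta> = f \<L>\<^sub>\<rho>(V)\<eta> + d\<^sub>\<rho>f \<and> i(V)\<eta>\<close>.\<close>


section \<open>Functions of class \<open>C\<^sup>k\<close> on open sets\<close>

text \<open>The bracket takes global sections and the identities characterizing Lie derivatives
  involve global forms, while frames and coefficients exist only on open sets. Local data are
  therefore multiplied by bump functions before they enter, and identities valid near a point are
  transferred to it by locality of derivations. Tangent vectors being derivations of the global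
  functions, this locality itself rests on bump functions. These are made from exp(-1/t), so the C^k
  calculus covers sums, products and composition with functions of one variable. Minors serve two
  purposes: the coefficients of a list of vectors in a basis are minors of its coordinate matrix,
  hence smooth when the vectors vary smoothly, and as functions of the list they form the dual basis
  of alternating forms. The definition treats degree 0 and positive degrees separately;
  \<open>is_Lie_mvec\<close> is one condition for all degrees, and the rules are derived for it.
  That the anchor respects brackets is not among the axioms of \<open>lie_algebroid\<close>; it is
  derived from the Jacobi identity and enters the commutator formula.\<close>

lemma openin_Euclidean_iff:
  "openin (Euclidean_space n) S \<longleftrightarrow> (\<exists>G. open G \<and> S = G \<inter> {x. \<forall>i\<ge>n. x i = 0})"
  unfolding Euclidean_space_def openin_subtopology euclidean_product_topology open_openin[symmetric] ..

lemma continuous_fun_upd: "continuous_on UNIV (\<lambda>t. x(i := t))" for x :: "nat \<Rightarrow> real"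
proof (rule continuous_on_coordinatewise_then_product)
  show "continuous_on UNIV (\<lambda>t. (x(i := t)) j)" for j by (cases "j = i") auto
qed

text \<open>Changing a coordinate with index below n keeps all coordinates from n on zero, so near
  \<open>x i\<close> the line stays in the relatively open set S. Partial derivatives at points of S
  thus see only values on S.\<close>

lemma eventually_line:
  assumes "openin (Euclidean_space n) S" "x \<in> S" "i < n"
  shows "\<forall>\<^sub>F t in nhds (x i). x(i := t) \<in> S"
proof -
  obtain G where G: "open G" "S = G \<inter> {x. \<forall>i\<ge>n. x i = 0}"
    using assms(1) by (auto simp: openin_Euclidean_iff)
  have "open ((\<lambda>t. x(i := t)) -` G)"
    using open_vimage[OF G(1) continuous_fun_upd] .
  moreover have "x i \<in> (\<lambda>t. x(i := t)) -` G" using assms(2) G by simp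
  ultimately have "\<forall>\<^sub>F t in nhds (x i). t \<in> (\<lambda>t. x(i := t)) -` G" by (rule eventually_nhds_in_open)
  then show ?thesis by eventually_elim (use assms G in auto)
qed

lemma Ck_on_SucD:
  assumes "Ck_on n (Suc k) S f" "i < n" "x \<in> S"
  shows "((\<lambda>t. f (x(i := t))) has_real_derivative partial_deriv i f x) (at (x i))"
  using assms unfolding partial_deriv_def by (auto simp: DERIV_deriv_iff_real_differentiable)

lemma Ck_on_subset: "Ck_on n k S f \<Longrightarrow> T \<subseteq> S \<Longrightarrow> Ck_on n k T f"
proof (induction k arbitrary: f)
  case (Suc k)
  then show ?case by (auto dest: continuous_on_subset[where t = T])
qed (simp add: continuous_on_subset)

lemma Ck_on_cong:
  assumes "openin (Euclidean_space n) S" "\<And>x. x \<in> S \<Longrightarrow> f x = g x" "Ck_on n k S f"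
  shows "Ck_on n k S g"
  using assms(2,3)
proof (induction k arbitrary: f g)
  case 0
  then show ?case by (simp cong: continuous_on_cong)
next
  case (Suc k)
  have ev: "\<forall>\<^sub>F t in nhds (x i). f (x(i := t)) = g (x(i := t))" if "x \<in> S" "i < n" for x i
    using eventually_line[OF assms(1) that] by eventually_elim (use Suc.prems(1) in auto)
  have pd: "partial_deriv i f x = partial_deriv i g x" if "x \<in> S" "i < n" for x i
    unfolding partial_deriv_def by (rule deriv_cong_ev[OF ev[OF that]]) simp
  have df: "(\<lambda>t. g (x(i := t))) differentiable at (x i)" if "x \<in> S" "i < n" for x i
  proof -
    have "((\<lambda>t. f (x(i := t))) has_real_derivative partial_deriv i f x) (at (x i))"
      using Ck_on_SucD[OF Suc.prems(2) that(2,1)] .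
    then have "((\<lambda>t. g (x(i := t))) has_real_derivative partial_deriv i f x) (at (x i))"
      using DERIV_cong_ev[OF refl ev[OF that] refl] by simp
    then show ?thesis using real_differentiable_def by blast
  qed
  have "continuous_on S g" using Suc.prems by (simp cong: continuous_on_cong)
  moreover have "Ck_on n k S (partial_deriv i g)" if "i < n" for i
    by (rule Suc.IH[of "partial_deriv i f"]) (use Suc.prems that pd in auto)
  ultimately show ?case using df by simp
qed

text \<open>The derivative is supplied as some function g instead of
  \<open>partial_deriv i f\<close>, so that the sum, product and chain rules can be used with their
  explicit formulas.\<close>

lemma Ck_on_SucI:
  assumes S: "openin (Euclidean_space n) S" and "continuous_on S f"
    and g: "\<And>i. i < n \<Longrightarrow> \<exists>g. Ck_on n k S g \<and>
      (\<forall>x\<in>S. ((\<lambda>t. f (x(i := t))) has_real_derivative g x) (at (x i)))"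
  shows "Ck_on n (Suc k) S f"
proof -
  have "(\<forall>x\<in>S. (\<lambda>t. f (x(i := t))) differentiable at (x i)) \<and> Ck_on n k S (partial_deriv i f)"
    if i: "i < n" for i
  proof -
    obtain g where gk: "Ck_on n k S g"
      and gd: "\<And>x. x\<in>S \<Longrightarrow> ((\<lambda>t. f (x(i := t))) has_real_derivative g x) (at (x i))"
      using g[OF i] by blast
    have "Ck_on n k S (partial_deriv i f)"
      by (rule Ck_on_cong[OF S _ gk]) (simp add: partial_deriv_def DERIV_imp_deriv[OF gd])
    then show ?thesis using gd real_differentiable_def by blast
  qed
  then show ?thesis using assms(2) by simp
qed

lemma Ck_on_Suc_imp: "Ck_on n (Suc k) S f \<Longrightarrow> Ck_on n k S f"
proof (induction k arbitrary: f)
  case (Suc k)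
  then show ?case using Ck_on.simps(2)[of n "Suc k" S f] Ck_on.simps(2)[of n k S f] by blast
qed simp

lemma Ck_on_continuous: "Ck_on n k S f \<Longrightarrow> continuous_on S f"
  by (cases k) auto

lemma Ck_on_local:
  assumes "\<And>x. x \<in> S \<Longrightarrow> \<exists>T. openin (Euclidean_space n) T \<and> x \<in> T \<and> Ck_on n k (S \<inter> T) f"
    and S: "openin (Euclidean_space n) S"
  shows "Ck_on n k S f"
  using assms(1)
proof (induction k arbitrary: f)
  case 0
  have "continuous (at x within S) f" if x: "x \<in> S" for x
  proof -
    obtain T where T: "openin (Euclidean_space n) T" "x \<in> T" "continuous_on (S \<inter> T) f"
      using 0[OF x] by auto
    obtain G where G: "open G" "T = G \<inter> {x. \<forall>i\<ge>n. x i = 0}"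
      using T(1) by (auto simp: openin_Euclidean_iff)
    have "S \<subseteq> {x. \<forall>i\<ge>n. x i = 0}" using S by (auto simp: openin_Euclidean_iff)
    then have "S \<inter> G = S \<inter> T" using G by auto
    then have "at x within S = at x within (S \<inter> T)"
      using at_within_nhd[of x G S "S \<inter> T"] G T by auto
    then show ?thesis using T x by (simp add: continuous_on_eq_continuous_within)
  qed
  then show ?case by (simp add: continuous_on_eq_continuous_within)
next
  case (Suc k)
  have *: "Ck_on n k S f"
  proof (rule Suc.IH)
    fix x assume "x \<in> S"
    from Suc.prems[OF this] obtain T
      where T: "openin (Euclidean_space n) T" "x \<in> T" "Ck_on n (Suc k) (S \<inter> T) f" by blast
    show "\<exists>T. openin (Euclidean_space n) T \<and> x \<in> T \<and> Ck_on n k (S \<inter> T) f"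
      using T(1,2) Ck_on_Suc_imp[OF T(3)] by blast
  qed
  show ?case
  proof (rule Ck_on_SucI[OF S Ck_on_continuous[OF *]])
    fix i assume i: "i < n"
    have "Ck_on n k S (partial_deriv i f)"
    proof (rule Suc.IH)
      fix x assume "x \<in> S"
      then obtain T where "openin (Euclidean_space n) T" "x \<in> T" "Ck_on n (Suc k) (S \<inter> T) f"
        using Suc.prems by blast
      then show "\<exists>T. openin (Euclidean_space n) T \<and> x \<in> T \<and> Ck_on n k (S \<inter> T) (partial_deriv i f)"
        using i by auto
    qed
    moreover have "((\<lambda>t. f (x(i := t))) has_real_derivative partial_deriv i f x) (at (x i))"
      if x: "x \<in> S" for x
    proof -
      from Suc.prems[OF x] obtain T where T: "x \<in> T" "Ck_on n (Suc k) (S \<inter> T) f" by blast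
      show ?thesis by (rule Ck_on_SucD[OF T(2) i]) (use x T(1) in simp)
    qed
    ultimately show "\<exists>g. Ck_on n k S g \<and>
      (\<forall>x\<in>S. ((\<lambda>t. f (x(i := t))) has_real_derivative g x) (at (x i)))" by blast
  qed
qed

lemma Ck_on_const: "openin (Euclidean_space n) S \<Longrightarrow> Ck_on n k S (\<lambda>x. c)"
proof (induction k arbitrary: c)
  case (Suc k)
  have "\<exists>g. Ck_on n k S g \<and> (\<forall>x\<in>S. ((\<lambda>t. c) has_real_derivative g x) (at (x i)))" for i
    using Suc by (intro exI[of _ "\<lambda>x. 0"]) auto
  then show ?case by (intro Ck_on_SucI[OF Suc.prems]) auto
qed simp

lemma Ck_on_add:
  assumes "openin (Euclidean_space n) S" "Ck_on n k S f" "Ck_on n k S g"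
  shows "Ck_on n k S (\<lambda>x. f x + g x)"
  using assms(2,3)
proof (induction k arbitrary: f g)
  case (Suc k)
  show ?case
  proof (rule Ck_on_SucI[OF assms(1)])
    fix i assume i: "i < n"
    have "((\<lambda>t. f (x(i := t)) + g (x(i := t))) has_real_derivative
        partial_deriv i f x + partial_deriv i g x) (at (x i))" if "x \<in> S" for x
      by (rule DERIV_add[OF Ck_on_SucD[OF Suc.prems(1) i that] Ck_on_SucD[OF Suc.prems(2) i that]])
    moreover have "Ck_on n k S (\<lambda>x. partial_deriv i f x + partial_deriv i g x)"
      by (rule Suc.IH) (use Suc.prems i in auto)
    ultimately show "\<exists>h. Ck_on n k S h \<and>
      (\<forall>x\<in>S. ((\<lambda>t. f (x(i := t)) + g (x(i := t))) has_real_derivative h x) (at (x i)))"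
      by blast
  qed (use Suc.prems in \<open>auto intro: continuous_on_add\<close>)
qed (simp add: continuous_on_add)

lemma Ck_on_mult:
  assumes "openin (Euclidean_space n) S" "Ck_on n k S f" "Ck_on n k S g"
  shows "Ck_on n k S (\<lambda>x. f x * g x)"
  using assms(2,3)
proof (induction k arbitrary: f g)
  case (Suc k)
  show ?case
  proof (rule Ck_on_SucI[OF assms(1)])
    fix i assume i: "i < n"
    have "((\<lambda>t. f (x(i := t)) * g (x(i := t))) has_real_derivative
        partial_deriv i f x * g x + partial_deriv i g x * f x) (at (x i))" if "x \<in> S" for x
      by (rule DERIV_cong[OF DERIV_mult[OF Ck_on_SucD[OF Suc.prems(1) i that]
            Ck_on_SucD[OF Suc.prems(2) i that]]]) (simp add: fun_upd_triv)
    moreover have "Ck_on n k S (\<lambda>x. partial_deriv i f x * g x + partial_deriv i g x * f x)"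
      by (rule Ck_on_add[OF assms(1)]; rule Suc.IH)
        (use Suc.prems i Ck_on_Suc_imp[OF Suc.prems(1)] Ck_on_Suc_imp[OF Suc.prems(2)] in auto)
    ultimately show "\<exists>h. Ck_on n k S h \<and>
      (\<forall>x\<in>S. ((\<lambda>t. f (x(i := t)) * g (x(i := t))) has_real_derivative h x) (at (x i)))"
      by blast
  qed (use Suc.prems in \<open>auto intro: continuous_on_mult\<close>)
qed (simp add: continuous_on_mult)

text \<open>H is a sequence in which each function is the derivative of the preceding one. The
  derivative of \<open>H j \<circ> f\<close> involves \<open>H (Suc j)\<close>, so the induction on
  k runs over all j at once.\<close>

lemma Ck_on_compose:
  assumes S: "openin (Euclidean_space n) S" and f: "Ck_on n k S f"
    and H: "\<And>j t. (H j has_real_derivative H (Suc j) t) (at t)"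
  shows "Ck_on n k S (\<lambda>x. H j (f x))"
  using f
proof (induction k arbitrary: j f)
  case 0
  have "continuous_on UNIV (H j)"
    using H by (meson DERIV_isCont continuous_at_imp_continuous_on)
  then show ?case using continuous_on_compose2[of UNIV "H j" S f] 0 by simp
next
  case (Suc k)
  have "continuous_on UNIV (H j)"
    using H by (meson DERIV_isCont continuous_at_imp_continuous_on)
  then have cont: "continuous_on S (\<lambda>x. H j (f x))"
    using continuous_on_compose2[of UNIV "H j" S f] Ck_on_continuous[OF Suc.prems] by simp
  show ?case
  proof (rule Ck_on_SucI[OF S cont])
    fix i assume i: "i < n"
    have "((\<lambda>t. H j (f (x(i := t)))) has_real_derivative
        H (Suc j) (f x) * partial_deriv i f x) (at (x i))" if "x \<in> S" for x
      using DERIV_chain2[of "H j" _ "\<lambda>t. f (x(i := t))", OF _ Ck_on_SucD[OF Suc.prems i that]] H[of j]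
      by simp
    moreover have "Ck_on n k S (\<lambda>x. H (Suc j) (f x) * partial_deriv i f x)"
      by (rule Ck_on_mult[OF S Suc.IH]) (use Suc.prems i Ck_on_Suc_imp[OF Suc.prems] in auto)
    ultimately show "\<exists>g. Ck_on n k S g \<and>
      (\<forall>x\<in>S. ((\<lambda>t. H j (f (x(i := t)))) has_real_derivative g x) (at (x i)))" by blast
  qed
qed


section \<open>A flat function\<close>

text \<open>With s = 1/t the operator d/dt is -s^2 d/ds, so the derivative of p(s) exp(-s) is s^2 (p
  - p')(s) exp(-s). These are the polynomials in 1/t that occur in the derivatives of
  exp(-1/t).\<close>

primrec flat_poly :: "nat \<Rightarrow> real poly" where
  "flat_poly 0 = 1"
| "flat_poly (Suc k) = [:0, 0, 1:] * (flat_poly k - pderiv (flat_poly k))"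

definition flat_deriv :: "nat \<Rightarrow> real \<Rightarrow> real" where
  "flat_deriv k t = (if t > 0 then poly (flat_poly k) (1 / t) * exp (- (1 / t)) else 0)"

lemma poly_exp_tendsto_0: "((\<lambda>s. poly p s * exp (- s)) \<longlongrightarrow> 0) at_top" for p :: "real poly"
proof -
  have "((\<lambda>s. \<Sum>i\<le>degree p. coeff p i * (s ^ i / exp s)) \<longlongrightarrow> 0) at_top"
    using tendsto_sum[where f = "\<lambda>i s. coeff p i * (s ^ i / exp s)" and a = "\<lambda>i. 0" and I = "{..degree p}"
        and F = at_top]
      tendsto_mult_right_zero[OF tendsto_power_div_exp_0] by simp
  moreover have "(\<Sum>i\<le>degree p. coeff p i * (s ^ i / exp s)) = poly p s * exp (- s)" for s
    by (simp add: poly_altdef sum_distrib_right exp_minus divide_inverse mult.assoc)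
  ultimately show ?thesis by simp
qed

lemma flat_deriv_has_derivative: "(flat_deriv k has_real_derivative flat_deriv (Suc k) t) (at t)"
proof -
  consider "t > 0" | "t < 0" | "t = 0" by linarith
  then show ?thesis
  proof cases
    case 1
    have "((\<lambda>t. poly (flat_poly k) (1 / t) * exp (- (1 / t))) has_real_derivative
        poly (flat_poly (Suc k)) (1 / t) * exp (- (1 / t))) (at t)"
      using 1 by (auto intro!: derivative_eq_intros DERIV_chain2[OF poly_DERIV]
          simp: field_simps power2_eq_square)
    moreover have "\<forall>\<^sub>F s in nhds t. flat_deriv k s = poly (flat_poly k) (1 / s) * exp (- (1 / s))"
      using eventually_nhds_in_open[of "{0<..}" t] 1
      by (auto elim!: eventually_mono simp: flat_deriv_def)
    ultimately show ?thesis using 1 DERIV_cong_ev[of t t "flat_deriv k"]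
      by (simp add: flat_deriv_def)
  next
    case 2
    moreover have "\<forall>\<^sub>F s in nhds t. flat_deriv k s = 0"
      using eventually_nhds_in_open[of "{..<0}" t] 2
      by (auto elim!: eventually_mono simp: flat_deriv_def)
    ultimately show ?thesis using DERIV_cong_ev[of t t "flat_deriv k" "\<lambda>_. 0"]
      by (simp add: flat_deriv_def)
  next
    case 3
    \<comment> \<open>The difference quotient at 0 from the right is s p(s) exp(-s) with s = 1/t
      tending to infinity; \<open>[:0, 1:]\<close> supplies the factor s. From the left the quotient
      is zero.\<close>
    have "((\<lambda>t. flat_deriv k t / t) \<longlongrightarrow> 0) (at_right 0)"
    proof -
      have "((\<lambda>t. poly ([:0, 1:] * flat_poly k) (1 / t) * exp (- (1 / t))) \<longlongrightarrow> 0) (at_right (0::real))"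
        using filterlim_compose[OF poly_exp_tendsto_0[of "[:0, 1:] * flat_poly k"]
            filterlim_inverse_at_top_right] by (simp add: inverse_eq_divide)
      moreover have "\<forall>\<^sub>F t in at_right 0. poly ([:0, 1:] * flat_poly k) (1 / t) * exp (- (1 / t)) =
          flat_deriv k t / t"
        by (auto simp: eventually_at_right_field flat_deriv_def intro!: exI[of _ 1])
      ultimately show ?thesis by (rule Lim_transform_eventually)
    qed
    moreover have "((\<lambda>t. flat_deriv k t / t) \<longlongrightarrow> 0) (at_left 0)"
    proof (rule Lim_transform_eventually[OF tendsto_const])
      show "\<forall>\<^sub>F t in at_left 0. 0 = flat_deriv k t / t"
        by (auto simp: eventually_at_left_field flat_deriv_def intro!: exI[of _ "-1"])
    qed
    ultimately have "((\<lambda>t. flat_deriv k t / t) \<longlongrightarrow> 0) (at 0)"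
      by (simp add: filterlim_split_at)
    then show ?thesis using 3 by (simp add: DERIV_def flat_deriv_def)
  qed
qed

lemma flat_deriv_0: "flat_deriv 0 t = (if t > 0 then exp (- (1 / t)) else 0)"
  by (simp add: flat_deriv_def)


section \<open>Smooth functions on a manifold\<close>

lemma Euclidean_space_top_of_set: "Euclidean_space n = top_of_set {x. \<forall>i\<ge>n. x i = 0}"
  by (simp add: Euclidean_space_def euclidean_product_topology)

lemma Euclidean_box_nhd:
  assumes A: "openin (Euclidean_space n) A" and c: "c \<in> A"
  obtains r where "r > 0"
    "\<And>y. (\<forall>i\<ge>n. y i = 0) \<Longrightarrow> (\<And>i. i < n \<Longrightarrow> \<bar>y i - c i\<bar> < r) \<Longrightarrow> y \<in> A"
proof -
  obtain G where G: "open G" "A = G \<inter> {x. \<forall>i\<ge>n. x i = 0}"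
    using A by (auto simp: openin_Euclidean_iff)
  have "openin (product_topology (\<lambda>i. euclidean) UNIV) G"
    using G(1) by (simp add: euclidean_product_topology)
  from product_topology_open_contains_basis[OF this, of c] obtain X where
    X: "c \<in> PiE UNIV X" "\<And>i. open (X i)" "PiE UNIV X \<subseteq> G"
    using c G by auto
  have "\<exists>r>0. \<forall>t. \<bar>t - c i\<bar> < r \<longrightarrow> t \<in> X i" for i
  proof -
    have "c i \<in> X i" using X(1) by auto
    then obtain r where "r > 0" "ball (c i) r \<subseteq> X i" using X(2) openE by metis
    then show ?thesis by (intro exI[of _ r]) (auto simp: dist_real_def abs_minus_commute subset_iff)
  qed
  then obtain r where r: "\<And>i. r i > 0" "\<And>i t. \<bar>t - c i\<bar> < r i \<Longrightarrow> t \<in> X i" by metis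
  \<comment> \<open>The element 1 keeps the minimum defined for n = 0. From n on, y and c agree
    because both vanish.\<close>
  define r0 where "r0 = Min (insert 1 (r ` {..<n}))"
  have "r0 > 0" using r(1) by (auto simp: r0_def)
  moreover have "y \<in> A" if y: "\<forall>i\<ge>n. y i = 0" "\<And>i. i < n \<Longrightarrow> \<bar>y i - c i\<bar> < r0" for y
  proof -
    have "y i \<in> X i" for i
    proof (cases "i < n")
      case True
      then have "r0 \<le> r i" by (auto simp: r0_def)
      then show ?thesis using y(2)[OF True] r(2) by force
    next
      case False
      then have "y i = c i" using y(1) c G(2) by auto
      then show ?thesis using X(1) by auto
    qed
    then show ?thesis using X(3) G(2) y(1) by auto
  qed
  ultimately show ?thesis using that by blast
qed

text \<open>The points live in an infinite product, so compactness comes from Tychonoff: the ball is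
  a closed subset of a product of compact intervals whose factors are {0} from index n on.\<close>

lemma compact_Euclidean_ball:
  "compact {y. (\<forall>i::nat\<ge>n. y i = (0::real)) \<and> (\<Sum>i<n. (y i - c i)\<^sup>2) \<le> r}" (is "compact ?B")
proof -
  define X where "X i = (if i < n then {c i - sqrt r..c i + sqrt r} else {0})" for i
  have "compactin (product_topology (\<lambda>i. euclidean) UNIV) (PiE UNIV X)"
    unfolding compactin_PiE by (auto simp: X_def)
  then have "compact (PiE UNIV X)" by (simp add: euclidean_product_topology)
  moreover have "closed ?B"
  proof -
    have "closed (\<Inter>i\<in>{n..}. {y. y i = (0::real)})"
      by (intro closed_INT ballI closed_Collect_eq) simp_all
    moreover have "closed {y. (\<Sum>i<n. (y i - c i)\<^sup>2) \<le> r}"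
      by (intro closed_Collect_le continuous_intros) simp_all
    moreover have "?B = (\<Inter>i\<in>{n..}. {y. y i = 0}) \<inter> {y. (\<Sum>i<n. (y i - c i)\<^sup>2) \<le> r}" by auto
    ultimately show ?thesis by auto
  qed
  moreover have "?B \<subseteq> PiE UNIV X"
  proof
    fix y assume y: "y \<in> ?B"
    have "y i \<in> X i" for i
    proof (cases "i < n")
      case True
      have "(y i - c i)\<^sup>2 \<le> (\<Sum>i<n. (y i - c i)\<^sup>2)"
        by (rule member_le_sum) (use True in auto)
      also have "\<dots> \<le> r" using y by simp
      finally have "\<bar>y i - c i\<bar> \<le> sqrt r" using real_le_rsqrt[of "\<bar>y i - c i\<bar>"] by simp
      then show ?thesis using True by (auto simp: X_def)
    qed (use y in \<open>auto simp: X_def\<close>)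
    then show "y \<in> PiE UNIV X" by auto
  qed
  ultimately show ?thesis
    using compact_Int_closed[of "PiE UNIV X" ?B] by (simp add: Int_absorb1)
qed

context smooth_manifold
begin

lemma chart_inj: "(W, \<phi>) \<in> atlas M \<Longrightarrow> x \<in> W \<Longrightarrow> inv_into W \<phi> (\<phi> x) = x"
  using chart_homeo[of W \<phi>] by (auto simp: homeomorphism_def)

lemma chart_image_openin:
  assumes W: "(W, \<phi>) \<in> atlas M" and S: "open S"
  shows "openin (Euclidean_space (mdim M)) (\<phi> ` (S \<inter> W))"
proof -
  have "continuous_on (\<phi> ` W) (inv_into W \<phi>)"
    using chart_homeo[OF W] by (simp add: homeomorphism_def)
  then have "openin (top_of_set (\<phi> ` W)) (\<phi> ` W \<inter> inv_into W \<phi> -` S)"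
    using S by (rule continuous_openin_preimage_gen)
  moreover have "\<phi> ` W \<inter> inv_into W \<phi> -` S = \<phi> ` (S \<inter> W)"
    using chart_inj[OF W] by force
  ultimately show ?thesis
    using chart_image_open[OF W] by (auto simp: Euclidean_space_top_of_set intro: openin_trans)
qed

lemma smooth_fun_on_iff: "smooth_fun_on M S f \<longleftrightarrow> (\<forall>W \<phi> k. (W, \<phi>) \<in> atlas M \<longrightarrow>
    Ck_on (mdim M) k (\<phi> ` (S \<inter> W)) (\<lambda>y. f (inv_into W \<phi> y)))"
  by (fastforce simp: smooth_fun_on_def Cinf_on_def comp_def)

lemma smooth_fun_onI:
  assumes "\<And>W \<phi> k. (W, \<phi>) \<in> atlas M \<Longrightarrow> Ck_on (mdim M) k (\<phi> ` (S \<inter> W)) (\<lambda>y. f (inv_into W \<phi> y))"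
  shows "smooth_fun_on M S f"
  using assms by (simp add: smooth_fun_on_iff)

lemma smooth_fun_onD:
  "smooth_fun_on M S f \<Longrightarrow> (W, \<phi>) \<in> atlas M \<Longrightarrow>
    Ck_on (mdim M) k (\<phi> ` (S \<inter> W)) (\<lambda>y. f (inv_into W \<phi> y))"
  by (simp add: smooth_fun_on_iff)

lemma smooth_fun_on_cong:
  assumes "open S" "\<And>x. x \<in> S \<Longrightarrow> f x = g x" "smooth_fun_on M S f"
  shows "smooth_fun_on M S g"
proof (rule smooth_fun_onI)
  fix W \<phi> k assume W: "(W, \<phi>) \<in> atlas M"
  show "Ck_on (mdim M) k (\<phi> ` (S \<inter> W)) (\<lambda>y. g (inv_into W \<phi> y))"
    by (rule Ck_on_cong[OF chart_image_openin[OF W assms(1)] _ smooth_fun_onD[OF assms(3) W]])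
      (use assms(2) chart_inj[OF W] in auto)
qed

lemma smooth_fun_on_subset: "smooth_fun_on M S f \<Longrightarrow> T \<subseteq> S \<Longrightarrow> smooth_fun_on M T f"
  by (rule smooth_fun_onI, rule Ck_on_subset[OF smooth_fun_onD]) auto

lemma smooth_fun_on_const: "open S \<Longrightarrow> smooth_fun_on M S (\<lambda>x. c)"
  by (intro smooth_fun_onI Ck_on_const chart_image_openin)

lemma smooth_fun_on_add:
  "open S \<Longrightarrow> smooth_fun_on M S f \<Longrightarrow> smooth_fun_on M S g \<Longrightarrow> smooth_fun_on M S (\<lambda>x. f x + g x)"
  by (rule smooth_fun_onI) (simp add: Ck_on_add chart_image_openin smooth_fun_onD)

lemma smooth_fun_on_mult:
  "open S \<Longrightarrow> smooth_fun_on M S f \<Longrightarrow> smooth_fun_on M S g \<Longrightarrow> smooth_fun_on M S (\<lambda>x. f x * g x)"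
  by (rule smooth_fun_onI) (simp add: Ck_on_mult chart_image_openin smooth_fun_onD)

lemma smooth_fun_on_sum:
  assumes "open S" "\<And>i. i \<in> I \<Longrightarrow> smooth_fun_on M S (f i)"
  shows "smooth_fun_on M S (\<lambda>x. \<Sum>i\<in>I. f i x)"
  using assms(2)
  by (induction I rule: infinite_finite_induct)
    (simp_all add: smooth_fun_on_const smooth_fun_on_add assms(1))

lemma smooth_fun_on_diff:
  assumes "open S" "smooth_fun_on M S f" "smooth_fun_on M S g"
  shows "smooth_fun_on M S (\<lambda>x. f x - g x)"
  using smooth_fun_on_add[OF assms(1,2) smooth_fun_on_mult[OF assms(1) smooth_fun_on_const[OF assms(1), of "-1"] assms(3)]]
  by simp

lemma smooth_fun_on_compose:
  assumes "open S" "smooth_fun_on M S f" "\<And>j t. (H j has_real_derivative H (Suc j) t) (at t)"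
  shows "smooth_fun_on M S (\<lambda>x. H j (f x))"
  by (intro smooth_fun_onI Ck_on_compose[OF chart_image_openin[OF _ assms(1)] smooth_fun_onD[OF assms(2)]] assms(3))

lemma smooth_fun_on_local:
  assumes S: "open S"
    and loc: "\<And>x. x \<in> S \<Longrightarrow> \<exists>N. open N \<and> x \<in> N \<and> smooth_fun_on M (S \<inter> N) f"
  shows "smooth_fun_on M S f"
proof (rule smooth_fun_onI, rule Ck_on_local)
  fix W \<phi> k assume W: "(W, \<phi>) \<in> atlas M"
  show "openin (Euclidean_space (mdim M)) (\<phi> ` (S \<inter> W))" by (rule chart_image_openin[OF W S])
  fix y assume "y \<in> \<phi> ` (S \<inter> W)"
  then obtain x where x: "x \<in> S" "x \<in> W" "y = \<phi> x" by auto
  from loc[OF x(1)] obtain N where N: "open N" "x \<in> N" "smooth_fun_on M (S \<inter> N) f" by blast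
  have "\<phi> ` (S \<inter> W) \<inter> \<phi> ` (N \<inter> W) = \<phi> ` (S \<inter> N \<inter> W)"
    using inj_on_image_Int[OF inj_on_inverseI[of W "inv_into W \<phi>" \<phi>, OF chart_inj[OF W]], of "S \<inter> W" "N \<inter> W"]
    by (simp add: Int_ac)
  then show "\<exists>T. openin (Euclidean_space (mdim M)) T \<and> y \<in> T \<and>
      Ck_on (mdim M) k (\<phi> ` (S \<inter> W) \<inter> T) (\<lambda>y. f (inv_into W \<phi> y))"
    using smooth_fun_onD[OF N(3) W] chart_image_openin[OF W N(1)] x N(2)
    by (intro exI[of _ "\<phi> ` (N \<inter> W)"]) auto
qed

lemma chart_component_smooth:
  assumes "(W, \<phi>) \<in> atlas M" "i < mdim M"
  shows "smooth_fun_on M W (\<lambda>x. \<phi> x i)"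
  using chart_compat[OF _ assms] by (intro smooth_fun_onI) (simp add: Cinf_on_def Int_commute)

lemma Cinf_const: "(\<lambda>x. c) \<in> Cinf M"
  and Cinf_diff: "f \<in> Cinf M \<Longrightarrow> g \<in> Cinf M \<Longrightarrow> (\<lambda>x. f x - g x) \<in> Cinf M"
  and Cinf_mult: "f \<in> Cinf M \<Longrightarrow> g \<in> Cinf M \<Longrightarrow> (\<lambda>x. f x * g x) \<in> Cinf M"
  by (simp_all add: Cinf_def smooth_fun_on_const smooth_fun_on_add smooth_fun_on_mult smooth_fun_on_diff)

lemma Cinf_sum: "(\<And>i. i \<in> I \<Longrightarrow> f i \<in> Cinf M) \<Longrightarrow> (\<lambda>x. \<Sum>i\<in>I. f i x) \<in> Cinf M"
  by (simp add: Cinf_def smooth_fun_on_sum)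

lemma Cinf_on: "f \<in> Cinf M \<Longrightarrow> smooth_fun_on M S f"
  by (auto simp: Cinf_def intro: smooth_fun_on_subset)

section \<open>Cut-off functions and extension by zero\<close>

text \<open>The open sets U and -K cover the manifold. On the first both factors are smooth as far
  as S reaches; on the second the product is 0, whatever the values of f there.\<close>

lemma bump_mult_smooth:
  assumes "\<beta> \<in> Cinf M" "closed K" "\<And>x. x \<notin> K \<Longrightarrow> \<beta> x = 0" "K \<subseteq> U" "open U" "open S"
    and f: "smooth_fun_on M (S \<inter> U) f"
  shows "smooth_fun_on M S (\<lambda>x. \<beta> x * f x)"
proof (rule smooth_fun_on_local[OF \<open>open S\<close>])
  fix x assume "x \<in> S"
  show "\<exists>N. open N \<and> x \<in> N \<and> smooth_fun_on M (S \<inter> N) (\<lambda>x. \<beta> x * f x)"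
  proof (cases "x \<in> K")
    case True
    then show ?thesis
      using assms(4-6) by (intro exI[of _ U] conjI smooth_fun_on_mult[OF _ Cinf_on[OF assms(1)] f]) auto
  next
    case False
    have "smooth_fun_on M (S \<inter> - K) (\<lambda>x. \<beta> x * f x)"
      by (rule smooth_fun_on_cong[OF _ _ smooth_fun_on_const[of _ 0]])
        (use assms in \<open>auto simp: open_Int open_Compl\<close>)
    then show ?thesis using False assms(2) by (intro exI[of _ "- K"]) auto
  qed
qed

lemma bump_exists:
  assumes U: "open U" and x0: "x0 \<in> U"
  obtains \<beta> K N where "\<beta> \<in> Cinf M" "closed K" "\<And>x. x \<notin> K \<Longrightarrow> \<beta> x = 0" "K \<subseteq> U"
    "open N" "x0 \<in> N" "\<And>x. x \<in> N \<Longrightarrow> \<beta> x = 1"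
proof -
  have "x0 \<in> \<Union>(fst ` atlas M)" by (simp add: atlas_cover)
  then obtain W \<phi> where W: "(W, \<phi>) \<in> atlas M" "x0 \<in> W" by auto
  define n where "n = mdim M"
  have oW: "open W" using chart_open[OF W(1)] .
  have "\<phi> x0 \<in> \<phi> ` (U \<inter> W)" using x0 W(2) by simp
  from Euclidean_box_nhd[OF chart_image_openin[OF W(1) U] this] obtain r where r: "r > 0"
    "\<And>y. (\<forall>i\<ge>n. y i = 0) \<Longrightarrow> (\<And>i. i < n \<Longrightarrow> \<bar>y i - \<phi> x0 i\<bar> < r) \<Longrightarrow> y \<in> \<phi> ` (U \<inter> W)"
    unfolding n_def by blast
  \<comment> \<open>Radius r/2 places the closed Euclidean ball B inside the open box of half-width
    r, hence inside the chart image of U.\<close>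
  define s where "s = (r / 2)\<^sup>2"
  define q where "q y = (\<Sum>i<n. (y i - \<phi> x0 i)\<^sup>2)" for y
  define B where "B = {y. (\<forall>i\<ge>n. y i = 0) \<and> q y \<le> s}"
  have s: "s > 0" using r(1) by (simp add: s_def)
  have B: "B \<subseteq> \<phi> ` (U \<inter> W)"
  proof
    fix y assume y: "y \<in> B"
    show "y \<in> \<phi> ` (U \<inter> W)"
    proof (rule r(2))
      fix i assume i: "i < n"
      have "(y i - \<phi> x0 i)\<^sup>2 \<le> q y" unfolding q_def by (rule member_le_sum) (use i in auto)
      also have "\<dots> \<le> (r / 2)\<^sup>2" using y by (simp add: B_def s_def)
      finally have "\<bar>y i - \<phi> x0 i\<bar> \<le> \<bar>r / 2\<bar>" by (simp only: abs_le_square_iff)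
      then show "\<bar>y i - \<phi> x0 i\<bar> < r" using r(1) by simp
    qed (use y in \<open>simp add: B_def\<close>)
  qed
  have W0: "\<forall>i\<ge>n. \<phi> x i = 0" if "x \<in> W" for x
  proof -
    have "\<phi> ` W \<subseteq> topspace (Euclidean_space n)"
      using chart_image_open[OF W(1)] unfolding n_def by (rule openin_subset)
    then show ?thesis using that by (auto simp: topspace_Euclidean_space)
  qed
  define K where "K = inv_into W \<phi> ` B"
  have Kiff: "x \<in> K \<longleftrightarrow> q (\<phi> x) \<le> s" if "x \<in> W" for x
  proof
    assume "x \<in> K"
    then obtain y where y: "y \<in> B" "x = inv_into W \<phi> y" by (auto simp: K_def)
    then obtain x' where "x' \<in> W" "y = \<phi> x'" using B by auto
    then show "q (\<phi> x) \<le> s" using y chart_inj[OF W(1)] by (auto simp: B_def)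
  next
    assume "q (\<phi> x) \<le> s"
    then have "\<phi> x \<in> B" using W0[OF that] by (simp add: B_def)
    then show "x \<in> K" using chart_inj[OF W(1) that] unfolding K_def by force
  qed
  have KUW: "K \<subseteq> U \<inter> W"
  proof
    fix x assume "x \<in> K"
    then obtain x' where "x' \<in> U \<inter> W" "x = inv_into W \<phi> (\<phi> x')" using B by (auto simp: K_def)
    then show "x \<in> U \<inter> W" using chart_inj[OF W(1)] by auto
  qed
  \<comment> \<open>Compactness makes K closed in the whole manifold and not only in W; here the
    Hausdorff property enters. Extension by zero is smooth because the complement of K is then
    open.\<close>
  have "compact B" using compact_Euclidean_ball[of n "\<phi> x0" s] by (simp add: B_def q_def)
  moreover have "continuous_on B (inv_into W \<phi>)"
    by (rule continuous_on_subset[of "\<phi> ` W"]) (use chart_homeo[OF W(1)] B in \<open>auto simp: homeomorphism_def\<close>)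
  ultimately have "closed K" unfolding K_def by (intro compact_imp_closed compact_continuous_image)
  have qs: "smooth_fun_on M W (\<lambda>x. q (\<phi> x))"
    unfolding q_def power2_eq_square n_def
    by (intro smooth_fun_on_sum smooth_fun_on_mult smooth_fun_on_diff chart_component_smooth W oW smooth_fun_on_const) auto
  define g where "g = flat_deriv 0"
  have gs: "smooth_fun_on M S (\<lambda>x. g (f x))" if "open S" "smooth_fun_on M S f" for S f
    unfolding g_def using that flat_deriv_has_derivative by (rule smooth_fun_on_compose)
  have gnn: "g t \<ge> 0" and gpos: "t > 0 \<Longrightarrow> g t > 0" and g0: "t \<le> 0 \<Longrightarrow> g t = 0" for t
    by (simp_all add: g_def flat_deriv_0)
  have gmono: "t \<le> t' \<Longrightarrow> g t \<le> g t'" for t t'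
    by (auto simp: g_def flat_deriv_0 frac_le)
  \<comment> \<open>A plateau from two nested copies of g. For q below s/2 the inner g is 0 and h =
    g 1 / g 1 = 1. For q above s the inner quotient is at least 1 by monotonicity, so the outer g
    has an argument at most 0 and vanishes.\<close>
  define h where "h x = g (1 - g (q (\<phi> x) - s / 2) * inverse (g (s / 2))) * inverse (g 1)" for x
  have hs: "smooth_fun_on M W h"
    unfolding h_def
    by (intro smooth_fun_on_mult smooth_fun_on_diff smooth_fun_on_const gs qs oW)
  have h1: "h x = 1" if "q (\<phi> x) < s / 2" for x
    using that gpos[of 1] by (simp add: h_def g0)
  have h0: "h x = 0" if "q (\<phi> x) > s" for x
  proof -
    have "g (q (\<phi> x) - s / 2) \<ge> g (s / 2)" using that by (intro gmono) simp
    then have "g (q (\<phi> x) - s / 2) * inverse (g (s / 2)) \<ge> 1"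
      using gpos[of "s / 2"] s by (simp add: field_simps)
    then show ?thesis by (simp add: h_def g0)
  qed
  define \<beta> where "\<beta> x = (if x \<in> W then h x else 0)" for x
  have chiK: "\<beta> x = 0" if "x \<notin> K" for x
    using that h0 Kiff by (auto simp: \<beta>_def)
  have "smooth_fun_on M UNIV \<beta>"
  proof (rule smooth_fun_on_local)
    fix x
    show "\<exists>N. open N \<and> x \<in> N \<and> smooth_fun_on M (UNIV \<inter> N) \<beta>"
    proof (cases "x \<in> W")
      case True
      have "smooth_fun_on M W \<beta>"
        by (rule smooth_fun_on_cong[OF oW _ hs]) (simp add: \<beta>_def)
      then show ?thesis using True oW by auto
    next
      case False
      have "smooth_fun_on M (- K) \<beta>"
        by (rule smooth_fun_on_cong[OF _ _ smooth_fun_on_const[of _ 0]])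
          (use \<open>closed K\<close> chiK in auto)
      then show ?thesis using False KUW \<open>closed K\<close> by (intro exI[of _ "- K"]) auto
    qed
  qed simp
  then have "\<beta> \<in> Cinf M" by (simp add: Cinf_def)
  moreover have "open (W \<inter> (\<lambda>x. q (\<phi> x)) -` {..<s / 2})"
  proof (rule continuous_open_preimage[OF _ oW])
    have "continuous_on W \<phi>" using chart_homeo[OF W(1)] by (simp add: homeomorphism_def)
    then show "continuous_on W (\<lambda>x. q (\<phi> x))"
      unfolding q_def
      by (intro continuous_on_sum continuous_on_power continuous_on_diff continuous_on_const)
        (rule continuous_on_product_then_coordinatewise)
  qed simp
  moreover have "x0 \<in> W \<inter> (\<lambda>x. q (\<phi> x)) -` {..<s / 2}"
    using W(2) s by (simp add: q_def)
  moreover have "\<beta> x = 1" if "x \<in> W \<inter> (\<lambda>x. q (\<phi> x)) -` {..<s / 2}" for x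
    using that h1[of x] by (simp add: \<beta>_def)
  ultimately show ?thesis
    using that[of \<beta> K "W \<inter> (\<lambda>x. q (\<phi> x)) -` {..<s / 2}"] \<open>closed K\<close> chiK KUW
    by blast
qed

section \<open>Smoothness of derivatives along vector fields\<close>

lemma smooth_tangent_section_apply:
  assumes X: "smooth_section_on M (tangent_bundle M) S X" and S: "open S" and f: "f \<in> Cinf M"
  shows "smooth_fun_on M S (\<lambda>x. X x f)"
proof (rule smooth_fun_onI)
  fix W \<phi> k assume W: "(W, \<phi>) \<in> atlas M"
  let ?n = "mdim M"
  from X W obtain c where c: "\<And>i. i < ?n \<Longrightarrow> smooth_fun_on M (S \<inter> W) (c i)"
    "\<And>x. x \<in> S \<inter> W \<Longrightarrow> X x = (\<Sum>i<?n. c i x *\<^sub>R coord_vector M W \<phi> i x)"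
    by (force simp: smooth_section_on_def tangent_bundle_def)
  have op: "openin (Euclidean_space ?n) (\<phi> ` (S \<inter> W))" by (rule chart_image_openin[OF W S])
  \<comment> \<open>Order \<open>Suc k\<close> is taken for f since passing to its partial
    derivatives costs one order.\<close>
  have "Ck_on ?n (Suc k) (\<phi> ` (S \<inter> W)) (\<lambda>y. f (inv_into W \<phi> y))"
    by (rule smooth_fun_onD[OF Cinf_on[OF f] W])
  then have pd: "Ck_on ?n k (\<phi> ` (S \<inter> W)) (partial_deriv i (f \<circ> inv_into W \<phi>))" if "i < ?n" for i
    using that by (simp add: comp_def)
  have "Ck_on ?n k (\<phi> ` (S \<inter> W)) (\<lambda>y. \<Sum>i\<in>I. c i (inv_into W \<phi> y) * partial_deriv i (f \<circ> inv_into W \<phi>) y)"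
    if "I \<subseteq> {..<?n}" for I
    using finite_subset[OF that finite_lessThan] that
  proof (induction I rule: finite_induct)
    case (insert i I)
    have "Ck_on ?n k (\<phi> ` (S \<inter> W \<inter> W)) (\<lambda>y. c i (inv_into W \<phi> y))"
      by (rule smooth_fun_onD[OF c(1) W]) (use insert.prems in auto)
    then have "Ck_on ?n k (\<phi> ` (S \<inter> W)) (\<lambda>y. c i (inv_into W \<phi> y))" by (simp add: Int_assoc)
    moreover have "i < ?n" "I \<subseteq> {..<?n}" using insert.prems by auto
    ultimately have "Ck_on ?n k (\<phi> ` (S \<inter> W)) (\<lambda>y. c i (inv_into W \<phi> y) *
        partial_deriv i (f \<circ> inv_into W \<phi>) y +
        (\<Sum>i\<in>I. c i (inv_into W \<phi> y) * partial_deriv i (f \<circ> inv_into W \<phi>) y))"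
      using insert.IH by (intro Ck_on_add[OF op] Ck_on_mult[OF op] pd)
    then show ?case by (simp only: sum.insert[OF insert.hyps])
  qed (simp add: Ck_on_const op)
  from this[OF order_refl]
  show "Ck_on ?n k (\<phi> ` (S \<inter> W)) (\<lambda>y. X (inv_into W \<phi> y) f)"
    by (rule Ck_on_cong[OF op, rotated])
      (auto simp: c(2) sum_fun_apply coord_vector_def f chart_inj[OF W])
qed

end


section \<open>Alternating forms\<close>

text \<open>If an entry of \<open>us\<close> or \<open>ws\<close> lies outside V, all three values
  are the default 0, so linearity in one slot holds for arbitrary surrounding lists.\<close>

lemma alt_forms_linear:
  assumes w: "\<omega> \<in> alt_forms V" and v: "v \<in> V" "w \<in> V"
  shows "\<omega> (us @ (a *\<^sub>R v + b *\<^sub>R w) # ws) = a * \<omega> (us @ v # ws) + b * \<omega> (us @ w # ws)"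
proof (cases "set us \<subseteq> V \<and> set ws \<subseteq> V")
  case True
  then show ?thesis using alt_formsD(2)[OF w _ _ v] by blast
next
  case False
  then have "\<omega> (us @ u # ws) = 0" for u by (intro alt_formsD(1)[OF w]) auto
  then show ?thesis by simp
qed

lemma alt_forms_add:
  "\<omega> \<in> alt_forms V \<Longrightarrow> v \<in> V \<Longrightarrow> w \<in> V \<Longrightarrow> \<omega> (us @ (v + w) # ws) = \<omega> (us @ v # ws) + \<omega> (us @ w # ws)"
  using alt_forms_linear[of \<omega> V v w us 1 1 ws] by simp

lemma alt_forms_scale:
  "\<omega> \<in> alt_forms V \<Longrightarrow> v \<in> V \<Longrightarrow> \<omega> (us @ (a *\<^sub>R v) # ws) = a * \<omega> (us @ v # ws)"
  using alt_forms_linear[of \<omega> V v v us a 0 ws] by simp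

lemma alt_forms_sum:
  assumes w: "\<omega> \<in> alt_forms V" and V: "subspace V" and e: "\<And>i. i \<in> N \<Longrightarrow> e i \<in> V"
  shows "\<omega> (us @ (\<Sum>i\<in>N. c i *\<^sub>R e i) # ws) = (\<Sum>i\<in>N. c i * \<omega> (us @ e i # ws))"
  using e
proof (induction N rule: infinite_finite_induct)
  case (insert i N)
  have "(\<Sum>i\<in>N. c i *\<^sub>R e i) \<in> V"
    using insert.prems by (intro subspace_sum[OF V] subspace_scale[OF V]) auto
  then show ?case
    using insert V by (simp add: alt_forms_add[OF w] alt_forms_scale[OF w] subspace_scale)
qed (use alt_forms_scale[OF w, of 0 us 0 ws] subspace_0[OF V] in auto)

lemma alt_forms_repeat: "\<omega> \<in> alt_forms V \<Longrightarrow> \<not> distinct vs \<Longrightarrow> \<omega> vs = 0"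
  using alt_formsD(1,3) by blast

text \<open>Polarization: the value with v + w in both slots is 0, and so are the two terms with
  equal entries in its expansion.\<close>

lemma alt_forms_swap:
  assumes w: "\<omega> \<in> alt_forms V" and v: "v \<in> V" "w \<in> V"
  shows "\<omega> (us @ v # ws @ w # zs) = - \<omega> (us @ w # ws @ v # zs)"
proof -
  have rep: "\<omega> (us @ u # ws @ u # zs) = 0" for u by (rule alt_forms_repeat[OF w]) auto
  have "0 = \<omega> (us @ v # ws @ (v + w) # zs) + \<omega> (us @ w # ws @ (v + w) # zs)"
    using alt_forms_add[OF w v, of us "ws @ (v + w) # zs"] by (simp add: rep)
  moreover have "\<omega> (us @ u # ws @ (v + w) # zs) = \<omega> (us @ u # ws @ v # zs) + \<omega> (us @ u # ws @ w # zs)" for u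
    using alt_forms_add[OF w v, of "us @ u # ws" zs] by simp
  ultimately show ?thesis by (simp add: rep)
qed

lemma alt_forms_move:
  assumes w: "\<omega> \<in> alt_forms V" and v: "v \<in> V"
  shows "set ws \<subseteq> V \<Longrightarrow> \<omega> (us @ v # ws @ zs) = (-1) ^ length ws * \<omega> (us @ ws @ v # zs)"
proof (induction ws arbitrary: us)
  case (Cons x ws)
  have "\<omega> (us @ v # (x # ws) @ zs) = - \<omega> ((us @ [x]) @ v # ws @ zs)"
    using alt_forms_swap[OF w v, of x us "[]" "ws @ zs"] Cons.prems by simp
  also have "\<dots> = - ((-1) ^ length ws * \<omega> ((us @ [x]) @ ws @ v # zs))"
    using Cons.prems by (subst Cons.IH) auto
  finally show ?case by simp
qed simp

lemma alt_forms_lincomb: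
  assumes "\<And>i. i \<in> I \<Longrightarrow> \<omega> i \<in> alt_forms V"
  shows "(\<lambda>vs. \<Sum>i\<in>I. c i * \<omega> i vs) \<in> alt_forms V"
proof (rule alt_formsI)
  fix us ws v w a b assume "v \<in> V" "w \<in> V"
  then have "\<omega> i (us @ (a *\<^sub>R v + b *\<^sub>R w) # ws) = a * \<omega> i (us @ v # ws) + b * \<omega> i (us @ w # ws)"
    if "i \<in> I" for i by (rule alt_forms_linear[OF assms[OF that]])
  then show "(\<Sum>i\<in>I. c i * \<omega> i (us @ (a *\<^sub>R v + b *\<^sub>R w) # ws)) =
      a * (\<Sum>i\<in>I. c i * \<omega> i (us @ v # ws)) + b * (\<Sum>i\<in>I. c i * \<omega> i (us @ w # ws))"
    by (simp add: sum_distrib_left sum.distrib[symmetric] algebra_simps)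
qed (use alt_formsD(1)[OF assms] alt_formsD(3)[OF assms] in \<open>auto intro!: sum.neutral\<close>)

lemma alt_forms_linear_comb2:
  assumes "\<omega> \<in> alt_forms V" "\<theta> \<in> alt_forms V"
  shows "(\<lambda>vs. a * \<omega> vs + b * \<theta> vs) \<in> alt_forms V"
  using alt_forms_lincomb[of "{True, False}" "\<lambda>i. if i then \<omega> else \<theta>" V "\<lambda>i. if i then a else b"] assms
  by simp

lemma alt_forms_part:
  assumes w: "\<omega> \<in> alt_forms V"
  shows "(\<lambda>vs. if length vs = p then \<omega> vs else 0) \<in> alt_forms V"
  by (rule alt_formsI) (simp_all add: alt_formsD(1)[OF w] alt_forms_linear[OF w] alt_forms_repeat[OF w])

lemma alt_forms_pullback:
  assumes w: "\<omega> \<in> alt_forms W" and \<kappa>: "linear \<kappa>" "\<kappa> ` V \<subseteq> W" and V: "subspace V"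
  shows "(\<lambda>vs. if set vs \<subseteq> V then \<omega> (map \<kappa> vs) else 0) \<in> alt_forms V"
proof (rule alt_formsI)
  fix us ws v w a b assume *: "set us \<subseteq> V" "set ws \<subseteq> V" "v \<in> V" "w \<in> V"
  have "a *\<^sub>R v + b *\<^sub>R w \<in> V" using V * by (simp add: subspace_add subspace_scale)
  moreover have "\<kappa> v \<in> W" "\<kappa> w \<in> W" using \<kappa>(2) * by auto
  ultimately show "(if set (us @ (a *\<^sub>R v + b *\<^sub>R w) # ws) \<subseteq> V
      then \<omega> (map \<kappa> (us @ (a *\<^sub>R v + b *\<^sub>R w) # ws)) else 0) =
      a * (if set (us @ v # ws) \<subseteq> V then \<omega> (map \<kappa> (us @ v # ws)) else 0) +
      b * (if set (us @ w # ws) \<subseteq> V then \<omega> (map \<kappa> (us @ w # ws)) else 0)"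
    using * by (simp add: linear_add[OF \<kappa>(1)] linear_scale[OF \<kappa>(1)] alt_forms_linear[OF w])
next
  fix vs :: "'b list" assume "\<not> distinct vs"
  then have "\<not> distinct (map \<kappa> vs)" by (simp add: distinct_map)
  then show "(if set vs \<subseteq> V then \<omega> (map \<kappa> vs) else 0) = 0"
    by (simp add: alt_forms_repeat[OF w])
qed simp

lemma sorted_list_of_set_append:
  fixes A B :: "nat set"
  assumes "finite A" "finite B" "\<And>a b. a \<in> A \<Longrightarrow> b \<in> B \<Longrightarrow> a < b"
  shows "sorted_list_of_set (A \<union> B) = sorted_list_of_set A @ sorted_list_of_set B"
proof (rule sorted_distinct_set_unique)
  show "sorted (sorted_list_of_set A @ sorted_list_of_set B)"
    unfolding sorted_append using assms by (simp add: order_less_imp_le)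
  show "distinct (sorted_list_of_set A @ sorted_list_of_set B)"
    unfolding distinct_append using assms by force
qed (use assms in simp_all)

lemma sorted_list_of_set_split:
  fixes J :: "nat set"
  assumes "finite J" "i \<notin> J"
  shows "sorted_list_of_set J = sorted_list_of_set {j \<in> J. j < i} @ sorted_list_of_set {j \<in> J. i < j}"
    and "sorted_list_of_set (insert i J) =
      sorted_list_of_set {j \<in> J. j < i} @ i # sorted_list_of_set {j \<in> J. i < j}"
proof -
  let ?l = "{j \<in> J. j < i}" and ?r = "{j \<in> J. i < j}"
  have J: "J = ?l \<union> ?r" "insert i J = ?l \<union> ({i} \<union> ?r)"
    using assms(2) by (auto simp: not_less_iff_gr_or_eq)
  show "sorted_list_of_set J = sorted_list_of_set ?l @ sorted_list_of_set ?r"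
    by (subst J(1), rule sorted_list_of_set_append) (use assms(1) in auto)
  have "sorted_list_of_set (insert i J) = sorted_list_of_set ?l @ sorted_list_of_set ({i} \<union> ?r)"
    by (subst J(2), rule sorted_list_of_set_append) (use assms(1) in auto)
  also have "sorted_list_of_set ({i} \<union> ?r) = i # sorted_list_of_set ?r"
    by (subst sorted_list_of_set_append) (use assms(1) in auto)
  finally show "sorted_list_of_set (insert i J) = sorted_list_of_set ?l @ i # sorted_list_of_set ?r" .
qed

text \<open>To reach its place in the increasing list, \<open>e i\<close> passes exactly the entries
  with index below i. The sign is the one in the Laplace expansion of \<open>minor\<close>.\<close>

lemma alt_forms_insert:
  fixes J :: "nat set"
  assumes w: "\<omega> \<in> alt_forms V" and J: "finite J" "i \<notin> J" and e: "\<And>j. j \<in> insert i J \<Longrightarrow> e j \<in> V"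
  shows "\<omega> (e i # map e (sorted_list_of_set J)) =
    (-1) ^ card {j \<in> J. j < i} * \<omega> (map e (sorted_list_of_set (insert i J)))"
proof -
  let ?l = "sorted_list_of_set {j \<in> J. j < i}" and ?r = "sorted_list_of_set {j \<in> J. i < j}"
  have "set (map e ?l) \<subseteq> V" using J e by auto
  then have "\<omega> ([] @ e i # map e ?l @ map e ?r) =
      (-1) ^ length (map e ?l) * \<omega> ([] @ map e ?l @ e i # map e ?r)"
    by (intro alt_forms_move[OF w]) (use e in auto)
  then show ?thesis
    by (simp only: sorted_list_of_set_split[OF J]) simp
qed


section \<open>Minors and dual bases of alternating forms\<close>

text \<open>The minor with rows \<open>cs\<close> and columns \<open>I\<close>, by Laplace expansion along the first row.\<close>

primrec minor :: "(nat \<Rightarrow> real) list \<Rightarrow> nat set \<Rightarrow> real" where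
  "minor [] I = (if I = {} then 1 else 0)"
| "minor (c # cs) I = (\<Sum>i\<in>I. (-1) ^ card {j\<in>I. j < i} * c i * minor cs (I - {i}))"

text \<open>By multilinearity the first vector becomes a combination of the \<open>e i\<close>; the
  induction hypothesis applies to the form with \<open>e i\<close> put into its first slot. Sorting
  i into the index set then reproduces the Laplace expansion along the first row.\<close>

lemma alt_forms_expand:
  assumes w: "\<omega> \<in> alt_forms V" and V: "subspace V" and N: "finite N" and e: "\<And>i. i \<in> N \<Longrightarrow> e i \<in> V"
  shows "\<omega> (map (\<lambda>c. \<Sum>i\<in>N. c i *\<^sub>R e i) cs) =
    (\<Sum>I\<in>Pow N. minor cs I * \<omega> (map e (sorted_list_of_set I)))"
  using w
proof (induction cs arbitrary: \<omega>)
  case Nil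
  have "(\<Sum>I\<in>Pow N. minor [] I * \<omega> (map e (sorted_list_of_set I))) =
      (\<Sum>I\<in>Pow N. if {} = I then \<omega> [] else 0)"
    by (intro sum.cong) auto
  then show ?case using N by simp
next
  case (Cons c cs)
  let ?s = "\<lambda>i I. (-1) ^ card {j\<in>I. j < i} :: real"
  let ?w = "\<lambda>I. \<omega> (map e (sorted_list_of_set I))"
  have lift: "(\<lambda>vs. \<omega> ([e i] @ vs)) \<in> alt_forms V" if "i \<in> N" for i
    by (rule alt_forms_append_left[OF Cons.prems]) (use e that in auto)
  have ins: "\<omega> (e i # map e (sorted_list_of_set J)) = (if i \<in> J then 0 else ?s i J * ?w (insert i J))"
    if "i \<in> N" "J \<in> Pow N" for i J
  proof (cases "i \<in> J")
    case True
    moreover have "finite J" using that N finite_subset by auto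
    ultimately show ?thesis by (auto intro!: alt_forms_repeat[OF Cons.prems])
  next
    case False
    moreover have "finite J" using that N finite_subset by auto
    ultimately show ?thesis
      using alt_forms_insert[OF Cons.prems, of J i e] that e by auto
  qed
  have "\<omega> (map (\<lambda>c. \<Sum>i\<in>N. c i *\<^sub>R e i) (c # cs)) =
      (\<Sum>i\<in>N. c i * \<omega> (e i # map (\<lambda>c. \<Sum>i\<in>N. c i *\<^sub>R e i) cs))"
    using alt_forms_sum[OF Cons.prems V, of N e "[]"] e by simp
  also have "\<dots> = (\<Sum>i\<in>N. c i * (\<Sum>J\<in>Pow N. minor cs J * \<omega> (e i # map e (sorted_list_of_set J))))"
    using Cons.IH[OF lift] by (intro sum.cong) auto
  also have "\<dots> = (\<Sum>i\<in>N. \<Sum>J\<in>Pow N. if i \<in> J then 0 else ?s i J * c i * minor cs J * ?w (insert i J))"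
    unfolding sum_distrib_left by (intro sum.cong refl) (auto simp: ins)
  also have "\<dots> = (\<Sum>(i, J)\<in>N \<times> Pow N. if i \<in> J then 0 else ?s i J * c i * minor cs J * ?w (insert i J))"
    by (rule sum.cartesian_product)
  also have "\<dots> = (\<Sum>(i, J)\<in>Sigma N (\<lambda>i. Pow (N - {i})). ?s i J * c i * minor cs J * ?w (insert i J))"
    using N by (intro sum.mono_neutral_cong_right) auto
  \<comment> \<open>Pairs (i, J) with i outside J correspond to pairs (I, i) with i in I by I = J
    \<union> {i}. The sign is unchanged, as i does not count among the indices below i.\<close>
  also have "\<dots> = (\<Sum>(I, i)\<in>Sigma (Pow N) (\<lambda>I. I). ?s i I * c i * minor cs (I - {i}) * ?w I)"
  proof (rule sum.reindex_bij_witness[where i = "\<lambda>(I, i). (i, I - {i})" and j = "\<lambda>(i, J). (insert i J, i)"], goal_cases)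
    case (5 p)
    obtain i J where p: "p = (i, J)" by (cases p)
    have "{j \<in> insert i J. j < i} = {j \<in> J. j < i}" by auto
    moreover have "insert i J - {i} = J" using 5 p by auto
    ultimately show ?case by (simp add: p)
  qed auto
  also have "\<dots> = (\<Sum>I\<in>Pow N. \<Sum>i\<in>I. ?s i I * c i * minor cs (I - {i}) * ?w I)"
    using N by (subst sum.Sigma) (auto intro: finite_subset)
  also have "\<dots> = (\<Sum>I\<in>Pow N. minor (c # cs) I * ?w I)"
    by (simp add: sum_distrib_right)
  finally show ?case .
qed

lemma minor_linear:
  "minor (us @ (a *\<^sub>R v + b *\<^sub>R w) # ws) I = a * minor (us @ v # ws) I + b * minor (us @ w # ws) I"
proof (induction us arbitrary: I)
  case Nil
  show ?case by (simp add: sum_distrib_left sum.distrib[symmetric] algebra_simps)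
next
  case (Cons u us)
  then show ?case by (simp add: sum_distrib_left sum.distrib[symmetric] algebra_simps)
qed

text \<open>Expanding along both equal rows gives a double sum over i and j in I whose terms change
  sign when i and j are exchanged.\<close>

lemma minor_repeat_first: "minor (c # c # cs) I = 0"
proof (cases "finite I")
  case I: True
  let ?s = "\<lambda>i I. (-1) ^ card {j\<in>I. j < i} :: real"
  define a where "a i j = (if i = j then 0 else ?s i I * ?s j (I - {i}) * c i * c j * minor cs (I - {i, j}))" for i j
  \<comment> \<open>For i < j, removing i lowers the number of indices below j by one, while
    removing j leaves the number of indices below i unchanged.\<close>
  have flip: "?s i I * ?s j (I - {i}) = - (?s j I * ?s i (I - {j}))" if "i < j" "i \<in> I" "j \<in> I" for i j
  proof -
    have "{k \<in> I. k < j} = insert i {k \<in> I - {i}. k < j}" using that by auto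
    then have "card {k \<in> I. k < j} = Suc (card {k \<in> I - {i}. k < j})" using I by simp
    moreover have "{k \<in> I - {j}. k < i} = {k \<in> I. k < i}" using that by auto
    ultimately show ?thesis by simp
  qed
  have anti: "a i j = - a j i" if "i \<in> I" "j \<in> I" for i j
  proof -
    consider "i < j" | "j < i" | "i = j" by linarith
    then show ?thesis
    proof cases
      case 1
      then show ?thesis using flip[OF 1 that] by (simp add: a_def insert_commute)
    next
      case 2
      then show ?thesis using flip[OF 2 that(2,1)] by (simp add: a_def insert_commute)
    qed (simp add: a_def)
  qed
  have "minor (c # c # cs) I = (\<Sum>i\<in>I. \<Sum>j\<in>I. a i j)"
  proof (simp only: minor.simps sum_distrib_left, rule sum.cong[OF refl])
    fix i assume i: "i \<in> I"
    have "(\<Sum>j\<in>I - {i}. ?s i I * c i * (?s j (I - {i}) * c j * minor cs (I - {i} - {j}))) = (\<Sum>j\<in>I - {i}. a i j)"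
    proof (rule sum.cong[OF refl])
      fix j assume "j \<in> I - {i}"
      moreover have "I - {i} - {j} = I - {i, j}" by auto
      ultimately show "?s i I * c i * (?s j (I - {i}) * c j * minor cs (I - {i} - {j})) = a i j"
        by (simp add: a_def)
    qed
    also have "\<dots> = (\<Sum>j\<in>I. a i j)"
      using I by (intro sum.mono_neutral_left) (auto simp: a_def)
    finally show "(\<Sum>j\<in>I - {i}. ?s i I * c i * (?s j (I - {i}) * c j * minor cs (I - {i} - {j}))) = (\<Sum>j\<in>I. a i j)" .
  qed
  moreover have "(\<Sum>i\<in>I. \<Sum>j\<in>I. a i j) = (\<Sum>i\<in>I. \<Sum>j\<in>I. - a j i)"
    by (intro sum.cong refl anti)
  moreover have "(\<Sum>i\<in>I. \<Sum>j\<in>I. - a j i) = - (\<Sum>i\<in>I. \<Sum>j\<in>I. a i j)"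
    by (subst sum.swap) (simp only: sum_negf)
  ultimately show ?thesis by linarith
qed simp

text \<open>If the repetition lies in the tail, the induction hypothesis applies to the minors of
  the tail. Otherwise the first row c recurs there: by the hypothesis the minors with n rows, put to
  0 on other lengths, are alternating forms, so \<open>alt_forms_move\<close> brings the second c
  next to the first.\<close>

lemma minor_repeat_aux:
  "length cs = n \<Longrightarrow> \<not> distinct cs \<Longrightarrow> minor cs I = 0"
proof (induction n arbitrary: cs I)
  case (Suc n)
  then obtain c ds where cs: "cs = c # ds" "length ds = n" by (auto simp: length_Suc_conv)
  show ?case
  proof (cases "distinct ds")
    case False
    then show ?thesis by (simp add: cs Suc.IH)
  next
    case True
    then have "c \<in> set ds" using Suc.prems cs by simp
    then obtain as bs where ds: "ds = as @ c # bs" by (auto dest: split_list)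
    define w where "w J vs = (if length vs = n then minor vs J else 0)" for J vs
    have w: "w J \<in> alt_forms UNIV" for J
      by (rule alt_formsI) (simp_all add: w_def minor_linear Suc.IH)
    have "minor ds J = (-1) ^ length as * minor (c # as @ bs) J" for J
    proof -
      have "w J ([] @ c # as @ bs) = (-1) ^ length as * w J ([] @ as @ c # bs)"
        by (rule alt_forms_move[OF w]) auto
      then have "minor (c # as @ bs) J = (-1) ^ length as * minor ds J"
        using cs(2) ds by (simp add: w_def)
      then have "(-1) ^ length as * minor (c # as @ bs) J = ((-1) ^ length as * (-1) ^ length as) * minor ds J"
        by simp
      also have "(-1) ^ length as * (-1) ^ length as = (1 :: real)"
        by (simp add: power_mult_distrib[symmetric])
      finally show ?thesis by simp
    qed
    then have "minor (c # ds) I = (-1) ^ length as * minor (c # c # as @ bs) I"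
      by (simp add: sum_distrib_left algebra_simps)
    then show ?thesis by (simp only: minor_repeat_first cs)
  qed
qed simp

lemma minor_alt_forms: "(\<lambda>cs. minor cs I) \<in> alt_forms UNIV"
  by (rule alt_formsI) (simp_all add: minor_linear minor_repeat_aux[OF refl])

text \<open>The first row is nonzero only in column j. Since \<open>js\<close> is increasing, j is
  the smallest index and its Laplace sign is +1.\<close>

lemma minor_dual:
  "sorted js \<Longrightarrow> distinct js \<Longrightarrow> minor (map (\<lambda>j i. if i = j then 1 else 0) js) I = (if I = set js then 1 else 0)"
proof (induction js arbitrary: I)
  case (Cons j js)
  let ?s = "(-1) ^ card {k\<in>I. k < j} :: real"
  have "minor (map (\<lambda>j i. if i = j then 1 else 0) (j # js)) I =
      (\<Sum>i\<in>I. if i = j then ?s * (if I - {j} = set js then 1 else 0) else 0)"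
    unfolding list.map minor.simps
  proof (rule sum.cong[OF refl])
    fix i assume "i \<in> I"
    have "minor (map (\<lambda>j i. if i = j then 1 else 0) js) (I - {j}) = (if I - {j} = set js then 1 else 0)"
      using Cons by simp
    then show "(-1) ^ card {k\<in>I. k < i} * (if i = j then 1 else 0) *
        minor (map (\<lambda>j i. if i = j then 1 else 0) js) (I - {i}) =
        (if i = j then ?s * (if I - {j} = set js then 1 else 0) else 0)"
      by (cases "i = j") simp_all
  qed
  also have "\<dots> = (if I = set (j # js) then 1 else 0)"
  proof (cases "j \<in> I \<and> I - {j} = set js")
    case True
    then have I: "I = insert j (set js)" by auto
    then have "{k\<in>I. k < j} = {}" using Cons.prems by auto
    then have "?s = 1" by (simp only: card.empty power_0)
    moreover have "finite I" using I by simp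
    ultimately show ?thesis using True I by simp
  next
    case False
    have "I \<noteq> set (j # js)" using False Cons.prems by auto
    moreover have "(\<Sum>i\<in>I. if i = j then ?s * (if I - {j} = set js then 1 else 0) else 0) = 0"
      using False by (intro sum.neutral) auto
    ultimately show ?thesis by simp
  qed
  finally show ?case .
qed simp

text \<open>Taking values in \<open>nat \<Rightarrow> real\<close>, a single linear extension from
  the basis yields all coordinate functions together, and it is linear on the whole type.\<close>

lemma basis_coordinates:
  assumes e: "inj_on e N" "independent (e ` N)" "finite N"
  obtains \<kappa> :: "'v::real_vector \<Rightarrow> nat \<Rightarrow> real"
  where "linear \<kappa>" "\<And>j. j \<in> N \<Longrightarrow> \<kappa> (e j) = (\<lambda>i. if i = j then 1 else 0)"
    "\<And>v. v \<in> span (e ` N) \<Longrightarrow> v = (\<Sum>i\<in>N. \<kappa> v i *\<^sub>R e i)"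
proof -
  obtain \<kappa> :: "'v \<Rightarrow> nat \<Rightarrow> real" where \<kappa>: "linear \<kappa>"
    "\<And>v. v \<in> e ` N \<Longrightarrow> \<kappa> v = (\<lambda>i. if i = inv_into N e v then 1 else 0)"
    using linear_independent_extend[OF e(2), of "\<lambda>v i. if i = inv_into N e v then 1 else 0"] by auto
  have d: "\<kappa> (e j) = (\<lambda>i. if i = j then 1 else 0)" if "j \<in> N" for j
    using \<kappa>(2)[of "e j"] that e(1) by simp
  have "v = (\<Sum>i\<in>N. \<kappa> v i *\<^sub>R e i)" if "v \<in> span (e ` N)" for v
    using that
  proof (induction rule: span_induct_alt)
    case base
    show ?case by (simp add: linear_0[OF \<kappa>(1)])
  next
    case (step c x y)
    then obtain j where j: "j \<in> N" "x = e j" by auto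
    have "(\<Sum>i\<in>N. \<kappa> x i *\<^sub>R e i) = (\<Sum>i\<in>N. if j = i then e i else 0)"
      using j by (intro sum.cong) (auto simp: d)
    also have "\<dots> = x" using j e(3) by simp
    finally have x: "(\<Sum>i\<in>N. \<kappa> x i *\<^sub>R e i) = x" .
    have "(\<Sum>i\<in>N. \<kappa> (c *\<^sub>R x + y) i *\<^sub>R e i) = c *\<^sub>R (\<Sum>i\<in>N. \<kappa> x i *\<^sub>R e i) + (\<Sum>i\<in>N. \<kappa> y i *\<^sub>R e i)"
      by (simp add: linear_add[OF \<kappa>(1)] linear_scale[OF \<kappa>(1)] scaleR_add_left sum.distrib scaleR_sum_right)
    then show ?case using x step.IH by simp
  qed
  then show ?thesis using that[of \<kappa>] \<kappa>(1) d by blast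
qed

text \<open>The form with index I is the minor in the columns I of the matrix of coordinates. On an
  increasing list of basis vectors the rows are unit vectors, so \<open>minor_dual\<close> evaluates
  it.\<close>

lemma dual_forms_exist:
  fixes e :: "nat \<Rightarrow> 'v::real_vector"
  assumes e: "inj_on e N" "independent (e ` N)" "finite N" and V: "V = span (e ` N)"
  obtains \<epsilon> where "\<And>I. \<epsilon> I \<in> alt_forms V"
    "\<And>I J. J \<subseteq> N \<Longrightarrow> \<epsilon> I (map e (sorted_list_of_set J)) = (if I = J then 1 else 0)"
proof -
  obtain \<kappa> :: "'v \<Rightarrow> nat \<Rightarrow> real" where \<kappa>: "linear \<kappa>"
    "\<And>j. j \<in> N \<Longrightarrow> \<kappa> (e j) = (\<lambda>i. if i = j then 1 else 0)"
    using basis_coordinates[OF e] by metis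
  let ?\<epsilon> = "\<lambda>I vs. if set vs \<subseteq> V then minor (map \<kappa> vs) I else 0"
  have "?\<epsilon> I \<in> alt_forms V" for I
    by (rule alt_forms_pullback[OF minor_alt_forms \<kappa>(1)]) (auto simp: V)
  moreover have "?\<epsilon> I (map e (sorted_list_of_set J)) = (if I = J then 1 else 0)" if J: "J \<subseteq> N" for I J
  proof -
    have fJ: "finite J" using J e(3) finite_subset by blast
    then have m: "map \<kappa> (map e (sorted_list_of_set J)) = map (\<lambda>j i. if i = j then 1 else 0) (sorted_list_of_set J)"
      using J \<kappa>(2) by auto
    have "set (map e (sorted_list_of_set J)) \<subseteq> V"
      using J fJ by (auto simp: V intro: span_base)
    moreover have "minor (map \<kappa> (map e (sorted_list_of_set J))) I = (if I = J then 1 else 0)"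
      unfolding m by (subst minor_dual) (use fJ in simp_all)
    ultimately show ?thesis by (simp only: if_True)
  qed
  ultimately show ?thesis using that[of ?\<epsilon>] by blast
qed

text \<open>The rows \<open>cs\<close> depend on \<open>vs\<close> alone. Having the same
  coefficients for all forms allows forms to be compared and the coefficients to be identified by
  dual forms.\<close>

lemma alt_forms_expand_basis:
  assumes e: "inj_on e N" "independent (e ` N)" "finite N" and V: "V = span (e ` N)"
    and vs: "set vs \<subseteq> V"
  obtains cs where "\<And>\<omega>. \<omega> \<in> alt_forms V \<Longrightarrow>
    \<omega> vs = (\<Sum>I\<in>Pow N. minor cs I * \<omega> (map e (sorted_list_of_set I)))"
proof -
  obtain \<kappa> :: "'a \<Rightarrow> nat \<Rightarrow> real" where \<kappa>: "\<And>v. v \<in> span (e ` N) \<Longrightarrow> v = (\<Sum>i\<in>N. \<kappa> v i *\<^sub>R e i)"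
    using basis_coordinates[OF e] by metis
  have "map (\<lambda>c. \<Sum>i\<in>N. c i *\<^sub>R e i) (map \<kappa> vs) = vs"
    using vs \<kappa> V by (auto intro!: map_idI simp: subset_iff)
  then have "\<omega> vs = (\<Sum>I\<in>Pow N. minor (map \<kappa> vs) I * \<omega> (map e (sorted_list_of_set I)))"
    if "\<omega> \<in> alt_forms V" for \<omega>
    using alt_forms_expand[OF that, of N e "map \<kappa> vs"] e(3) V by (simp add: span_base)
  then show ?thesis using that by blast
qed


section \<open>Shuffles with a one-element first block\<close>

text \<open>The (1,m)-shuffle whose one-element block is sent to i: reading a list through it moves
  entry i to the front and keeps the order of the others.\<close>

definition move_front :: "nat \<Rightarrow> nat \<Rightarrow> nat" where
  "move_front i k = (if k = 0 then i else if k \<le> i then k - 1 else k)"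

lemma move_front_Suc: "move_front (Suc i) = Transposition.transpose i (Suc i) \<circ> move_front i"
  by (auto simp: fun_eq_iff move_front_def Transposition.transpose_def)

lemma move_front_permutes_sign:
  "i \<le> m \<Longrightarrow> move_front i permutes {..<Suc m} \<and> sign (move_front i) = (-1) ^ i"
proof (induction i)
  case 0
  have "move_front 0 = id" by (auto simp: fun_eq_iff move_front_def)
  then show ?case by (simp only: permutes_id sign_id power_0 simp_thms)
next
  case (Suc i)
  then have IH: "move_front i permutes {..<Suc m}" "sign (move_front i) = (-1) ^ i" by auto
  have t: "Transposition.transpose i (Suc i) permutes {..<Suc m}" using Suc.prems by (intro permutes_swap_id) auto
  have "permutation (Transposition.transpose i (Suc i))" "permutation (move_front i)"
    using t IH(1) by (auto intro: permutes_imp_permutation[OF finite_lessThan])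
  then have "sign (Transposition.transpose i (Suc i) \<circ> move_front i) = (-1) ^ Suc i"
    by (simp only: sign_compose IH(2) sign_swap_id) simp
  then show ?case unfolding move_front_Suc using permutes_compose[OF IH(1) t] by blast
qed

lemma map_move_front:
  assumes "i \<le> m"
  shows "map (move_front i) [1..<Suc m] = [0..<i] @ [Suc i..<Suc m]"
proof (rule nth_equalityI)
  fix k assume "k < length (map (move_front i) [1..<Suc m])"
  then show "map (move_front i) [1..<Suc m] ! k = ([0..<i] @ [Suc i..<Suc m]) ! k"
    using assms by (simp add: nth_append move_front_def del: upt_Suc)
qed (use assms in auto)

text \<open>A (1,m)-shuffle is determined by its value at 0, because the remaining positions
  enumerate the complement of that value in increasing order.\<close>

lemma shuffle_perms_1: "shuffle_perms 1 m = move_front ` {..m}"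
proof (intro equalityI subsetI)
  fix \<sigma> assume "\<sigma> \<in> shuffle_perms 1 m"
  then have p: "\<sigma> permutes {..<Suc m}" and mono: "strict_mono_on {1..<Suc m} \<sigma>"
    by (auto simp: shuffle_perms_def)
  have i: "\<sigma> 0 \<le> m" using permutes_in_image[OF p, of 0] by simp
  have inj: "inj \<sigma>" using permutes_inj[OF p] .
  have "sorted_wrt (<) [1..<Suc m]" by (rule sorted_wrt_upt)
  then have "sorted_wrt (<) (map \<sigma> [1..<Suc m])"
    unfolding sorted_wrt_map by (rule sorted_wrt_mono_rel[rotated]) (use mono in \<open>auto simp: strict_mono_on_def\<close>)
  then have s: "sorted (map \<sigma> [1..<Suc m])" "distinct (map \<sigma> [1..<Suc m])"
    by (auto simp: strict_sorted_iff)
  have "set (map \<sigma> [1..<Suc m]) = \<sigma> ` ({..<Suc m} - {0})" by auto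
  also have "\<dots> = \<sigma> ` {..<Suc m} - {\<sigma> 0}" by (simp add: image_set_diff[OF inj])
  also have "\<dots> = {..<Suc m} - {\<sigma> 0}" by (simp only: permutes_image[OF p])
  also have "\<dots> = set (map (move_front (\<sigma> 0)) [1..<Suc m])"
    using i unfolding map_move_front[OF i] by auto
  finally have "map \<sigma> [1..<Suc m] = map (move_front (\<sigma> 0)) [1..<Suc m]"
    unfolding map_move_front[OF i]
    by (intro sorted_distinct_set_unique s) (auto simp: sorted_append simp del: upt_Suc)
  then have *: "\<sigma> k = move_front (\<sigma> 0) k" if "k \<in> {1..<Suc m}" for k
    using that by (auto simp del: upt_Suc)
  have "\<sigma> k = move_front (\<sigma> 0) k" for k
  proof (cases "k = 0 \<or> k < Suc m")
    case True
    then show ?thesis using *[of k] by (cases "k = 0") (auto simp: move_front_def)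
  next
    case False
    then have "\<sigma> k = k" by (intro permutes_not_in[OF p]) simp
    then show ?thesis using False i by (simp add: move_front_def)
  qed
  then have "\<sigma> = move_front (\<sigma> 0)" by blast
  then show "\<sigma> \<in> move_front ` {..m}" using i by (intro image_eqI[of _ _ "\<sigma> 0"]) simp_all
next
  fix \<sigma> assume "\<sigma> \<in> move_front ` {..m}"
  then obtain i where i: "i \<le> m" "\<sigma> = move_front i" by auto
  then show "\<sigma> \<in> shuffle_perms 1 m"
    using move_front_permutes_sign[OF i(1)]
    by (auto simp: shuffle_perms_def strict_mono_on_def move_front_def)
qed

text \<open>Only p = 1 survives in the sum over degrees, since \<beta> vanishes on lists of other
  lengths; the shuffles are then the cycles \<open>move_front i\<close> with sign
  \<open>(-1) ^ i\<close>.\<close>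

lemma alt_wedge_one_form:
  assumes \<beta>: "\<And>us. length us \<noteq> 1 \<Longrightarrow> \<beta> us = 0"
  shows "alt_wedge \<beta> \<theta> vs =
    (\<Sum>i<length vs. (-1) ^ i * \<beta> [vs ! i] * \<theta> (take i vs @ drop (Suc i) vs))"
proof (cases "length vs")
  case 0
  then show ?thesis by (simp add: alt_wedge_def \<beta>)
next
  case (Suc m)
  have inj: "inj_on move_front {..m}"
    by (rule inj_onI) (metis move_front_def)
  let ?t = "\<lambda>p \<sigma>. of_int (sign \<sigma>) * \<beta> (map (\<lambda>i. vs ! \<sigma> i) [0..<p]) *
    \<theta> (map (\<lambda>i. vs ! \<sigma> i) [p..<length vs]) :: real"
  have "alt_wedge \<beta> \<theta> vs = (\<Sum>p\<le>length vs. \<Sum>\<sigma>\<in>shuffle_perms p (length vs - p). ?t p \<sigma>)"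
    by (simp only: alt_wedge_def)
  also have "\<dots> = (\<Sum>p\<in>{1}. \<Sum>\<sigma>\<in>shuffle_perms p (length vs - p). ?t p \<sigma>)"
    by (rule sum.mono_neutral_right) (auto simp: Suc \<beta>)
  also have "\<dots> = (\<Sum>i\<le>m. ?t 1 (move_front i))"
    by (simp add: Suc shuffle_perms_1[simplified] sum.reindex[OF inj] del: upt_Suc)
  also have "\<dots> = (\<Sum>i\<le>m. (-1) ^ i * \<beta> [vs ! i] * \<theta> (take i vs @ drop (Suc i) vs))"
  proof (rule sum.cong[OF refl])
    fix i assume "i \<in> {..m}"
    then have i: "i \<le> m" by simp
    have "map (\<lambda>k. vs ! move_front i k) [1..<length vs] = map ((!) vs) (map (move_front i) [1..<Suc m])"
      by (simp add: Suc del: upt_Suc)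
    also have "\<dots> = take i vs @ drop (Suc i) vs"
      unfolding map_move_front[OF i] using i
      by (intro nth_equalityI) (simp_all add: Suc nth_append del: upt_Suc)
    finally show "?t 1 (move_front i) = (-1) ^ i * \<beta> [vs ! i] * \<theta> (take i vs @ drop (Suc i) vs)"
      using move_front_permutes_sign[OF i] by (simp add: move_front_def)
  qed
  finally show ?thesis by (simp add: Suc lessThan_Suc_atMost)
qed

text \<open>Moving v from the front into slot i gives a second factor \<open>(-1) ^ i\<close>, which
  cancels the sign of the shuffle. The wedge with an interior product thus becomes a sum over
  replaced slots, the shape occurring in Lie derivatives.\<close>

lemma alt_wedge_one_form_insert:
  assumes \<beta>: "\<And>us. length us \<noteq> 1 \<Longrightarrow> \<beta> us = 0"
    and w: "\<omega> \<in> alt_forms V" and v: "v \<in> V" and vs: "set vs \<subseteq> V"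
  shows "alt_wedge \<beta> (\<lambda>us. \<omega> (v # us)) vs = (\<Sum>i<length vs. \<beta> [vs ! i] * \<omega> (vs[i := v]))"
proof (rule trans[OF alt_wedge_one_form sum.cong[OF refl]])
  show "length us \<noteq> 1 \<Longrightarrow> \<beta> us = 0" for us by (rule \<beta>)
  fix i assume "i \<in> {..<length vs}"
  then have i: "i < length vs" by simp
  have "set (take i vs) \<subseteq> V" by (rule order_trans[OF set_take_subset vs])
  from alt_forms_move[OF w v this, of "[]" "drop (Suc i) vs"] i
  have "\<omega> (v # take i vs @ drop (Suc i) vs) = (-1) ^ i * \<omega> (vs[i := v])"
    by (simp add: upd_conv_take_nth_drop)
  then have "(-1) ^ i * \<beta> [vs ! i] * \<omega> (v # take i vs @ drop (Suc i) vs) =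
      ((-1) ^ i * (-1) ^ i) * (\<beta> [vs ! i] * \<omega> (vs[i := v]))" by simp
  also have "(-1) ^ i * (-1) ^ i = (1::real)" by (simp add: power_mult_distrib[symmetric])
  finally show "(-1) ^ i * \<beta> [vs ! i] * \<omega> (v # take i vs @ drop (Suc i) vs) = \<beta> [vs ! i] * \<omega> (vs[i := v])"
    by simp
qed


section \<open>Sums over the slots of a list\<close>

text \<open>The Leibniz extension of D to lists, seen through a function F of lists. D and F are
  arbitrary maps, which separates the bookkeeping of slots from multilinearity.\<close>

definition slot_sum :: "('a \<Rightarrow> 'a) \<Rightarrow> ('a list \<Rightarrow> 'b::ab_group_add) \<Rightarrow> 'a list \<Rightarrow> 'b" where
  "slot_sum D F vs = (\<Sum>i<length vs. F (vs[i := D (vs ! i)]))"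

lemma slot_sum_Nil [simp]: "slot_sum D F [] = 0"
  by (simp add: slot_sum_def)

lemma slot_sum_Cons: "slot_sum D F (a # vs) = F (D a # vs) + slot_sum D (\<lambda>ws. F (a # ws)) vs"
  by (simp add: slot_sum_def sum.lessThan_Suc_shift del: sum.lessThan_Suc)

lemma slot_sum_append:
  "slot_sum D F (us @ vs) = slot_sum D (\<lambda>ws. F (ws @ vs)) us + slot_sum D (\<lambda>ws. F (us @ ws)) vs"
  by (induction us arbitrary: F) (simp_all add: slot_sum_Cons add.assoc)

lemma slot_sum_rev: "slot_sum D F (rev vs) = slot_sum D (\<lambda>ws. F (rev ws)) vs"
  by (induction vs arbitrary: F) (simp_all add: slot_sum_Cons slot_sum_append add.commute)

lemma slot_sum_add: "slot_sum D (\<lambda>ws. F ws + G ws) vs = slot_sum D F vs + slot_sum D G vs"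
  by (simp add: slot_sum_def sum.distrib)

lemma slot_sum_0 [simp]: "slot_sum D (\<lambda>ws. 0) vs = 0"
  by (simp add: slot_sum_def)

lemma slot_sum_mult: "slot_sum D (\<lambda>ws. c * F ws) vs = c * slot_sum D F vs" for c :: real
  by (simp add: slot_sum_def sum_distrib_left)

text \<open>Terms in which D and E act on different slots occur in both double sums and cancel;
  those with both on the same slot remain. The operator of the outer sum acts on the entry first,
  hence \<open>D (E a)\<close> in the first term.\<close>

lemma slot_sum_commutator:
  assumes "\<And>us a ws. a \<in> S \<Longrightarrow> F (us @ D (E a) # ws) - F (us @ E (D a) # ws) = F (us @ C a # ws)"
    and "set vs \<subseteq> S"
  shows "slot_sum E (slot_sum D F) vs - slot_sum D (slot_sum E F) vs = slot_sum C F vs"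
  using assms
proof (induction vs arbitrary: F)
  case (Cons a vs)
  have 1: "F (D (E a) # vs) - F (E (D a) # vs) = F (C a # vs)"
    using Cons.prems(1)[of a "[]" vs] Cons.prems(2) by simp
  have "F ((a # us) @ D (E b) # ws) - F ((a # us) @ E (D b) # ws) = F ((a # us) @ C b # ws)"
    if "b \<in> S" for us b ws by (rule Cons.prems(1)[OF that])
  then have 2: "slot_sum E (slot_sum D (\<lambda>ws. F (a # ws))) vs - slot_sum D (slot_sum E (\<lambda>ws. F (a # ws))) vs =
      slot_sum C (\<lambda>ws. F (a # ws)) vs"
    using Cons.prems(2) by (intro Cons.IH) auto
  have exp: "slot_sum E' (slot_sum D' F) (a # vs) = F (D' (E' a) # vs) + slot_sum D' (\<lambda>ws. F (E' a # ws)) vs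
      + (slot_sum E' (\<lambda>ws. F (D' a # ws)) vs + slot_sum E' (slot_sum D' (\<lambda>ws. F (a # ws))) vs)" for D' E'
    by (simp add: slot_sum_Cons slot_sum_add)
  show ?case unfolding exp slot_sum_Cons[of C] 1[symmetric] 2[symmetric] by (simp add: algebra_simps)
qed simp


section \<open>Sections, forms and multivectors of a Lie algebroid\<close>

lemma alt_forms_eqI:
  assumes "\<omega> \<in> alt_forms V" "\<theta> \<in> alt_forms V" "\<And>vs. set vs \<subseteq> V \<Longrightarrow> \<omega> vs = \<theta> vs"
  shows "\<omega> = \<theta>"
proof
  show "\<omega> vs = \<theta> vs" for vs
    using assms(3) alt_formsD(1)[OF assms(1)] alt_formsD(1)[OF assms(2)] by (cases "set vs \<subseteq> V") simp_all
qed

text \<open>A minor is a polynomial in its entries. Applied to coordinate functions of sections,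
  this makes coefficients of exterior products smooth.\<close>

lemma (in smooth_manifold) minor_smooth:
  assumes S: "open S"
  shows "(\<And>c i. c \<in> set cs \<Longrightarrow> i \<in> N \<Longrightarrow> smooth_fun_on M S (c i)) \<Longrightarrow> I \<subseteq> N \<Longrightarrow>
    smooth_fun_on M S (\<lambda>x. minor (map (\<lambda>c i. c i x) cs) I)"
proof (induction cs arbitrary: I)
  case Nil
  then show ?case by (simp add: smooth_fun_on_const[OF S])
next
  case (Cons c cs)
  show ?case
    unfolding list.map minor.simps
  proof (intro smooth_fun_on_sum smooth_fun_on_mult smooth_fun_on_const S)
    fix i assume i: "i \<in> I"
    show "smooth_fun_on M S (\<lambda>x. c i x)" using Cons.prems i by auto
    show "smooth_fun_on M S (\<lambda>x. minor (map (\<lambda>c i. c i x) cs) (I - {i}))"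
      using Cons.prems by (intro Cons.IH) auto
  qed
qed

sublocale lie_algebroid \<subseteq> M: smooth_manifold "base L"
  by (rule base_manifold)

sublocale lie_algebroid \<subseteq> B: smooth_vector_bundle "base L" "ebundle L"
  by (rule vector_bundle)

context lie_algebroid
begin

abbreviation "CM \<equiv> Cinf (base L)"
abbreviation "N \<equiv> idx (ebundle L)"
abbreviation "smooth \<equiv> smooth_fun_on (base L)"
abbreviation "section_on \<equiv> smooth_section_on (base L) (ebundle L)"
abbreviation "is_frame U e \<equiv> (U, e) \<in> frames (ebundle L)"
abbreviation "Alt x \<equiv> alt_forms (efib L x)"
abbreviation "smooth_coeffs U c \<equiv> \<forall>I\<subseteq>N. smooth U (c I)"
text \<open>The expansion of P in the frame of exterior products, tested only on alternating forms.
  That P vanishes on other functions is a separate condition in the introduction rules for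
  \<open>Avec\<close>.\<close>

abbreviation "expands U e P c \<equiv>
  \<forall>x\<in>U. \<forall>\<omega>\<in>Alt x. P x \<omega> = (\<Sum>I\<in>Pow N. c I x * \<omega> (frame_list e I x))"

section \<open>Local frames and smooth sections of the bundle\<close>

lemma frame_at: obtains U e where "is_frame U e" "x \<in> U"
proof -
  have "x \<in> \<Union>(fst ` frames (ebundle L))" by (simp add: B.frames_cover)
  then show ?thesis using that by auto
qed

lemma frame_fibre:
  assumes "is_frame U e" "x \<in> U"
  shows "inj_on (\<lambda>i. e i x) N" "independent ((\<lambda>i. e i x) ` N)" "efib L x = span ((\<lambda>i. e i x) ` N)"
  using B.frame_basis[OF assms] by auto

lemma frame_in: "is_frame U e \<Longrightarrow> x \<in> U \<Longrightarrow> i \<in> N \<Longrightarrow> e i x \<in> efib L x"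
  using frame_fibre(3)[of U e x] by (auto intro: span_base)

lemma frame_list_in: "is_frame U e \<Longrightarrow> x \<in> U \<Longrightarrow> I \<subseteq> N \<Longrightarrow> set (frame_list e I x) \<subseteq> efib L x"
  using frame_in finite_subset[OF _ B.finite_idx, of I] by (auto simp: frame_list_def)

lemma subspace_efib: "subspace (efib L x)"
  by (rule frame_at[of x]) (use frame_fibre(3) in \<open>simp add: subspace_span\<close>)

lemma sec_in: "V \<in> Sec L \<Longrightarrow> V x \<in> efib L x"
  by (simp add: smooth_sections_def smooth_section_on_def)

lemma section_onI:
  assumes "\<And>x. x \<in> S \<Longrightarrow> s x \<in> efib L x"
    and "\<And>U e. is_frame U e \<Longrightarrow> \<exists>c. (\<forall>i\<in>N. smooth (S \<inter> U) (c i)) \<and>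
       (\<forall>x\<in>S \<inter> U. s x = (\<Sum>i\<in>N. c i x *\<^sub>R e i x))"
  shows "section_on S s"
  using assms by (auto simp: smooth_section_on_def)

lemma section_on_in: "section_on S s \<Longrightarrow> x \<in> S \<Longrightarrow> s x \<in> efib L x"
  by (simp add: smooth_section_on_def)

lemma efib_closed:
  "0 \<in> efib L x"
  "v \<in> efib L x \<Longrightarrow> w \<in> efib L x \<Longrightarrow> v + w \<in> efib L x"
  "v \<in> efib L x \<Longrightarrow> a *\<^sub>R v \<in> efib L x"
  using subspace_efib by (simp_all add: subspace_0 subspace_add subspace_scale)

lemma section_onD:
  assumes "section_on S s" "is_frame U e"
  obtains c where "\<And>i. i \<in> N \<Longrightarrow> smooth (S \<inter> U) (c i)"
    "\<And>x. x \<in> S \<Longrightarrow> x \<in> U \<Longrightarrow> s x = (\<Sum>i\<in>N. c i x *\<^sub>R e i x)"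
proof -
  from assms have "\<exists>c. (\<forall>i\<in>N. smooth (S \<inter> U) (c i)) \<and> (\<forall>x\<in>S \<inter> U. s x = (\<Sum>i\<in>N. c i x *\<^sub>R e i x))"
    unfolding smooth_section_on_def by blast
  then show ?thesis using that by blast
qed

lemma section_on_subset:
  assumes s: "section_on S s" and T: "T \<subseteq> S"
  shows "section_on T s"
proof (rule section_onI)
  show "x \<in> T \<Longrightarrow> s x \<in> efib L x" for x using section_on_in[OF s] T by auto
  fix U e assume U: "is_frame U e"
  obtain c where c: "\<And>i. i \<in> N \<Longrightarrow> smooth (S \<inter> U) (c i)"
    "\<And>x. x \<in> S \<Longrightarrow> x \<in> U \<Longrightarrow> s x = (\<Sum>i\<in>N. c i x *\<^sub>R e i x)" by (rule section_onD[OF s U]) blast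
  have "smooth (T \<inter> U) (c i)" if "i \<in> N" for i
    by (rule M.smooth_fun_on_subset[OF c(1)[OF that]]) (use T in auto)
  then show "\<exists>c. (\<forall>i\<in>N. smooth (T \<inter> U) (c i)) \<and> (\<forall>x\<in>T \<inter> U. s x = (\<Sum>i\<in>N. c i x *\<^sub>R e i x))"
    using c(2) T by (intro exI[of _ c]) auto
qed

lemma sec_on: "V \<in> Sec L \<Longrightarrow> section_on S V"
  by (rule section_on_subset[of UNIV]) (auto simp: smooth_sections_def)

lemma frame_section_on: "is_frame U e \<Longrightarrow> i \<in> N \<Longrightarrow> S \<subseteq> U \<Longrightarrow> section_on S (e i)"
  by (rule section_on_subset[OF B.frame_compat])

lemma section_on_comb:
  assumes "open S" "section_on S s" "section_on S t" "smooth S f" "smooth S g"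
  shows "section_on S (\<lambda>x. f x *\<^sub>R s x + g x *\<^sub>R t x)"
proof (rule section_onI)
  show "f x *\<^sub>R s x + g x *\<^sub>R t x \<in> efib L x" if "x \<in> S" for x
    by (intro efib_closed section_on_in[OF assms(2) that] section_on_in[OF assms(3) that])
  fix U e assume U: "is_frame U e"
  obtain c where c: "\<And>i. i \<in> N \<Longrightarrow> smooth (S \<inter> U) (c i)"
    "\<And>x. x \<in> S \<Longrightarrow> x \<in> U \<Longrightarrow> s x = (\<Sum>i\<in>N. c i x *\<^sub>R e i x)" by (rule section_onD[OF assms(2) U]) blast
  obtain d where d: "\<And>i. i \<in> N \<Longrightarrow> smooth (S \<inter> U) (d i)"
    "\<And>x. x \<in> S \<Longrightarrow> x \<in> U \<Longrightarrow> t x = (\<Sum>i\<in>N. d i x *\<^sub>R e i x)" by (rule section_onD[OF assms(3) U]) blast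
  have o: "open (S \<inter> U)" using assms(1) B.frame_open[OF U] by auto
  have fg: "smooth (S \<inter> U) f" "smooth (S \<inter> U) g"
    using assms(4,5) by (auto intro: M.smooth_fun_on_subset)
  have "smooth (S \<inter> U) (\<lambda>x. f x * c i x + g x * d i x)" if "i \<in> N" for i
    by (intro M.smooth_fun_on_add M.smooth_fun_on_mult o fg c(1) d(1) that)
  moreover have "f x *\<^sub>R s x + g x *\<^sub>R t x = (\<Sum>i\<in>N. (f x * c i x + g x * d i x) *\<^sub>R e i x)"
    if "x \<in> S \<inter> U" for x
    using that c(2)[of x] d(2)[of x] by (simp add: scaleR_sum_right scaleR_add_left sum.distrib)
  ultimately show "\<exists>c. (\<forall>i\<in>N. smooth (S \<inter> U) (c i)) \<and>
      (\<forall>x\<in>S \<inter> U. f x *\<^sub>R s x + g x *\<^sub>R t x = (\<Sum>i\<in>N. c i x *\<^sub>R e i x))"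
    by (intro exI[of _ "\<lambda>i x. f x * c i x + g x * d i x"]) blast
qed

lemma section_on_0: "open S \<Longrightarrow> section_on S (\<lambda>x. 0)"
proof (rule section_onI)
  show "0 \<in> efib L x" for x by (rule efib_closed)
  fix U e assume "open S" "is_frame U e"
  then show "\<exists>c. (\<forall>i\<in>N. smooth (S \<inter> U) (c i)) \<and> (\<forall>x\<in>S \<inter> U. 0 = (\<Sum>i\<in>N. c i x *\<^sub>R e i x))"
    using M.smooth_fun_on_const[of "S \<inter> U" 0] B.frame_open by (intro exI[of _ "\<lambda>i x. 0"]) auto
qed

lemma section_on_sum:
  assumes S: "open S" and s: "\<And>i. i \<in> I \<Longrightarrow> section_on S (s i)"
  shows "section_on S (\<lambda>x. \<Sum>i\<in>I. a i *\<^sub>R s i x)"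
  using s
proof (induction I rule: infinite_finite_induct)
  case (insert i I)
  have "section_on S (\<lambda>x. a i *\<^sub>R s i x + 1 *\<^sub>R (\<Sum>i\<in>I. a i *\<^sub>R s i x))"
    using insert by (intro section_on_comb M.smooth_fun_on_const S) auto
  then show ?case using insert.hyps by simp
qed (simp_all add: section_on_0 S)

text \<open>Off U the values of s are arbitrary, but \<beta> is zero there. In this way the members
  of a local frame become arguments of the bracket, which acts on global sections.\<close>

lemma bump_section:
  assumes b: "\<beta> \<in> CM" "closed K" "\<And>x. x \<notin> K \<Longrightarrow> \<beta> x = 0" "K \<subseteq> U" "open U" and s: "section_on U s"
  shows "sec_scale \<beta> s \<in> Sec L"
proof -
  have "section_on UNIV (sec_scale \<beta> s)"
  proof (rule section_onI)
    fix x show "sec_scale \<beta> s x \<in> efib L x"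
    proof (cases "x \<in> U")
      case True
      then show ?thesis by (simp add: sec_scale_def efib_closed section_on_in[OF s])
    next
      case False
      then have "\<beta> x = 0" using b by auto
      then show ?thesis by (simp add: sec_scale_def efib_closed)
    qed
  next
    fix U' e assume U': "is_frame U' e"
    obtain c where c: "\<And>i. i \<in> N \<Longrightarrow> smooth (U \<inter> U') (c i)"
      "\<And>x. x \<in> U \<Longrightarrow> x \<in> U' \<Longrightarrow> s x = (\<Sum>i\<in>N. c i x *\<^sub>R e i x)" by (rule section_onD[OF s U']) blast
    have "smooth U' (\<lambda>x. \<beta> x * c i x)" if "i \<in> N" for i
      using c(1)[OF that] B.frame_open[OF U'] by (intro M.bump_mult_smooth[OF b]) (auto simp: Int_commute)
    moreover have "sec_scale \<beta> s x = (\<Sum>i\<in>N. (\<beta> x * c i x) *\<^sub>R e i x)" if "x \<in> U'" for x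
    proof (cases "x \<in> U")
      case True
      then show ?thesis using c(2)[OF True that] by (simp add: sec_scale_def scaleR_sum_right)
    next
      case False
      then have "\<beta> x = 0" using b by auto
      then show ?thesis by (simp add: sec_scale_def)
    qed
    ultimately show "\<exists>c. (\<forall>i\<in>N. smooth (UNIV \<inter> U') (c i)) \<and>
        (\<forall>x\<in>UNIV \<inter> U'. sec_scale \<beta> s x = (\<Sum>i\<in>N. c i x *\<^sub>R e i x))"
      by (intro exI[of _ "\<lambda>i x. \<beta> x * c i x"]) simp
  qed
  then show ?thesis by (simp add: smooth_sections_def)
qed

lemma sec_comb: "V \<in> Sec L \<Longrightarrow> W \<in> Sec L \<Longrightarrow> f \<in> CM \<Longrightarrow> g \<in> CM \<Longrightarrow>
    (\<lambda>x. f x *\<^sub>R V x + g x *\<^sub>R W x) \<in> Sec L"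
  using section_on_comb[of UNIV V W f g] by (simp add: smooth_sections_def M.Cinf_on)

lemma sec_sum: "(\<And>i. i \<in> I \<Longrightarrow> V i \<in> Sec L) \<Longrightarrow> (\<lambda>x. \<Sum>i\<in>I. a i *\<^sub>R V i x) \<in> Sec L"
  using section_on_sum[of UNIV I V a] by (simp add: smooth_sections_def)

lemma sec_scale_in: "V \<in> Sec L \<Longrightarrow> f \<in> CM \<Longrightarrow> sec_scale f V \<in> Sec L"
  using sec_comb[of V V f "\<lambda>x. 0"] by (simp add: sec_scale_def M.Cinf_const)

lemma sec_add: "V \<in> Sec L \<Longrightarrow> W \<in> Sec L \<Longrightarrow> V + W \<in> Sec L"
  using sec_comb[of V W "\<lambda>x. 1" "\<lambda>x. 1"] by (simp add: M.Cinf_const plus_fun_def)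

lemma sec_diff: "V \<in> Sec L \<Longrightarrow> W \<in> Sec L \<Longrightarrow> V - W \<in> Sec L"
  using sec_comb[of V W "\<lambda>x. 1" "\<lambda>x. -1"] by (simp add: M.Cinf_const fun_diff_def)

lemma sec_scaleR: "V \<in> Sec L \<Longrightarrow> a *\<^sub>R V \<in> Sec L"
  using sec_scale_in[of V "\<lambda>x. a"] by (simp add: M.Cinf_const sec_scale_def scaleR_fun_def)

lemma sec_0: "0 \<in> Sec L"
  using section_on_0[of UNIV] by (simp add: smooth_sections_def zero_fun_def)

section \<open>Global sections that restrict to a frame near a point\<close>

text \<open>U carries the frame, and S is a smaller neighbourhood on which \<beta> is 1. The global
  sections \<open>sec_scale \<beta> (e i)\<close> therefore coincide with the frame on S.\<close>

definition bumped_frame where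
  "bumped_frame x0 U e \<beta> K S \<longleftrightarrow> is_frame U e \<and> x0 \<in> U \<and> \<beta> \<in> CM \<and> closed K \<and> (\<forall>x. x \<notin> K \<longrightarrow> \<beta> x = 0) \<and>
    K \<subseteq> U \<and> open S \<and> x0 \<in> S \<and> (\<forall>x\<in>S. \<beta> x = 1) \<and> S \<subseteq> U \<and> (\<forall>i\<in>N. sec_scale \<beta> (e i) \<in> Sec L)"

lemma bumped_frameD:
  assumes "bumped_frame x0 U e \<beta> K S"
  shows "is_frame U e" "x0 \<in> U" "\<beta> \<in> CM" "closed K" "x \<notin> K \<Longrightarrow> \<beta> x = 0"
    "K \<subseteq> U" "open S" "x0 \<in> S" "x \<in> S \<Longrightarrow> \<beta> x = 1" "S \<subseteq> U"
    "i \<in> N \<Longrightarrow> sec_scale \<beta> (e i) \<in> Sec L"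
  using assms unfolding bumped_frame_def by blast+

lemma bumped_frame_exists: obtains U e \<beta> K S where "bumped_frame x0 U e \<beta> K S"
proof -
  obtain U e where U: "is_frame U e" "x0 \<in> U" by (rule frame_at)
  obtain \<beta> K S where b: "\<beta> \<in> CM" "closed K" "\<And>x. x \<notin> K \<Longrightarrow> \<beta> x = 0" "K \<subseteq> U"
    "open S" "x0 \<in> S" "\<And>x. x \<in> S \<Longrightarrow> \<beta> x = 1"
    by (rule M.bump_exists[OF B.frame_open[OF U(1)] U(2)]) blast
  have "S \<subseteq> U"
  proof
    fix x assume "x \<in> S"
    then have "x \<in> K" using b(3)[of x] b(7)[of x] by auto
    then show "x \<in> U" using b(4) by auto
  qed
  moreover have "sec_scale \<beta> (e i) \<in> Sec L" if "i \<in> N" for i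
    by (rule bump_section[OF b(1-4) B.frame_open[OF U(1)] B.frame_compat[OF U(1) that]])
  ultimately have "bumped_frame x0 U e \<beta> K S" using U b unfolding bumped_frame_def by blast
  then show ?thesis by (rule that)
qed

lemma section_through:
  assumes "v \<in> efib L x"
  obtains V where "V \<in> Sec L" "V x = v"
proof -
  obtain U e \<beta> K S where "bumped_frame x U e \<beta> K S" by (rule bumped_frame_exists)
  note f = bumped_frameD[OF this]
  obtain \<kappa> :: "'v \<Rightarrow> nat \<Rightarrow> real"
    where \<kappa>: "\<And>v. v \<in> span ((\<lambda>i. e i x) ` N) \<Longrightarrow> v = (\<Sum>i\<in>N. \<kappa> v i *\<^sub>R e i x)"
    using basis_coordinates[OF frame_fibre(1,2)[OF f(1,2)] B.finite_idx] by metis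
  have "(\<lambda>y. \<Sum>i\<in>N. \<kappa> v i *\<^sub>R sec_scale \<beta> (e i) y) \<in> Sec L"
    by (rule sec_sum) (rule f(11))
  moreover have "v = (\<Sum>i\<in>N. \<kappa> v i *\<^sub>R sec_scale \<beta> (e i) x)"
    using \<kappa>[of v] assms frame_fibre(3)[OF f(1,2)] f(8,9) by (simp add: sec_scale_def)
  ultimately show ?thesis by (rule that[OF _ sym])
qed

lemma sections_through:
  assumes "set vs \<subseteq> efib L x"
  obtains Vs where "set Vs \<subseteq> Sec L" "map (\<lambda>V. V x) Vs = vs"
proof -
  have "\<exists>V. V \<in> Sec L \<and> V x = v" if "v \<in> efib L x" for v using section_through[OF that] by metis
  then obtain s where s: "\<And>v. v \<in> efib L x \<Longrightarrow> s v \<in> Sec L \<and> s v x = v" by metis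
  have "set (map s vs) \<subseteq> Sec L" "map (\<lambda>V. V x) (map s vs) = vs"
    using assms s by (auto intro!: map_idI)
  then show ?thesis using that by blast
qed


subsection \<open>Smoothness of forms\<close>

text \<open>The coefficients are minors of the coordinate functions of the sections. They are smooth
  and serve all forms and all points of S simultaneously.\<close>

lemma section_list_coeffs:
  assumes U: "is_frame U e" and S: "open S" "S \<subseteq> U" and s: "\<And>s. s \<in> set ss \<Longrightarrow> section_on S s"
  shows "\<exists>m. smooth_coeffs S m \<and> (\<forall>x\<in>S. \<forall>\<omega>\<in>Alt x.
      \<omega> (map (\<lambda>s. s x) ss) = (\<Sum>I\<in>Pow N. m I x * \<omega> (frame_list e I x)))"
proof -
  have "\<exists>c. (\<forall>i\<in>N. smooth S (c i)) \<and> (\<forall>x\<in>S. s x = (\<Sum>i\<in>N. c i x *\<^sub>R e i x))"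
    if ss: "s \<in> set ss" for s
  proof -
    obtain c where c: "\<And>i. i \<in> N \<Longrightarrow> smooth (S \<inter> U) (c i)"
      "\<And>x. x \<in> S \<Longrightarrow> x \<in> U \<Longrightarrow> s x = (\<Sum>i\<in>N. c i x *\<^sub>R e i x)" by (rule section_onD[OF s[OF ss] U]) blast
    then show ?thesis using S(2) by (intro exI[of _ c]) (auto simp: Int_absorb2 subset_iff)
  qed
  then obtain C where C: "\<And>s i. s \<in> set ss \<Longrightarrow> i \<in> N \<Longrightarrow> smooth S (C s i)"
    "\<And>s x. s \<in> set ss \<Longrightarrow> x \<in> S \<Longrightarrow> s x = (\<Sum>i\<in>N. C s i x *\<^sub>R e i x)" by metis
  let ?m = "\<lambda>I x. minor (map (\<lambda>c i. c i x) (map C ss)) I"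
  have "smooth S (?m I)" if "I \<subseteq> N" for I
    by (rule M.minor_smooth[OF S(1) _ that]) (auto intro: C(1))
  moreover have "\<omega> (map (\<lambda>s. s x) ss) = (\<Sum>I\<in>Pow N. ?m I x * \<omega> (frame_list e I x))"
    if x: "x \<in> S" and w: "\<omega> \<in> Alt x" for x \<omega>
  proof -
    have "x \<in> U" using x S(2) by auto
    have m: "map (\<lambda>s. s x) ss = map (\<lambda>c. \<Sum>i\<in>N. c i *\<^sub>R e i x) (map (\<lambda>c i. c i x) (map C ss))"
      using C(2) x by simp
    show ?thesis
      unfolding frame_list_def m using frame_in[OF U \<open>x \<in> U\<close>]
      by (rule alt_forms_expand[OF w subspace_efib B.finite_idx])
  qed
  ultimately show ?thesis by (intro exI[of _ ?m]) blast
qed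

lemma form_eval_smooth_in_frame:
  assumes U: "is_frame U e" and S: "open S" "S \<subseteq> U"
    and alt: "\<And>x. x \<in> S \<Longrightarrow> \<eta> x \<in> Alt x"
    and sm: "\<And>I. I \<subseteq> N \<Longrightarrow> smooth S (\<lambda>x. \<eta> x (frame_list e I x))"
    and s: "\<And>s. s \<in> set ss \<Longrightarrow> section_on S s"
  shows "smooth S (\<lambda>x. \<eta> x (map (\<lambda>s. s x) ss))"
proof -
  from section_list_coeffs[OF U S s] obtain m where m: "smooth_coeffs S m"
    "\<forall>x\<in>S. \<forall>\<omega>\<in>Alt x.
      \<omega> (map (\<lambda>s. s x) ss) = (\<Sum>I\<in>Pow N. m I x * \<omega> (frame_list e I x))"
    by blast
  have "smooth S (\<lambda>x. \<Sum>I\<in>Pow N. m I x * \<eta> x (frame_list e I x))"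
    using m(1) by (intro M.smooth_fun_on_sum M.smooth_fun_on_mult S(1) sm) auto
  then show ?thesis
    by (rule M.smooth_fun_on_cong[OF S(1), rotated]) (use m(2) alt in simp)
qed

lemma frame_list_map: "frame_list e I x = map (\<lambda>s. s x) (map e (sorted_list_of_set I))"
  by (simp add: frame_list_def)

lemma set_sorted_frame: "I \<subseteq> N \<Longrightarrow> s \<in> set (map e (sorted_list_of_set I)) \<Longrightarrow> \<exists>i\<in>N. s = e i"
  using finite_subset[OF _ B.finite_idx, of I] by auto

lemma OmegaD: "\<eta> \<in> Omega L \<Longrightarrow> \<eta> x \<in> Alt x"
  by (simp add: Omega_def)

lemma OmegaD_smooth: "\<eta> \<in> Omega L \<Longrightarrow> is_frame U e \<Longrightarrow> I \<subseteq> N \<Longrightarrow> smooth U (\<lambda>x. \<eta> x (frame_list e I x))"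
  unfolding Omega_def by blast

text \<open>One frame near each point suffices: the members of another frame are smooth sections,
  and the value of a form on a list of sections is a combination, with smooth minors, of its
  components in the first frame.\<close>

lemma OmegaI_local:
  assumes alt: "\<And>x. \<eta> x \<in> Alt x"
    and loc: "\<And>x. \<exists>S U e. is_frame U e \<and> open S \<and> x \<in> S \<and> S \<subseteq> U \<and>
      (\<forall>I\<subseteq>N. smooth S (\<lambda>x. \<eta> x (frame_list e I x)))"
  shows "\<eta> \<in> Omega L"
proof -
  have "smooth U' (\<lambda>x. \<eta> x (frame_list e' J x))" if U': "is_frame U' e'" and J: "J \<subseteq> N" for U' e' J
  proof (rule M.smooth_fun_on_local[OF B.frame_open[OF U']])
    fix x assume "x \<in> U'"
    obtain S U e where *: "is_frame U e" "open S" "x \<in> S" "S \<subseteq> U"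
      "\<And>I. I \<subseteq> N \<Longrightarrow> smooth S (\<lambda>x. \<eta> x (frame_list e I x))" using loc[of x] by blast
    have "smooth (U' \<inter> S) (\<lambda>x. \<eta> x (frame_list e' J x))"
      unfolding frame_list_map
    proof (rule form_eval_smooth_in_frame[OF *(1) _ _ alt])
      show "open (U' \<inter> S)" by (intro open_Int *(2) B.frame_open[OF U'])
      show "U' \<inter> S \<subseteq> U" using *(4) by auto
      show "smooth (U' \<inter> S) (\<lambda>x. \<eta> x (frame_list e I x))" if "I \<subseteq> N" for I
        by (rule M.smooth_fun_on_subset[OF *(5)[OF that]]) auto
      fix s assume "s \<in> set (map e' (sorted_list_of_set J))"
      from set_sorted_frame[OF J this] obtain i where "i \<in> N" "s = e' i" by (rule bexE)
      then show "section_on (U' \<inter> S) s" using frame_section_on[OF U', of i "U' \<inter> S"] by simp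
    qed
    then show "\<exists>N. open N \<and> x \<in> N \<and> smooth (U' \<inter> N) (\<lambda>x. \<eta> x (frame_list e' J x))"
      using *(2,3) by blast
  qed
  then show ?thesis using alt by (auto simp: Omega_def)
qed

lemma OmegaI:
  assumes "\<And>x. \<eta> x \<in> Alt x"
    and "\<And>U e I. is_frame U e \<Longrightarrow> I \<subseteq> N \<Longrightarrow> smooth U (\<lambda>x. \<eta> x (frame_list e I x))"
  shows "\<eta> \<in> Omega L"
  using assms by (auto simp: Omega_def)

lemma Omega_eval_smooth:
  assumes \<eta>: "\<eta> \<in> Omega L" and S: "open S" and s: "\<And>s. s \<in> set ss \<Longrightarrow> section_on S s"
  shows "smooth S (\<lambda>x. \<eta> x (map (\<lambda>s. s x) ss))"
proof (rule M.smooth_fun_on_local[OF S])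
  fix x
  obtain U e where U: "is_frame U e" "x \<in> U" by (rule frame_at)
  have "smooth (S \<inter> U) (\<lambda>x. \<eta> x (map (\<lambda>s. s x) ss))"
  proof (rule form_eval_smooth_in_frame[OF U(1) _ _ OmegaD[OF \<eta>]])
    show "open (S \<inter> U)" using S B.frame_open[OF U(1)] by auto
    show "smooth (S \<inter> U) (\<lambda>x. \<eta> x (frame_list e I x))" if "I \<subseteq> N" for I
      by (rule M.smooth_fun_on_subset[OF OmegaD_smooth[OF \<eta> U(1) that]]) auto
    show "section_on (S \<inter> U) s" if "s \<in> set ss" for s
      by (rule section_on_subset[OF s[OF that]]) auto
  qed auto
  then show "\<exists>N. open N \<and> x \<in> N \<and> smooth (S \<inter> N) (\<lambda>x. \<eta> x (map (\<lambda>s. s x) ss))"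
    using U B.frame_open by blast
qed

lemma form_eval_Cinf: "\<eta> \<in> Omega L \<Longrightarrow> set Vs \<subseteq> Sec L \<Longrightarrow> form_eval \<eta> Vs \<in> CM"
  unfolding Cinf_def form_eval_def mem_Collect_eq by (rule Omega_eval_smooth) (auto intro: sec_on)

lemma Omega_eqI:
  assumes "\<eta> \<in> Omega L" "\<theta> \<in> Omega L" "\<And>Vs. set Vs \<subseteq> Sec L \<Longrightarrow> form_eval \<eta> Vs = form_eval \<theta> Vs"
  shows "\<eta> = \<theta>"
proof
  fix x
  show "\<eta> x = \<theta> x"
  proof (rule alt_forms_eqI[OF OmegaD[OF assms(1)] OmegaD[OF assms(2)]])
    fix vs assume "set vs \<subseteq> efib L x"
    then obtain Vs where "set Vs \<subseteq> Sec L" "map (\<lambda>V. V x) Vs = vs" by (rule sections_through)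
    then show "\<eta> x vs = \<theta> x vs" using fun_cong[OF assms(3)[of Vs], of x] by (simp add: form_eval_def)
  qed
qed

section \<open>Dual frames and global forms with a prescribed value\<close>

text \<open>The forms are chosen at each point separately. Smoothness will enter through their
  values on the frame lists, which are the constants 0 and 1.\<close>

lemma dual_frame:
  assumes U: "is_frame U e"
  obtains \<epsilon> where "\<And>x I. x \<in> U \<Longrightarrow> \<epsilon> x I \<in> Alt x"
    "\<And>x I J. x \<in> U \<Longrightarrow> J \<subseteq> N \<Longrightarrow> \<epsilon> x I (frame_list e J x) = (if I = J then 1 else 0)"
proof -
  have "\<exists>\<epsilon>. (\<forall>I. \<epsilon> I \<in> Alt x) \<and>
      (\<forall>I J. J \<subseteq> N \<longrightarrow> \<epsilon> I (frame_list e J x) = (if I = J then 1 else 0))" if x: "x \<in> U" for x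
    using dual_forms_exist[OF frame_fibre(1,2)[OF U x] B.finite_idx frame_fibre(3)[OF U x]]
    unfolding frame_list_def by metis
  then obtain \<epsilon> where "\<And>x. x \<in> U \<Longrightarrow> (\<forall>I. \<epsilon> x I \<in> Alt x) \<and>
      (\<forall>I J. J \<subseteq> N \<longrightarrow> \<epsilon> x I (frame_list e J x) = (if I = J then 1 else 0))" by metis
  then show ?thesis using that[of \<epsilon>] by blast
qed

lemma frame_expand:
  assumes "is_frame U e" "x \<in> U" "set vs \<subseteq> efib L x"
  obtains cs where "\<And>\<omega>. \<omega> \<in> Alt x \<Longrightarrow>
    \<omega> vs = (\<Sum>I\<in>Pow N. minor cs I * \<omega> (frame_list e I x))"
  using alt_forms_expand_basis[OF frame_fibre(1,2)[OF assms(1,2)] B.finite_idx frame_fibre(3)[OF assms(1,2)] assms(3)]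
  unfolding frame_list_def by metis

text \<open>The value \<omega> is extended with constant coefficients in the dual frame and cut off
  by \<beta>. On frame lists this gives \<beta> times constants, and off K the form is zero.\<close>

lemma form_through:
  assumes w: "\<omega> \<in> Alt x0"
  obtains \<eta> where "\<eta> \<in> Omega L" "\<eta> x0 = \<omega>"
proof -
  obtain U e \<beta> K S where "bumped_frame x0 U e \<beta> K S" by (rule bumped_frame_exists)
  note f = bumped_frameD[OF this]
  obtain \<epsilon> where eps: "\<And>x I. x \<in> U \<Longrightarrow> \<epsilon> x I \<in> Alt x"
    "\<And>x I J. x \<in> U \<Longrightarrow> J \<subseteq> N \<Longrightarrow> \<epsilon> x I (frame_list e J x) = (if I = J then 1 else 0)"
    by (rule dual_frame[OF f(1)]) blast
  define \<eta> where "\<eta> x = (\<lambda>vs. \<Sum>I\<in>Pow N. (\<beta> x * \<omega> (frame_list e I x0)) * \<epsilon> x I vs)" for x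
  have out: "\<eta> x = (\<lambda>vs. 0)" if "x \<notin> K" for x using f(5)[OF that] by (simp add: \<eta>_def)
  have alt: "\<eta> x \<in> Alt x" for x
  proof (cases "x \<in> U")
    case True
    then show ?thesis unfolding \<eta>_def by (intro alt_forms_lincomb eps)
  next
    case False
    then have "\<eta> x = (\<lambda>vs. 0)" using out f(6) by blast
    then show ?thesis by (simp add: alt_forms_zero)
  qed
  have ev: "\<eta> x (frame_list e J x) = \<beta> x * \<omega> (frame_list e J x0)" if "x \<in> U" "J \<subseteq> N" for x J
    using that eps(2)[OF that] B.finite_idx by (simp add: \<eta>_def if_distrib[of "\<lambda>t. _ * t"] cong: if_cong)
  have "\<eta> \<in> Omega L"
  proof (rule OmegaI_local[OF alt])
    fix x
    show "\<exists>S U e. is_frame U e \<and> open S \<and> x \<in> S \<and> S \<subseteq> U \<and> (\<forall>I\<subseteq>N. smooth S (\<lambda>x. \<eta> x (frame_list e I x)))"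
    proof (cases "x \<in> U")
      case True
      have "smooth U (\<lambda>x. \<eta> x (frame_list e I x))" if "I \<subseteq> N" for I
      proof (rule M.smooth_fun_on_cong[OF B.frame_open[OF f(1)]])
        show "smooth U (\<lambda>x. \<beta> x * \<omega> (frame_list e I x0))"
          by (intro M.smooth_fun_on_mult M.smooth_fun_on_const M.Cinf_on f B.frame_open[OF f(1)])
      qed (simp add: ev that)
      then show ?thesis using True f(1) B.frame_open[OF f(1)] by blast
    next
      case False
      obtain U' e' where U': "is_frame U' e'" "x \<in> U'" by (rule frame_at)
      have o: "open (U' \<inter> - K)" using f(4) B.frame_open[OF U'(1)] by auto
      have "smooth (U' \<inter> - K) (\<lambda>x. \<eta> x (frame_list e' I x))" for I
        by (rule M.smooth_fun_on_cong[OF o _ M.smooth_fun_on_const[OF o, of 0]]) (simp add: out)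
      moreover have "x \<in> U' \<inter> - K" using U' False f(6) by auto
      ultimately show ?thesis using U' o by blast
    qed
  qed
  moreover have "\<eta> x0 = \<omega>"
  proof (rule alt_forms_eqI[OF alt w])
    fix vs assume "set vs \<subseteq> efib L x0"
    then obtain cs where cs: "\<And>\<omega>. \<omega> \<in> Alt x0 \<Longrightarrow>
      \<omega> vs = (\<Sum>I\<in>Pow N. minor cs I * \<omega> (frame_list e I x0))" by (rule frame_expand[OF f(1,2)]) blast
    show "\<eta> x0 vs = \<omega> vs"
      unfolding cs[OF alt] cs[OF w] by (intro sum.cong) (auto simp: ev f)
  qed
  ultimately show ?thesis using that by blast
qed


subsection \<open>Lie derivatives of functions\<close>

lemma anchor_tangent: "v \<in> efib L x \<Longrightarrow> anchor L x v \<in> tangent_space (base L) x"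
  using anchor_map by (simp add: smooth_bundle_map_def tangent_bundle_def)

lemma anchor_linear: "v \<in> efib L x \<Longrightarrow> w \<in> efib L x \<Longrightarrow>
    anchor L x (a *\<^sub>R v + b *\<^sub>R w) = a *\<^sub>R anchor L x v + b *\<^sub>R anchor L x w"
  using anchor_map unfolding smooth_bundle_map_def by blast

lemma anchor_0: "anchor L x 0 = 0"
  using anchor_linear[of 0 x 0 0 0] by (simp add: efib_closed)

lemma anchor_sum:
  assumes "\<And>i. i \<in> I \<Longrightarrow> e i \<in> efib L x"
  shows "anchor L x (\<Sum>i\<in>I. c i *\<^sub>R e i) = (\<Sum>i\<in>I. c i *\<^sub>R anchor L x (e i))"
  using assms
proof (induction I rule: infinite_finite_induct)
  case (insert i I)
  have "(\<Sum>i\<in>I. c i *\<^sub>R e i) \<in> efib L x"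
    using insert.prems by (intro subspace_sum[OF subspace_efib] efib_closed) auto
  then show ?case
    using insert anchor_linear[of "e i" x "\<Sum>i\<in>I. c i *\<^sub>R e i" "c i" 1] by simp
qed (simp_all add: anchor_0)

lemma Lie_fun_Cinf:
  assumes V: "V \<in> Sec L" and f: "f \<in> CM"
  shows "Lie_fun L V f \<in> CM"
  unfolding Cinf_def mem_Collect_eq
proof (rule M.smooth_fun_on_local)
  fix x
  obtain U e where U: "is_frame U e" "x \<in> U" by (rule frame_at)
  have oU: "open U" by (rule B.frame_open[OF U(1)])
  obtain c where c: "\<And>i. i \<in> N \<Longrightarrow> smooth (U \<inter> U) (c i)"
    "\<And>x. x \<in> U \<Longrightarrow> x \<in> U \<Longrightarrow> V x = (\<Sum>i\<in>N. c i x *\<^sub>R e i x)"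
    by (rule section_onD[OF sec_on[OF V, of U] U(1)]) blast
  have "smooth_section_on (base L) (tangent_bundle (base L)) U (\<lambda>x. anchor L x (e i x))" if "i \<in> N" for i
    using anchor_map U(1) that unfolding smooth_bundle_map_def by blast
  then have "smooth U (\<lambda>x. anchor L x (e i x) f)" if "i \<in> N" for i
    using that by (intro M.smooth_tangent_section_apply oU f)
  then have "smooth U (\<lambda>x. \<Sum>i\<in>N. c i x * anchor L x (e i x) f)"
    using c(1) by (intro M.smooth_fun_on_sum M.smooth_fun_on_mult oU) simp_all
  then have "smooth U (Lie_fun L V f)"
  proof (rule M.smooth_fun_on_cong[OF oU, rotated])
    fix x assume x: "x \<in> U"
    show "(\<Sum>i\<in>N. c i x * anchor L x (e i x) f) = Lie_fun L V f x"
      unfolding Lie_fun_def c(2)[OF x x]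
      by (subst anchor_sum) (use frame_in[OF U(1) x] in \<open>simp_all add: sum_fun_apply\<close>)
  qed
  then show "\<exists>N. open N \<and> x \<in> N \<and> smooth (UNIV \<inter> N) (Lie_fun L V f)"
    using U(2) oU by auto
qed simp

lemma Lie_fun_comb:
  assumes "V \<in> Sec L" "f \<in> CM" "g \<in> CM"
  shows "Lie_fun L V (\<lambda>x. a * f x + b * g x) x = a * Lie_fun L V f x + b * Lie_fun L V g x"
proof -
  have "(\<lambda>x. a * f x + b * g x) = a *\<^sub>R f + b *\<^sub>R g" by (simp add: fun_eq_iff)
  then show ?thesis
    using anchor_tangent[OF sec_in[OF assms(1), of x]] assms(2,3) by (simp add: tangent_space_def Lie_fun_def)
qed

lemma Lie_fun_mult:
  assumes "V \<in> Sec L" "f \<in> CM" "g \<in> CM"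
  shows "Lie_fun L V (\<lambda>x. f x * g x) x = f x * Lie_fun L V g x + g x * Lie_fun L V f x"
  using anchor_tangent[OF sec_in[OF assms(1), of x]] assms(2,3) by (simp add: tangent_space_def Lie_fun_def)

lemma Lie_fun_add:
  "V \<in> Sec L \<Longrightarrow> f \<in> CM \<Longrightarrow> g \<in> CM \<Longrightarrow>
    Lie_fun L V (\<lambda>x. f x + g x) x = Lie_fun L V f x + Lie_fun L V g x"
  using Lie_fun_comb[of V f g 1 1 x] by simp

lemma Lie_fun_diff:
  "V \<in> Sec L \<Longrightarrow> f \<in> CM \<Longrightarrow> g \<in> CM \<Longrightarrow>
    Lie_fun L V (\<lambda>x. f x - g x) x = Lie_fun L V f x - Lie_fun L V g x"
  using Lie_fun_comb[of V f g 1 "-1" x] by simp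

lemma Lie_fun_const:
  assumes "V \<in> Sec L"
  shows "Lie_fun L V (\<lambda>x. c) x = 0"
proof -
  have "Lie_fun L V (\<lambda>x. 1) x = 0"
    using Lie_fun_mult[OF assms M.Cinf_const[of 1] M.Cinf_const[of 1], of x] by simp
  then show ?thesis
    using Lie_fun_comb[OF assms M.Cinf_const[of 1] M.Cinf_const[of 1], of c 0 x] by simp
qed

lemma Lie_fun_sum:
  assumes V: "V \<in> Sec L" and f: "\<And>i. i \<in> I \<Longrightarrow> f i \<in> CM"
  shows "Lie_fun L V (\<lambda>x. \<Sum>i\<in>I. f i x) x = (\<Sum>i\<in>I. Lie_fun L V (f i) x)"
  using f
proof (induction I rule: infinite_finite_induct)
  case (insert i I)
  have "Lie_fun L V (\<lambda>x. f i x + (\<Sum>i\<in>I. f i x)) x = Lie_fun L V (f i) x + Lie_fun L V (\<lambda>x. \<Sum>i\<in>I. f i x) x"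
    using insert.prems by (intro Lie_fun_add V M.Cinf_sum) auto
  then show ?case using insert by simp
qed (simp_all add: Lie_fun_const V)

text \<open>With a bump function \<beta> supported in S, the function \<beta> (f - g) vanishes
  identically. The product rule at x, where \<beta> = 1 and f = g, then leaves the derivative of f -
  g.\<close>

lemma Lie_fun_local:
  assumes V: "V \<in> Sec L" and f: "f \<in> CM" "g \<in> CM" and S: "open S" "x \<in> S" "\<And>y. y \<in> S \<Longrightarrow> f y = g y"
  shows "Lie_fun L V f x = Lie_fun L V g x"
proof -
  obtain \<beta> K T where b: "\<beta> \<in> CM" "closed K" "\<And>x. x \<notin> K \<Longrightarrow> \<beta> x = 0" "K \<subseteq> S"
    "open T" "x \<in> T" "\<And>x. x \<in> T \<Longrightarrow> \<beta> x = 1"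
    by (rule M.bump_exists[OF S(1,2)]) blast
  have "\<beta> y * (f y - g y) = 0" for y
    using b(3)[of y] b(4) S(3)[of y] by (cases "y \<in> K") auto
  then have "Lie_fun L V (\<lambda>y. \<beta> y * (f y - g y)) x = 0" by (simp only: Lie_fun_const[OF V])
  moreover have "Lie_fun L V (\<lambda>y. \<beta> y * (f y - g y)) x =
      \<beta> x * Lie_fun L V (\<lambda>y. f y - g y) x + (f x - g x) * Lie_fun L V \<beta> x"
    by (intro Lie_fun_mult V b(1) M.Cinf_diff f)
  ultimately show ?thesis using b(7)[OF b(6)] S(3)[OF S(2)] by (simp add: Lie_fun_diff V f)
qed

lemma Lie_fun_sec_scale:
  assumes "V \<in> Sec L"
  shows "Lie_fun L (sec_scale g V) f x = g x * Lie_fun L V f x"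
  using anchor_linear[of "V x" x "V x" "g x" 0] sec_in[OF assms]
  by (simp add: Lie_fun_def sec_scale_def)


subsection \<open>The bracket\<close>

lemma bracket_comb_right:
  assumes "U \<in> Sec L" "V \<in> Sec L" "W \<in> Sec L"
  shows "bracket L U (a *\<^sub>R V + b *\<^sub>R W) = a *\<^sub>R bracket L U V + b *\<^sub>R bracket L U W"
proof -
  have "bracket L U (a *\<^sub>R V + b *\<^sub>R W) = - bracket L (a *\<^sub>R V + b *\<^sub>R W) U"
    by (intro bracket_skew sec_add sec_scaleR assms)
  also have "\<dots> = a *\<^sub>R - bracket L V U + b *\<^sub>R - bracket L W U"
    by (simp add: bracket_linear assms)
  also have "\<dots> = a *\<^sub>R bracket L U V + b *\<^sub>R bracket L U W"
    by (simp only: bracket_skew[OF assms(1,2)] bracket_skew[OF assms(1,3)])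
  finally show ?thesis .
qed

lemma bracket_add_right:
  "U \<in> Sec L \<Longrightarrow> V \<in> Sec L \<Longrightarrow> W \<in> Sec L \<Longrightarrow> bracket L U (V + W) = bracket L U V + bracket L U W"
  using bracket_comb_right[of U V W 1 1] by simp

lemma bracket_jacobi_commutator:
  assumes "V \<in> Sec L" "W \<in> Sec L" "S \<in> Sec L"
  shows "bracket L V (bracket L W S) - bracket L W (bracket L V S) = bracket L (bracket L V W) S"
proof -
  have "bracket L W (bracket L S V) = - bracket L W (bracket L V S)"
    using bracket_comb_right[OF assms(2) bracket_closed[OF assms(1,3)] bracket_closed[OF assms(1,3)], of "-1" 0]
    by (simp add: bracket_skew[OF assms(3,1)])
  moreover have "bracket L S (bracket L V W) = - bracket L (bracket L V W) S"
    by (intro bracket_skew bracket_closed assms)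
  ultimately show ?thesis using bracket_jacobi[OF assms] by (simp add: algebra_simps)
qed

lemma bracket_scale_left:
  assumes "V \<in> Sec L" "W \<in> Sec L" "f \<in> CM"
  shows "bracket L (sec_scale f V) W = sec_scale f (bracket L V W) - sec_scale (Lie_fun L W f) V"
proof -
  have "bracket L (sec_scale f V) W = - bracket L W (sec_scale f V)"
    by (intro bracket_skew sec_scale_in assms)
  also have "\<dots> = - (sec_scale f (bracket L W V) + sec_scale (Lie_fun L W f) V)"
    by (simp only: bracket_leibniz[OF assms(2,1,3)])
  also have "\<dots> = sec_scale f (bracket L V W) - sec_scale (Lie_fun L W f) V"
    by (simp add: bracket_skew[OF assms(1,2)] fun_eq_iff sec_scale_def)
  finally show ?thesis .
qed

text \<open>The anchor is a homomorphism by the Jacobi identity for \<open>V\<close>, \<open>W\<close>, \<open>f S\<close>, where \<open>S\<close> does not vanish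
  at the given point; there is no such section if the rank is 0.\<close>

lemma Lie_fun_bracket:
  assumes V: "V \<in> Sec L" and W: "W \<in> Sec L" and f: "f \<in> CM"
  shows "Lie_fun L (bracket L V W) f x = Lie_fun L V (Lie_fun L W f) x - Lie_fun L W (Lie_fun L V f) x"
proof (cases "\<exists>v\<in>efib L x. v \<noteq> 0")
  case True
  then obtain v where v: "v \<in> efib L x" "v \<noteq> 0" by blast
  obtain S where S: "S \<in> Sec L" "S x = v" by (rule section_through[OF v(1)])
  \<comment> \<open>The two terms with a first derivative of f are together symmetric in A and B, so
    they drop out of the commutator.\<close>
  have second: "bracket L A (bracket L B (sec_scale f S)) y =
      f y *\<^sub>R bracket L A (bracket L B S) y + Lie_fun L A f y *\<^sub>R bracket L B S y +
      (Lie_fun L B f y *\<^sub>R bracket L A S y + Lie_fun L A (Lie_fun L B f) y *\<^sub>R S y)"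
    if "A \<in> Sec L" "B \<in> Sec L" for A B y
  proof -
    have "bracket L A (bracket L B (sec_scale f S)) =
        bracket L A (sec_scale f (bracket L B S)) + bracket L A (sec_scale (Lie_fun L B f) S)"
      unfolding bracket_leibniz[OF that(2) S(1) f]
      by (intro bracket_add_right that sec_scale_in bracket_closed S f Lie_fun_Cinf)
    then show ?thesis
      unfolding bracket_leibniz[OF that(1) bracket_closed[OF that(2) S(1)] f]
        bracket_leibniz[OF that(1) S(1) Lie_fun_Cinf[OF that(2) f]]
      by (simp only: plus_fun_apply sec_scale_def)
  qed
  have "bracket L (bracket L V W) (sec_scale f S) x =
      f x *\<^sub>R bracket L (bracket L V W) S x + Lie_fun L (bracket L V W) f x *\<^sub>R S x"
    unfolding bracket_leibniz[OF bracket_closed[OF V W] S(1) f] by (simp only: plus_fun_apply sec_scale_def)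
  moreover have "bracket L (bracket L V W) (sec_scale f S) x =
      bracket L V (bracket L W (sec_scale f S)) x - bracket L W (bracket L V (sec_scale f S)) x"
    using fun_cong[OF bracket_jacobi_commutator[OF V W sec_scale_in[OF S(1) f]], of x] by simp
  moreover have "bracket L (bracket L V W) S x = bracket L V (bracket L W S) x - bracket L W (bracket L V S) x"
    using fun_cong[OF bracket_jacobi_commutator[OF V W S(1)], of x] by simp
  ultimately have "Lie_fun L (bracket L V W) f x *\<^sub>R S x =
      (Lie_fun L V (Lie_fun L W f) x - Lie_fun L W (Lie_fun L V f) x) *\<^sub>R S x"
    by (simp add: second V W algebra_simps)
  then show ?thesis using S(2) v(2) by simp
next
  case False
  then have 0: "A x = 0" if "A \<in> Sec L" for A using sec_in[OF that] by blast
  show ?thesis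
    unfolding Lie_fun_def by (simp add: 0[OF V] 0[OF W] 0[OF bracket_closed[OF V W]] anchor_0)
qed


subsection \<open>Lie derivatives of forms\<close>

lemma form_eval_add:
  assumes "\<eta> \<in> Omega L" "A \<in> Sec L" "B \<in> Sec L"
  shows "form_eval \<eta> (us @ (A + B) # ws) = (\<lambda>x. form_eval \<eta> (us @ A # ws) x + form_eval \<eta> (us @ B # ws) x)"
  by (simp add: fun_eq_iff form_eval_def alt_forms_add[OF OmegaD[OF assms(1)] sec_in[OF assms(2)] sec_in[OF assms(3)]])

lemma form_eval_scale:
  assumes "\<eta> \<in> Omega L" "A \<in> Sec L"
  shows "form_eval \<eta> (us @ sec_scale f A # ws) = (\<lambda>x. f x * form_eval \<eta> (us @ A # ws) x)"
  by (simp add: fun_eq_iff form_eval_def sec_scale_def alt_forms_scale[OF OmegaD[OF assms(1)] sec_in[OF assms(2)]])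

lemma form_eval_diff:
  assumes "\<eta> \<in> Omega L" "A \<in> Sec L" "B \<in> Sec L"
  shows "form_eval \<eta> (us @ A # ws) - form_eval \<eta> (us @ B # ws) = form_eval \<eta> (us @ (A - B) # ws)"
  using form_eval_add[OF assms(1) sec_diff[OF assms(2,3)] assms(3), of us ws] by (simp add: fun_eq_iff)

text \<open>The value of the Lie derivative of \<open>\<eta>\<close> on sections; being tensorial in them, it comes from a form.\<close>

definition lie_eval :: "('m \<Rightarrow> 'v) \<Rightarrow> ('m, 'v) form \<Rightarrow> ('m \<Rightarrow> 'v) list \<Rightarrow> 'm \<Rightarrow> real" where
  "lie_eval V \<eta> Vs x = Lie_fun L V (form_eval \<eta> Vs) x - slot_sum (bracket L V) (\<lambda>Ws. form_eval \<eta> Ws x) Vs"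

lemma slot_list_in: "V \<in> Sec L \<Longrightarrow> set Vs \<subseteq> Sec L \<Longrightarrow> i < length Vs \<Longrightarrow>
    set (Vs[i := bracket L V (Vs ! i)]) \<subseteq> Sec L"
  using set_update_subset_insert[of Vs i "bracket L V (Vs ! i)"] bracket_closed nth_mem by blast

lemma lie_eval_Cinf:
  assumes "V \<in> Sec L" "\<eta> \<in> Omega L" "set Vs \<subseteq> Sec L"
  shows "lie_eval V \<eta> Vs \<in> CM"
proof -
  have "(\<lambda>x. Lie_fun L V (form_eval \<eta> Vs) x - (\<Sum>i<length Vs. form_eval \<eta> (Vs[i := bracket L V (Vs ! i)]) x)) \<in> CM"
    by (intro M.Cinf_diff M.Cinf_sum Lie_fun_Cinf form_eval_Cinf slot_list_in assms) auto
  then show ?thesis by (simp add: lie_eval_def[abs_def] slot_sum_def)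
qed

section \<open>Tensoriality of the formula for the Lie derivative of a form\<close>

lemma lie_eval_add:
  assumes V: "V \<in> Sec L" and \<eta>: "\<eta> \<in> Omega L" and us: "set us \<subseteq> Sec L" "set ws \<subseteq> Sec L"
    and A: "A \<in> Sec L" "B \<in> Sec L"
  shows "lie_eval V \<eta> (us @ (A + B) # ws) x = lie_eval V \<eta> (us @ A # ws) x + lie_eval V \<eta> (us @ B # ws) x"
proof -
  have "Lie_fun L V (form_eval \<eta> (us @ (A + B) # ws)) x =
      Lie_fun L V (form_eval \<eta> (us @ A # ws)) x + Lie_fun L V (form_eval \<eta> (us @ B # ws)) x"
    unfolding form_eval_add[OF \<eta> A] by (intro Lie_fun_add V form_eval_Cinf \<eta>) (use us A in auto)
  moreover have "form_eval \<eta> ((us @ [A + B]) @ zs) x = form_eval \<eta> ((us @ [A]) @ zs) x + form_eval \<eta> ((us @ [B]) @ zs) x" for zs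
    using form_eval_add[OF \<eta> A, of us zs] by simp
  ultimately show ?thesis
    by (simp add: lie_eval_def slot_sum_append slot_sum_Cons slot_sum_add form_eval_add[OF \<eta> A]
      bracket_add_right V A form_eval_add[OF \<eta> bracket_closed[OF V A(1)] bracket_closed[OF V A(2)]])
qed

text \<open>The derivative of f arises twice, from the product rule for functions and from the
  Leibniz rule of the bracket, with opposite signs.\<close>

lemma lie_eval_scale:
  assumes V: "V \<in> Sec L" and \<eta>: "\<eta> \<in> Omega L" and us: "set us \<subseteq> Sec L" "set ws \<subseteq> Sec L"
    and A: "A \<in> Sec L" and f: "f \<in> CM"
  shows "lie_eval V \<eta> (us @ sec_scale f A # ws) x = f x * lie_eval V \<eta> (us @ A # ws) x"
proof -
  have "Lie_fun L V (form_eval \<eta> (us @ sec_scale f A # ws)) x =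
      f x * Lie_fun L V (form_eval \<eta> (us @ A # ws)) x + form_eval \<eta> (us @ A # ws) x * Lie_fun L V f x"
    unfolding form_eval_scale[OF \<eta> A] by (intro Lie_fun_mult V form_eval_Cinf \<eta> f) (use us A in auto)
  moreover have "form_eval \<eta> (us @ bracket L V (sec_scale f A) # ws) x =
      f x * form_eval \<eta> (us @ bracket L V A # ws) x + Lie_fun L V f x * form_eval \<eta> (us @ A # ws) x"
    unfolding bracket_leibniz[OF V A f]
    by (simp add: form_eval_add[OF \<eta> sec_scale_in[OF bracket_closed[OF V A] f] sec_scale_in[OF A Lie_fun_Cinf[OF V f]]]
      form_eval_scale[OF \<eta> A] form_eval_scale[OF \<eta> bracket_closed[OF V A]])
  ultimately show ?thesis
    by (simp add: lie_eval_def slot_sum_append slot_sum_Cons slot_sum_mult form_eval_scale[OF \<eta> A] algebra_simps)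
qed

text \<open>Only the two slots holding A contribute; with \<open>bracket L V A\<close> in one of
  them and A in the other, the two values differ by a swap and cancel.\<close>

lemma lie_eval_repeat:
  assumes V: "V \<in> Sec L" and \<eta>: "\<eta> \<in> Omega L" and A: "A \<in> Sec L"
  shows "lie_eval V \<eta> (us @ A # ws @ A # zs) x = 0"
proof -
  have rep: "form_eval \<eta> (us @ A # ws @ A # zs) = (\<lambda>x. 0)" for us ws zs
    by (auto simp: fun_eq_iff form_eval_def intro!: alt_forms_repeat[OF OmegaD[OF \<eta>]])
  have "form_eval \<eta> (us @ bracket L V A # ws @ A # zs) x = - form_eval \<eta> (us @ A # ws @ bracket L V A # zs) x"
    unfolding form_eval_def
    using alt_forms_swap[OF OmegaD[OF \<eta>] sec_in[OF bracket_closed[OF V A]] sec_in[OF A]] by simp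
  then show ?thesis
    using rep by (simp add: lie_eval_def slot_sum_append slot_sum_Cons Lie_fun_const V)
qed

lemma lie_eval_sum:
  assumes V: "V \<in> Sec L" and \<eta>: "\<eta> \<in> Omega L" and us: "set us \<subseteq> Sec L" "set ws \<subseteq> Sec L"
    and I: "finite I" and E: "\<And>i. i \<in> I \<Longrightarrow> E i \<in> Sec L" "\<And>i. i \<in> I \<Longrightarrow> g i \<in> CM"
  shows "(\<Sum>i\<in>I. sec_scale (g i) (E i)) \<in> Sec L \<and>
    lie_eval V \<eta> (us @ (\<Sum>i\<in>I. sec_scale (g i) (E i)) # ws) x = (\<Sum>i\<in>I. g i x * lie_eval V \<eta> (us @ E i # ws) x)"
  using I E
proof (induction I rule: finite_induct)
  case empty
  have "sec_scale (\<lambda>x. 0) 0 = (0 :: 'm \<Rightarrow> 'v)" by (simp add: sec_scale_def zero_fun_def)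
  then have "lie_eval V \<eta> (us @ 0 # ws) x = 0"
    using lie_eval_scale[OF V \<eta> us sec_0 M.Cinf_const[of 0], of x] by (simp only: mult_zero_left)
  then show ?case using sec_0 by (simp only: sum.empty simp_thms)
next
  case (insert i I)
  let ?S = "\<Sum>i\<in>I. sec_scale (g i) (E i)"
  have E: "E i \<in> Sec L" "g i \<in> CM" and gE: "sec_scale (g i) (E i) \<in> Sec L"
    using insert.prems by (auto intro: sec_scale_in)
  have IH: "?S \<in> Sec L"
    "lie_eval V \<eta> (us @ ?S # ws) x = (\<Sum>i\<in>I. g i x * lie_eval V \<eta> (us @ E i # ws) x)"
    using insert.IH insert.prems by auto
  show ?case
    unfolding sum.insert[OF insert.hyps] lie_eval_add[OF V \<eta> us gE IH(1)]
      lie_eval_scale[OF V \<eta> us E] IH(2)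
    using sec_add[OF gE IH(1)] by blast
qed

lemma frame_coeffs_0:
  assumes U: "is_frame U e" "x \<in> U" and 0: "(\<Sum>i\<in>N. c i *\<^sub>R e i x) = 0" and j: "j \<in> N"
  shows "c j = 0"
proof -
  obtain \<kappa> :: "'v \<Rightarrow> nat \<Rightarrow> real" where \<kappa>: "linear \<kappa>"
    "\<And>j. j \<in> N \<Longrightarrow> \<kappa> (e j x) = (\<lambda>i. if i = j then 1 else 0)"
    by (rule basis_coordinates[OF frame_fibre(1,2)[OF U] B.finite_idx]) blast
  have "0 = \<kappa> (\<Sum>i\<in>N. c i *\<^sub>R e i x) j" by (simp add: 0 linear_0[OF \<kappa>(1)])
  also have "\<dots> = (\<Sum>i\<in>N. c i * \<kappa> (e i x) j)"
    by (simp add: linear_sum[OF \<kappa>(1)] linear_scale[OF \<kappa>(1)] sum_fun_apply)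
  also have "\<dots> = (\<Sum>i\<in>N. if j = i then c i else 0)" by (rule sum.cong) (auto simp: \<kappa>(2))
  also have "\<dots> = c j" using j B.finite_idx by simp
  finally show ?thesis by simp
qed

text \<open>\<open>\<beta>\<^sup>2 A\<close> is a global combination of the sections \<open>\<beta> e\<^sub>i\<close>, with coefficients vanishing at \<open>x\<close>.\<close>

lemma lie_eval_tensorial_0:
  assumes V: "V \<in> Sec L" and \<eta>: "\<eta> \<in> Omega L" and us: "set us \<subseteq> Sec L" "set ws \<subseteq> Sec L"
    and A: "A \<in> Sec L" "A x = 0"
  shows "lie_eval V \<eta> (us @ A # ws) x = 0"
proof -
  obtain U e \<beta> K S where "bumped_frame x U e \<beta> K S" by (rule bumped_frame_exists)
  note f = bumped_frameD[OF this]
  obtain c where c: "\<And>i. i \<in> N \<Longrightarrow> smooth (UNIV \<inter> U) (c i)"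
    "\<And>x. x \<in> UNIV \<Longrightarrow> x \<in> U \<Longrightarrow> A x = (\<Sum>i\<in>N. c i x *\<^sub>R e i x)"
    by (rule section_onD[OF sec_on[OF A(1), of UNIV] f(1)]) blast
  have g: "(\<lambda>x. \<beta> x * c i x) \<in> CM" if "i \<in> N" for i
    unfolding Cinf_def mem_Collect_eq
    by (rule M.bump_mult_smooth[OF f(3-6) B.frame_open[OF f(1)] open_UNIV c(1)[OF that]])
  \<comment> \<open>One factor \<beta> makes the coefficients c i global, the other the frame
    sections.\<close>
  have bb: "(\<lambda>x. \<beta> x * \<beta> x) \<in> CM" by (intro M.Cinf_mult f)
  have "sec_scale (\<lambda>x. \<beta> x * \<beta> x) A y = (\<Sum>i\<in>N. sec_scale (\<lambda>x. \<beta> x * c i x) (sec_scale \<beta> (e i))) y" for y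
  proof (cases "y \<in> U")
    case True
    then show ?thesis
      using c(2)[of y] by (simp add: sec_scale_def sum_fun_apply scaleR_sum_right algebra_simps)
  next
    case False
    then have "\<beta> y = 0" using f(5,6) by blast
    then show ?thesis by (simp add: sec_scale_def sum_fun_apply)
  qed
  then have eq: "sec_scale (\<lambda>x. \<beta> x * \<beta> x) A = (\<Sum>i\<in>N. sec_scale (\<lambda>x. \<beta> x * c i x) (sec_scale \<beta> (e i)))" ..
  have "lie_eval V \<eta> (us @ A # ws) x = lie_eval V \<eta> (us @ sec_scale (\<lambda>x. \<beta> x * \<beta> x) A # ws) x"
    using f(9)[OF f(8)] by (simp add: lie_eval_scale[OF V \<eta> us A(1) bb])
  also have "\<dots> = (\<Sum>i\<in>N. (\<beta> x * c i x) * lie_eval V \<eta> (us @ sec_scale \<beta> (e i) # ws) x)"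
    unfolding eq using lie_eval_sum[OF V \<eta> us B.finite_idx, where E = "\<lambda>i. sec_scale \<beta> (e i)"
        and g = "\<lambda>i x. \<beta> x * c i x", OF f(11) g] by blast
  also have "\<dots> = 0"
  proof (rule sum.neutral, rule ballI)
    fix i assume "i \<in> N"
    then have "c i x = 0" using frame_coeffs_0[OF f(1,2), of "\<lambda>i. c i x"] c(2)[of x] f(2) A(2) by simp
    then show "\<beta> x * c i x * lie_eval V \<eta> (us @ sec_scale \<beta> (e i) # ws) x = 0" by simp
  qed
  finally show ?thesis .
qed

text \<open>The arguments are exchanged one at a time, with those already exchanged collected in
  \<open>us\<close>. Each exchange writes A = B + (A - B), where A - B vanishes at x.\<close>

lemma lie_eval_tensorial:
  assumes V: "V \<in> Sec L" and \<eta>: "\<eta> \<in> Omega L" and len: "length Vs = length Ws"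
  shows "set us \<subseteq> Sec L \<Longrightarrow> set Vs \<subseteq> Sec L \<Longrightarrow> set Ws \<subseteq> Sec L \<Longrightarrow>
    map (\<lambda>V. V x) Vs = map (\<lambda>V. V x) Ws \<Longrightarrow> lie_eval V \<eta> (us @ Vs) x = lie_eval V \<eta> (us @ Ws) x"
  using len
proof (induction Vs Ws arbitrary: us rule: list_induct2)
  case (Cons A Vs B Ws)
  have A: "A \<in> Sec L" "B \<in> Sec L" and Vs: "set Vs \<subseteq> Sec L" and "A x = B x" using Cons.prems by auto
  have "lie_eval V \<eta> (us @ (B + (A - B)) # Vs) x =
      lie_eval V \<eta> (us @ B # Vs) x + lie_eval V \<eta> (us @ (A - B) # Vs) x"
    by (intro lie_eval_add V \<eta> Cons.prems Vs A sec_diff)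
  moreover have "lie_eval V \<eta> (us @ (A - B) # Vs) x = 0"
    by (intro lie_eval_tensorial_0 V \<eta> Cons.prems Vs sec_diff A) (simp add: \<open>A x = B x\<close>)
  ultimately have "lie_eval V \<eta> (us @ A # Vs) x = lie_eval V \<eta> (us @ B # Vs) x" by simp
  also have "\<dots> = lie_eval V \<eta> (us @ B # Ws) x"
    using Cons.IH[of "us @ [B]"] Cons.prems by simp
  finally show ?case .
qed simp

text \<open>For every point a section through each fibre vector is chosen, and \<theta> is evaluated
  on these; \<open>lie_eval_tensorial\<close> makes the result independent of the choice. This is
  \<open>ev\<close>, from which multilinearity and smoothness follow by using more convenient
  sections.\<close>

lemma Lie_form_exists:
  assumes V: "V \<in> Sec L" and \<eta>: "\<eta> \<in> Omega L"
  shows "\<exists>\<theta>. \<theta> \<in> Omega L \<and> (\<forall>Vs. set Vs \<subseteq> Sec L \<longrightarrow> form_eval \<theta> Vs = lie_eval V \<eta> Vs)"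
proof -
  have "\<exists>s. \<forall>v\<in>efib L x. s v \<in> Sec L \<and> s v x = v" for x
  proof (rule bchoice, rule ballI)
    fix v assume "v \<in> efib L x"
    then obtain W where "W \<in> Sec L" "W x = v" by (rule section_through)
    then show "\<exists>W. W \<in> Sec L \<and> W x = v" by blast
  qed
  then obtain s where "\<forall>x. \<forall>v\<in>efib L x. s x v \<in> Sec L \<and> s x v x = v" using choice by metis
  then have s: "s x v \<in> Sec L" "s x v x = v" if "v \<in> efib L x" for x v using that by blast+
  then have sl: "set (map (s x) vs) \<subseteq> Sec L" "map (\<lambda>V. V x) (map (s x) vs) = vs" if "set vs \<subseteq> efib L x" for x vs
    using that by (auto intro!: map_idI)
  define \<theta> where "\<theta> x vs = (if set vs \<subseteq> efib L x then lie_eval V \<eta> (map (s x) vs) x else 0)" for x vs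
  have ev: "\<theta> x (map (\<lambda>V. V x) Vs) = lie_eval V \<eta> Vs x" if "set Vs \<subseteq> Sec L" for x Vs
  proof -
    have sub: "set (map (\<lambda>V. V x) Vs) \<subseteq> efib L x" using that sec_in by auto
    have "lie_eval V \<eta> ([] @ map (s x) (map (\<lambda>V. V x) Vs)) x = lie_eval V \<eta> ([] @ Vs) x"
      by (rule lie_eval_tensorial[OF V \<eta>]) (use sl[OF sub] that in \<open>simp_all only: length_map set_simps empty_subsetI\<close>)
    then show ?thesis using sub by (simp add: \<theta>_def)
  qed
  have alt: "\<theta> x \<in> Alt x" for x
  proof (rule alt_formsI)
    fix us ws v w a b
    assume *: "set us \<subseteq> efib L x" "set ws \<subseteq> efib L x" "v \<in> efib L x" "w \<in> efib L x"
    define A B where "A = sec_scale (\<lambda>x. a) (s x v)" and "B = sec_scale (\<lambda>x. b) (s x w)"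
    have AB: "A \<in> Sec L" "B \<in> Sec L" using s * by (auto simp: A_def B_def intro!: sec_scale_in M.Cinf_const)
    have sets: "set (map (s x) us @ (A + B) # map (s x) ws) \<subseteq> Sec L"
      using sl(1)[OF *(1)] sl(1)[OF *(2)] sec_add[OF AB] by auto
    have m: "map (\<lambda>V. V x) (map (s x) us @ (A + B) # map (s x) ws) = us @ (a *\<^sub>R v + b *\<^sub>R w) # ws"
      using sl(2)[OF *(1)] sl(2)[OF *(2)] s(2) * by (simp add: A_def B_def sec_scale_def)
    have "\<theta> x (us @ (a *\<^sub>R v + b *\<^sub>R w) # ws) = lie_eval V \<eta> (map (s x) us @ (A + B) # map (s x) ws) x"
      using ev[OF sets, of x] unfolding m .
    also have "\<dots> = a * lie_eval V \<eta> (map (s x) us @ s x v # map (s x) ws) x +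
        b * lie_eval V \<eta> (map (s x) us @ s x w # map (s x) ws) x"
      unfolding lie_eval_add[OF V \<eta> sl(1)[OF *(1)] sl(1)[OF *(2)] AB] unfolding A_def B_def
        lie_eval_scale[OF V \<eta> sl(1)[OF *(1)] sl(1)[OF *(2)] s(1)[OF *(3)] M.Cinf_const]
        lie_eval_scale[OF V \<eta> sl(1)[OF *(1)] sl(1)[OF *(2)] s(1)[OF *(4)] M.Cinf_const] ..
    finally show "\<theta> x (us @ (a *\<^sub>R v + b *\<^sub>R w) # ws) = a * \<theta> x (us @ v # ws) + b * \<theta> x (us @ w # ws)"
      using * by (simp add: \<theta>_def)
  next
    fix vs assume vs: "set vs \<subseteq> efib L x" "\<not> distinct vs"
    from not_distinct_decomp[OF vs(2)] obtain us ws zs v where "vs = us @ [v] @ ws @ [v] @ zs" by blast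
    then show "\<theta> x vs = 0"
      using vs(1) s(1) by (simp add: \<theta>_def lie_eval_repeat[OF V \<eta>])
  qed (simp add: \<theta>_def)
  have "\<theta> \<in> Omega L"
  proof (rule OmegaI_local[OF alt])
    fix x
    obtain U e \<beta> K S where "bumped_frame x U e \<beta> K S" by (rule bumped_frame_exists)
    note f = bumped_frameD[OF this]
    \<comment> \<open>The chosen sections vary with the point without any regularity. On S they are
      replaced by the fixed global sections \<beta> e_i, for which the value is a smooth
      function.\<close>
    have "smooth S (\<lambda>x. \<theta> x (frame_list e I x))" if I: "I \<subseteq> N" for I
    proof (rule M.smooth_fun_on_cong[OF f(7)])
      let ?E = "map (\<lambda>i. sec_scale \<beta> (e i)) (sorted_list_of_set I)"
      have "finite I" using I B.finite_idx finite_subset by blast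
      then have E: "set ?E \<subseteq> Sec L" using f(11) I by auto
      show "smooth S (lie_eval V \<eta> ?E)" by (intro M.Cinf_on lie_eval_Cinf V \<eta> E)
      fix y assume "y \<in> S"
      then have "map (\<lambda>V. V y) ?E = frame_list e I y" by (simp add: frame_list_def sec_scale_def f(9))
      with ev[OF E, of y] show "lie_eval V \<eta> ?E y = \<theta> y (frame_list e I y)" by simp
    qed
    then show "\<exists>S U e. is_frame U e \<and> open S \<and> x \<in> S \<and> S \<subseteq> U \<and> (\<forall>I\<subseteq>N. smooth S (\<lambda>x. \<theta> x (frame_list e I x)))"
      using f(1,7,8,10) by blast
  qed
  moreover have "form_eval \<theta> Vs = lie_eval V \<eta> Vs" if "set Vs \<subseteq> Sec L" for Vs
    using ev[OF that] by (simp add: form_eval_def fun_eq_iff)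
  ultimately show ?thesis by blast
qed

text \<open>\<open>Lie_form\<close> is a definite description. It is well defined by the existence
  just shown and by \<open>Omega_eqI\<close>: a form is determined by its values on global sections,
  as every fibre vector lies on one.\<close>

lemma
  assumes V: "V \<in> Sec L" and \<eta>: "\<eta> \<in> Omega L"
  shows Lie_form_Omega: "Lie_form L V \<eta> \<in> Omega L"
    and form_eval_Lie_form: "set Vs \<subseteq> Sec L \<Longrightarrow> form_eval (Lie_form L V \<eta>) Vs = lie_eval V \<eta> Vs"
    and Lie_form_eqI: "\<theta> \<in> Omega L \<Longrightarrow> (\<And>Vs. set Vs \<subseteq> Sec L \<Longrightarrow> form_eval \<theta> Vs = lie_eval V \<eta> Vs) \<Longrightarrow>
      Lie_form L V \<eta> = \<theta>"
proof -
  let ?P = "\<lambda>\<theta>. \<theta> \<in> Omega L \<and> (\<forall>Vs. set Vs \<subseteq> Sec L \<longrightarrow> form_eval \<theta> Vs = lie_eval V \<eta> Vs)"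
  have lie: "Lie_fun L V (form_eval \<eta> Vs) - (\<Sum>i<length Vs. form_eval \<eta> (Vs[i := bracket L V (Vs ! i)])) = lie_eval V \<eta> Vs" for Vs
    by (simp add: fun_eq_iff lie_eval_def slot_sum_def sum_fun_apply)
  have eq: "Lie_form L V \<eta> = (THE \<theta>. ?P \<theta>)" by (simp add: Lie_form_def lie)
  have un: "\<theta> = \<theta>'" if "?P \<theta>" "?P \<theta>'" for \<theta> \<theta>'
    using that by (intro Omega_eqI) auto
  obtain \<theta>0 where t: "?P \<theta>0" using Lie_form_exists[OF V \<eta>] by blast
  have the: "Lie_form L V \<eta> = \<theta>0" unfolding eq by (rule the_equality[where P = ?P, OF t]) (rule un[OF _ t])
  show "Lie_form L V \<eta> \<in> Omega L" using the t by simp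
  show "set Vs \<subseteq> Sec L \<Longrightarrow> form_eval (Lie_form L V \<eta>) Vs = lie_eval V \<eta> Vs" using the t by simp
  show "\<theta> \<in> Omega L \<Longrightarrow> (\<And>Vs. set Vs \<subseteq> Sec L \<Longrightarrow> form_eval \<theta> Vs = lie_eval V \<eta> Vs) \<Longrightarrow> Lie_form L V \<eta> = \<theta>"
    unfolding the by (rule un[OF t]) blast
qed


subsection \<open>Multivector fields in frames\<close>

lemma Avec_coeffs:
  assumes P: "P \<in> Avec L" and U: "is_frame U e"
  shows "\<exists>c. smooth_coeffs U c \<and> expands U e P c"
proof -
  have "(U, \<lambda>I x. wedge_vecs (efib L x) (frame_list e I x)) \<in> frames (ext_bundle (ebundle L))"
    using U by (force simp: ext_bundle_def)
  with P obtain c where c: "\<forall>I\<in>Pow N. smooth (UNIV \<inter> U) (c I)"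
    "\<forall>x\<in>UNIV \<inter> U. P x = (\<Sum>I\<in>Pow N. c I x *\<^sub>R wedge_vecs (efib L x) (frame_list e I x))"
    unfolding Avec_def smooth_sections_def smooth_section_on_def mem_Collect_eq
    by (fastforce simp: ext_bundle_def)
  then show ?thesis by (intro exI[of _ c]) (simp add: sum_fun_apply wedge_vecs_def)
qed

lemma Avec_outside:
  assumes P: "P \<in> Avec L" and w: "\<omega> \<notin> Alt x"
  shows "P x \<omega> = 0"
proof -
  obtain U e where U: "is_frame U e" "x \<in> U" by (rule frame_at)
  have "(U, \<lambda>I x. wedge_vecs (efib L x) (frame_list e I x)) \<in> frames (ext_bundle (ebundle L))"
    using U by (force simp: ext_bundle_def)
  with P U(2) obtain c where
    "P x = (\<Sum>I\<in>Pow N. c I x *\<^sub>R wedge_vecs (efib L x) (frame_list e I x))"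
    unfolding Avec_def smooth_sections_def smooth_section_on_def mem_Collect_eq
    by (fastforce simp: ext_bundle_def)
  then show ?thesis using w by (simp add: sum_fun_apply wedge_vecs_def)
qed

text \<open>The coefficients in the expansion of \<open>vs\<close> are common to all forms, so
  applying the expansion to \<open>\<epsilon> J\<close> identifies the one with index J as
  \<open>\<epsilon> J vs\<close>.\<close>

lemma form_dual_expand:
  assumes U: "is_frame U e" "x \<in> U" and w: "\<omega> \<in> Alt x" and vs: "set vs \<subseteq> efib L x"
    and eps: "\<And>I. \<epsilon> I \<in> Alt x"
      "\<And>I J. J \<subseteq> N \<Longrightarrow> \<epsilon> I (frame_list e J x) = (if I = J then 1 else 0)"
  shows "\<omega> vs = (\<Sum>J\<in>Pow N. \<epsilon> J vs * \<omega> (frame_list e J x))"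
proof -
  obtain cs where cs: "\<And>\<omega>. \<omega> \<in> Alt x \<Longrightarrow>
    \<omega> vs = (\<Sum>I\<in>Pow N. minor cs I * \<omega> (frame_list e I x))"
    by (rule frame_expand[OF U vs]) blast
  have "\<epsilon> J vs = minor cs J" if "J \<in> Pow N" for J
  proof -
    have "\<epsilon> J vs = (\<Sum>I\<in>Pow N. if J = I then minor cs I else 0)"
      unfolding cs[OF eps(1)] by (intro sum.cong) (auto simp: eps(2))
    then show ?thesis using that B.finite_idx by simp
  qed
  then show ?thesis by (simp add: cs[OF w])
qed

text \<open>In another frame e' the coefficients can only be the values of P on the dual forms
  \<epsilon>. Near a point they are combinations of the given c I with values of \<epsilon> on the
  first frame, and these are smooth because \<epsilon> has constant components in e'.\<close>

lemma AvecI_local: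
  assumes out: "\<And>x \<omega>. \<omega> \<notin> Alt x \<Longrightarrow> P x \<omega> = 0"
    and loc: "\<And>x. \<exists>S U e c. is_frame U e \<and> open S \<and> x \<in> S \<and> S \<subseteq> U \<and> smooth_coeffs S c \<and> expands S e P c"
  shows "P \<in> Avec L"
proof -
  have fib: "P x \<in> ext_algebra (efib L x)" for x
  proof -
    from loc[of x] obtain S U e c where *: "is_frame U e" "x \<in> S" "S \<subseteq> U"
      "expands S e P c" by blast
    have "P x = (\<Sum>I\<in>Pow N. c I x *\<^sub>R wedge_vecs (efib L x) (frame_list e I x))"
    proof
      show "P x \<omega> = (\<Sum>I\<in>Pow N. c I x *\<^sub>R wedge_vecs (efib L x) (frame_list e I x)) \<omega>" for \<omega>
        using *(2,4) out by (cases "\<omega> \<in> Alt x") (simp_all add: sum_fun_apply wedge_vecs_def)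
    qed
    also have "\<dots> \<in> ext_algebra (efib L x)"
      unfolding ext_algebra_def
    proof (intro span_sum span_scale span_base)
      fix I assume "I \<in> Pow N"
      then have "set (frame_list e I x) \<subseteq> efib L x"
        using *(2,3) by (intro frame_list_in[OF *(1)]) auto
      then show "wedge_vecs (efib L x) (frame_list e I x) \<in> {wedge_vecs (efib L x) vs |vs. set vs \<subseteq> efib L x}"
        by blast
    qed
    finally show ?thesis .
  qed
  have co: "\<exists>c. (\<forall>I\<in>Pow N. smooth (UNIV \<inter> U') (c I)) \<and>
      (\<forall>x\<in>UNIV \<inter> U'. P x = (\<Sum>I\<in>Pow N. c I x *\<^sub>R wedge_vecs (efib L x) (frame_list e' I x)))"
    if U': "is_frame U' e'" for U' e'
  proof -
    obtain \<epsilon> where eps: "\<And>x I. x \<in> U' \<Longrightarrow> \<epsilon> x I \<in> Alt x"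
      "\<And>x I J. x \<in> U' \<Longrightarrow> J \<subseteq> N \<Longrightarrow> \<epsilon> x I (frame_list e' J x) = (if I = J then 1 else 0)"
      by (rule dual_frame[OF U']) blast
    define c' where "c' J x = P x (\<epsilon> x J)" for J x
    have "smooth U' (c' J)" for J
    proof (rule M.smooth_fun_on_local[OF B.frame_open[OF U']])
      fix x
      from loc[of x] obtain S U e c where *: "is_frame U e" "open S" "x \<in> S" "S \<subseteq> U" "smooth_coeffs S c" "expands S e P c" by blast
      have o: "open (U' \<inter> S)" using *(2) B.frame_open[OF U'] by auto
      have "smooth (U' \<inter> S) (\<lambda>y. \<epsilon> y J (frame_list e I y))" if I: "I \<subseteq> N" for I
        unfolding frame_list_map
      proof (rule form_eval_smooth_in_frame[OF U' o])
        show "smooth (U' \<inter> S) (\<lambda>x. \<epsilon> x J (frame_list e' I' x))" if "I' \<subseteq> N" for I'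
          by (rule M.smooth_fun_on_cong[OF o _ M.smooth_fun_on_const[OF o, of "if J = I' then 1 else 0"]])
            (use eps(2) that in auto)
        fix s assume "s \<in> set (map e (sorted_list_of_set I))"
        from set_sorted_frame[OF I this] obtain i where "i \<in> N" "s = e i" by (rule bexE)
        moreover have "U' \<inter> S \<subseteq> U" using *(4) by blast
        ultimately show "section_on (U' \<inter> S) s" using frame_section_on[OF *(1), of i "U' \<inter> S"] by simp
      qed (use eps(1) in auto)
      moreover have "smooth (U' \<inter> S) (c I)" if "I \<subseteq> N" for I
        by (rule M.smooth_fun_on_subset[of S]) (use *(5) that in auto)
      ultimately have "smooth (U' \<inter> S) (\<lambda>y. \<Sum>I\<in>Pow N. c I y * \<epsilon> y J (frame_list e I y))"
        by (intro M.smooth_fun_on_sum M.smooth_fun_on_mult o) auto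
      then have "smooth (U' \<inter> S) (c' J)"
        by (rule M.smooth_fun_on_cong[OF o, rotated]) (use *(6) eps(1) in \<open>simp add: c'_def\<close>)
      then show "\<exists>N. open N \<and> x \<in> N \<and> smooth (U' \<inter> N) (c' J)" using *(2,3) by blast
    qed
    moreover have "P x = (\<Sum>J\<in>Pow N. c' J x *\<^sub>R wedge_vecs (efib L x) (frame_list e' J x))" if x: "x \<in> U'" for x
    proof
      fix \<omega>
      show "P x \<omega> = (\<Sum>J\<in>Pow N. c' J x *\<^sub>R wedge_vecs (efib L x) (frame_list e' J x)) \<omega>"
      proof (cases "\<omega> \<in> Alt x")
        case True
        from loc[of x] obtain S U e c where *: "is_frame U e" "x \<in> S" "S \<subseteq> U"
          "expands S e P c" by blast
        have "P x \<omega> = (\<Sum>I\<in>Pow N. c I x * (\<Sum>J\<in>Pow N. \<epsilon> x J (frame_list e I x) * \<omega> (frame_list e' J x)))"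
        proof -
          have "\<omega> (frame_list e I x) = (\<Sum>J\<in>Pow N. \<epsilon> x J (frame_list e I x) * \<omega> (frame_list e' J x))"
            if "I \<in> Pow N" for I
            by (rule form_dual_expand[OF U' x True frame_list_in[OF *(1)] eps[OF x]])
              (use that *(2,3) in auto)
          then show ?thesis using *(2,4) True by simp
        qed
        also have "\<dots> = (\<Sum>J\<in>Pow N. (\<Sum>I\<in>Pow N. c I x * \<epsilon> x J (frame_list e I x)) * \<omega> (frame_list e' J x))"
          unfolding sum_distrib_left sum_distrib_right by (subst sum.swap) (simp add: mult.assoc)
        also have "\<dots> = (\<Sum>J\<in>Pow N. c' J x * \<omega> (frame_list e' J x))"
          using *(2,4) eps(1)[OF x] by (simp add: c'_def)
        finally show ?thesis using True by (simp add: sum_fun_apply wedge_vecs_def)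
      qed (simp add: out sum_fun_apply wedge_vecs_def)
    qed
    ultimately show ?thesis by (intro exI[of _ c']) simp
  qed
  show ?thesis
    unfolding Avec_def smooth_sections_def smooth_section_on_def mem_Collect_eq
    using fib co by (auto simp: ext_bundle_def)
qed

lemma AvecI:
  assumes out: "\<And>x \<omega>. \<omega> \<notin> Alt x \<Longrightarrow> P x \<omega> = 0"
    and co: "\<And>U e. is_frame U e \<Longrightarrow> \<exists>c. smooth_coeffs U c \<and> expands U e P c"
  shows "P \<in> Avec L"
proof (rule AvecI_local[OF out])
  fix x
  obtain U e where U: "is_frame U e" "x \<in> U" by (rule frame_at)
  from co[OF U(1)] U(2) B.frame_open[OF U(1)] U(1)
  show "\<exists>S U e c. is_frame U e \<and> open S \<and> x \<in> S \<and> S \<subseteq> U \<and> smooth_coeffs S c \<and> expands S e P c"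
    by blast
qed

section \<open>Multivector fields as linear functionals on forms\<close>

lemma Avec_linear:
  assumes P: "P \<in> Avec L" and w: "\<omega> \<in> Alt x" "\<theta> \<in> Alt x"
  shows "P x (\<lambda>vs. a * \<omega> vs + b * \<theta> vs) = a * P x \<omega> + b * P x \<theta>"
proof -
  obtain U e where U: "is_frame U e" "x \<in> U" by (rule frame_at)
  obtain c where "expands U e P c"
    using Avec_coeffs[OF P U(1)] by blast
  then show ?thesis
    using U(2) w alt_forms_linear_comb2[OF w, of a b]
    by (simp add: sum_distrib_left sum.distrib[symmetric] algebra_simps)
qed

lemma Avec_zero_form: "P \<in> Avec L \<Longrightarrow> P x (\<lambda>vs. 0) = 0"
  using Avec_linear[of P "\<lambda>vs. 0" x "\<lambda>vs. 0" 0 0] by (simp add: alt_forms_zero)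

lemma Avec_sum_form:
  assumes P: "P \<in> Avec L" and w: "\<And>i. i \<in> I \<Longrightarrow> \<omega> i \<in> Alt x"
  shows "P x (\<lambda>vs. \<Sum>i\<in>I. \<omega> i vs) = (\<Sum>i\<in>I. P x (\<omega> i))"
  using w
proof (induction I rule: infinite_finite_induct)
  case (insert i I)
  have "(\<lambda>vs. \<Sum>i\<in>I. \<omega> i vs) \<in> Alt x"
    using alt_forms_lincomb[of I \<omega> "efib L x" "\<lambda>i. 1"] insert.prems by simp
  then have "P x (\<lambda>vs. 1 * \<omega> i vs + 1 * (\<Sum>i\<in>I. \<omega> i vs)) = 1 * P x (\<omega> i) + 1 * P x (\<lambda>vs. \<Sum>i\<in>I. \<omega> i vs)"
    using insert.prems by (intro Avec_linear[OF P]) auto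
  then show ?case using insert by simp
qed (simp_all add: Avec_zero_form[OF P])

text \<open>Every alternating form at x is the value of a global form. The comparison concerns a
  single point, as gluing requires.\<close>

lemma Avec_eqI_at:
  assumes P: "P \<in> Avec L" "Q \<in> Avec L" and eq: "\<And>\<eta>. \<eta> \<in> Omega L \<Longrightarrow> pairing \<eta> P x = pairing \<eta> Q x"
  shows "P x = Q x"
proof
  fix \<omega>
  show "P x \<omega> = Q x \<omega>"
  proof (cases "\<omega> \<in> Alt x")
    case True
    then obtain \<eta> where "\<eta> \<in> Omega L" "\<eta> x = \<omega>" by (rule form_through)
    then show ?thesis using eq[of \<eta>] by (simp add: pairing_def)
  qed (simp add: Avec_outside P)
qed

lemma Avec_comb:
  assumes P: "P \<in> Avec L" "Q \<in> Avec L" and f: "f \<in> CM" "g \<in> CM"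
  shows "(\<lambda>x. f x *\<^sub>R P x + g x *\<^sub>R Q x) \<in> Avec L"
proof (rule AvecI)
  show "(f x *\<^sub>R P x + g x *\<^sub>R Q x) \<omega> = 0" if "\<omega> \<notin> Alt x" for x \<omega>
    using that by (simp add: Avec_outside P)
  fix U e assume U: "is_frame U e"
  obtain c where c: "smooth_coeffs U c" "expands U e P c"
    using Avec_coeffs[OF P(1) U] by blast
  obtain d where d: "smooth_coeffs U d" "expands U e Q d"
    using Avec_coeffs[OF P(2) U] by blast
  have oU: "open U" by (rule B.frame_open[OF U])
  have "smooth U (\<lambda>x. f x * c I x + g x * d I x)" if "I \<subseteq> N" for I
    using that c(1) d(1) by (intro M.smooth_fun_on_add M.smooth_fun_on_mult M.Cinf_on[OF f(1)] M.Cinf_on[OF f(2)] oU) auto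
  moreover have "(f y *\<^sub>R P y + g y *\<^sub>R Q y) \<omega> = (\<Sum>I\<in>Pow N. (f y * c I y + g y * d I y) * \<omega> (frame_list e I y))"
    if "y \<in> U" "\<omega> \<in> Alt y" for y \<omega>
    using that c(2) d(2) by (simp add: sum_distrib_left sum.distrib[symmetric] algebra_simps)
  ultimately show "\<exists>c. smooth_coeffs U c \<and> (\<forall>x\<in>U. \<forall>\<omega>\<in>Alt x.
      (f x *\<^sub>R P x + g x *\<^sub>R Q x) \<omega> = (\<Sum>I\<in>Pow N. c I x * \<omega> (frame_list e I x)))"
    by (intro exI[of _ "\<lambda>I x. f x * c I x + g x * d I x"]) blast
qed

lemma mvec_of_Avec:
  assumes Vs: "set Vs \<subseteq> Sec L"
  shows "mvec_of L Vs \<in> Avec L"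
proof (rule AvecI)
  show "mvec_of L Vs x \<omega> = 0" if "\<omega> \<notin> Alt x" for x \<omega>
    using that by (simp add: mvec_of_def wedge_vecs_def)
  fix U e assume U: "is_frame U e"
  have "section_on U V" if "V \<in> set Vs" for V using that Vs sec_on by blast
  from section_list_coeffs[OF U B.frame_open[OF U] subset_refl this]
  show "\<exists>c. smooth_coeffs U c \<and> expands U e (mvec_of L Vs) c"
    by (simp add: mvec_of_def wedge_vecs_def)
qed

lemma Avec_0: "(\<lambda>x. 0) \<in> Avec L"
  using Avec_comb[OF mvec_of_Avec[of "[]"] mvec_of_Avec[of "[]"] M.Cinf_const[of 0] M.Cinf_const[of 0]] by simp

lemma Avec_add: "P \<in> Avec L \<Longrightarrow> Q \<in> Avec L \<Longrightarrow> (\<lambda>x. P x + Q x) \<in> Avec L"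
  using Avec_comb[of P Q "\<lambda>x. 1" "\<lambda>x. 1"] by (simp add: M.Cinf_const)

lemma Avec_scale: "P \<in> Avec L \<Longrightarrow> f \<in> CM \<Longrightarrow> (\<lambda>x. f x *\<^sub>R P x) \<in> Avec L"
  using Avec_comb[of P P f "\<lambda>x. 0"] by (simp add: M.Cinf_const)

lemma Avec_sum: "(\<And>i. i \<in> I \<Longrightarrow> P i \<in> Avec L) \<Longrightarrow> (\<lambda>x. \<Sum>i\<in>I. P i x) \<in> Avec L"
  by (induction I rule: infinite_finite_induct) (simp_all add: Avec_0 Avec_add)

lemma pairing_Cinf:
  assumes \<eta>: "\<eta> \<in> Omega L" and P: "P \<in> Avec L"
  shows "pairing \<eta> P \<in> CM"
  unfolding Cinf_def mem_Collect_eq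
proof (rule M.smooth_fun_on_local)
  fix x
  obtain U e where U: "is_frame U e" "x \<in> U" by (rule frame_at)
  obtain c where c: "smooth_coeffs U c" "expands U e P c"
    using Avec_coeffs[OF P(1) U(1)] by blast
  have oU: "open U" by (rule B.frame_open[OF U(1)])
  have "smooth U (\<lambda>x. \<Sum>I\<in>Pow N. c I x * \<eta> x (frame_list e I x))"
    using c(1) by (intro M.smooth_fun_on_sum M.smooth_fun_on_mult oU OmegaD_smooth[OF \<eta> U(1)]) auto
  then have "smooth U (pairing \<eta> P)"
    by (rule M.smooth_fun_on_cong[OF oU, rotated]) (use c(2) OmegaD[OF \<eta>] in \<open>simp add: pairing_def\<close>)
  then show "\<exists>N. open N \<and> x \<in> N \<and> smooth (UNIV \<inter> N) (pairing \<eta> P)" using U oU by auto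
qed simp


subsection \<open>Operations on forms\<close>

text \<open>The interior product puts the reversed list in front. Reversal before and after turns it
  into the right contraction, see \<open>int_prod_contract\<close>, so one contraction rule serves
  both products.\<close>

definition form_rev :: "('m, 'v) form \<Rightarrow> ('m, 'v) form" where
  "form_rev \<eta> = (\<lambda>x vs. \<eta> x (rev vs))"

definition form_part :: "nat \<Rightarrow> ('m, 'v) form \<Rightarrow> ('m, 'v) form" where
  "form_part p \<eta> = (\<lambda>x vs. if length vs = p then \<eta> x vs else 0)"

text \<open>With global sections fixed in the first slots, the remaining form can be paired with Q.
  By \<open>pairing_prefix\<close> this is the value on these sections of the form contracted with
  Q.\<close>

definition form_prefix :: "('m \<Rightarrow> 'v) list \<Rightarrow> ('m, 'v) form \<Rightarrow> ('m, 'v) form" where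
  "form_prefix Vs \<eta> = (\<lambda>x ws. \<eta> x (map (\<lambda>V. V x) Vs @ ws))"

text \<open>The transpose of right multiplication by \<open>Q\<close>, see \<open>pairing_wedge\<close> below.\<close>

definition form_contract :: "('m, 'v) mvec \<Rightarrow> ('m, 'v) form \<Rightarrow> ('m, 'v) form" where
  "form_contract Q \<eta> = (\<lambda>x vs. Q x (\<lambda>ws. \<eta> x (vs @ ws)))"

lemma Omega_rev:
  assumes "\<eta> \<in> Omega L"
  shows "form_rev \<eta> \<in> Omega L"
proof (rule OmegaI)
  show "form_rev \<eta> x \<in> Alt x" for x
    unfolding form_rev_def by (rule alt_forms_rev[OF OmegaD[OF assms]])
  fix U e I assume U: "is_frame U e" and I: "I \<subseteq> N"
  show "smooth U (\<lambda>x. form_rev \<eta> x (frame_list e I x))"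
    unfolding form_rev_def frame_list_map rev_map
  proof (rule Omega_eval_smooth[OF assms B.frame_open[OF U]])
    fix s assume "s \<in> set (map e (rev (sorted_list_of_set I)))"
    then have "s \<in> set (map e (sorted_list_of_set I))" by simp
    from set_sorted_frame[OF I this] obtain i where "i \<in> N" "s = e i" by (rule bexE)
    then show "section_on U s" using frame_section_on[OF U, of i U] by simp
  qed
qed

lemma Omega_part:
  assumes "\<eta> \<in> Omega L"
  shows "form_part p \<eta> \<in> Omega_deg L p"
proof -
  have part: "form_part p \<eta> \<in> Omega L"
  proof (rule OmegaI)
    show "form_part p \<eta> x \<in> Alt x" for x
      unfolding form_part_def by (rule alt_forms_part[OF OmegaD[OF assms]])
    fix U e I assume U: "is_frame U e" and I: "I \<subseteq> N"
    show "smooth U (\<lambda>x. form_part p \<eta> x (frame_list e I x))"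
      using OmegaD_smooth[OF assms U I] M.smooth_fun_on_const[OF B.frame_open[OF U], of 0]
      by (cases "card I = p") (simp_all add: form_part_def frame_list_def)
  qed
  show ?thesis using part OmegaD[OF part] by (simp add: Omega_deg_def alt_forms_deg_def) (simp add: form_part_def)
qed

lemma Omega_deg_Omega: "\<eta> \<in> Omega_deg L p \<Longrightarrow> \<eta> \<in> Omega L"
  by (simp add: Omega_deg_def)

lemma alt_forms_append_any:
  assumes "\<omega> \<in> alt_forms V"
  shows "(\<lambda>vs. \<omega> (us @ vs)) \<in> alt_forms V"
proof (cases "set us \<subseteq> V")
  case False
  then have "\<omega> (us @ vs) = 0" for vs by (intro alt_formsD(1)[OF assms]) auto
  then show ?thesis by (simp add: alt_forms_zero)
qed (rule alt_forms_append_left[OF assms])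

lemma Omega_prefix:
  assumes \<eta>: "\<eta> \<in> Omega L" and Vs: "set Vs \<subseteq> Sec L"
  shows "form_prefix Vs \<eta> \<in> Omega L"
proof (rule OmegaI)
  show "form_prefix Vs \<eta> x \<in> Alt x" for x
    unfolding form_prefix_def by (rule alt_forms_append_any[OF OmegaD[OF \<eta>]])
  fix U e I assume U: "is_frame U e" and I: "I \<subseteq> N"
  show "smooth U (\<lambda>x. form_prefix Vs \<eta> x (frame_list e I x))"
    unfolding form_prefix_def frame_list_map map_append[symmetric]
  proof (rule Omega_eval_smooth[OF \<eta> B.frame_open[OF U]])
    fix s assume "s \<in> set (Vs @ map e (sorted_list_of_set I))"
    then consider "s \<in> Sec L" | "s \<in> set (map e (sorted_list_of_set I))" using Vs by auto
    then show "section_on U s"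
    proof cases
      case 2
      from set_sorted_frame[OF I this] obtain i where "i \<in> N" "s = e i" by (rule bexE)
      then show ?thesis using frame_section_on[OF U, of i U] by simp
    qed (rule sec_on)
  qed
qed

lemma form_contract_coeffs:
  assumes Q: "Q \<in> Avec L" and U: "is_frame U e"
  shows "\<exists>d. smooth_coeffs U d \<and> (\<forall>x\<in>U. \<forall>\<omega>\<in>Alt x.
      (\<lambda>vs. Q x (\<lambda>ws. \<omega> (vs @ ws))) = (\<lambda>vs. \<Sum>J\<in>Pow N. d J x * \<omega> (vs @ frame_list e J x)))"
proof -
  obtain d where d: "smooth_coeffs U d" "expands U e Q d"
    using Avec_coeffs[OF Q U] by blast
  then show ?thesis by (intro exI[of _ d]) (simp add: alt_forms_append_any)
qed

lemma contract_alt_forms: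
  assumes Q: "Q \<in> Avec L" and w: "\<omega> \<in> Alt x"
  shows "(\<lambda>vs. Q x (\<lambda>ws. \<omega> (vs @ ws))) \<in> Alt x"
proof -
  obtain U e where U: "is_frame U e" "x \<in> U" by (rule frame_at)
  obtain d where d: "\<forall>x\<in>U. \<forall>\<omega>\<in>Alt x.
      (\<lambda>vs. Q x (\<lambda>ws. \<omega> (vs @ ws))) = (\<lambda>vs. \<Sum>J\<in>Pow N. d J x * \<omega> (vs @ frame_list e J x))"
    using form_contract_coeffs[OF Q U(1)] by blast
  have "(\<lambda>vs. \<Sum>J\<in>Pow N. d J x * \<omega> (vs @ frame_list e J x)) \<in> Alt x"
    by (intro alt_forms_lincomb alt_forms_append_right w frame_list_in[OF U]) auto
  then show ?thesis using d U(2) w by simp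
qed

lemma frame_lists_section_on:
  assumes "is_frame U e" "I \<subseteq> N" "J \<subseteq> N"
    "s \<in> set (map e (sorted_list_of_set I) @ map e (sorted_list_of_set J))"
  shows "section_on U s"
proof -
  have "\<exists>i\<in>N. s = e i"
    using assms(4) set_sorted_frame[OF assms(2), of s e] set_sorted_frame[OF assms(3), of s e]
    unfolding set_append by blast
  then show ?thesis using frame_section_on[OF assms(1), of _ U] by auto
qed

lemma Omega_contract:
  assumes Q: "Q \<in> Avec L" and \<eta>: "\<eta> \<in> Omega L"
  shows "form_contract Q \<eta> \<in> Omega L"
proof (rule OmegaI)
  show "form_contract Q \<eta> x \<in> Alt x" for x
    unfolding form_contract_def by (rule contract_alt_forms[OF Q OmegaD[OF \<eta>]])
  fix U e I assume U: "is_frame U e" and I: "I \<subseteq> N"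
  have oU: "open U" by (rule B.frame_open[OF U])
  obtain d where d: "smooth_coeffs U d" "\<forall>x\<in>U. \<forall>\<omega>\<in>Alt x.
      (\<lambda>vs. Q x (\<lambda>ws. \<omega> (vs @ ws))) = (\<lambda>vs. \<Sum>J\<in>Pow N. d J x * \<omega> (vs @ frame_list e J x))"
    using form_contract_coeffs[OF Q U] by blast
  have "smooth U (\<lambda>x. \<eta> x (frame_list e I x @ frame_list e J x))" if "J \<subseteq> N" for J
    using Omega_eval_smooth[where ss = "map e (sorted_list_of_set I) @ map e (sorted_list_of_set J)",
        OF \<eta> oU frame_lists_section_on[OF U I that]]
    by (simp add: frame_list_def comp_def)
  then have "smooth U (\<lambda>x. \<Sum>J\<in>Pow N. d J x * \<eta> x (frame_list e I x @ frame_list e J x))"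
    using d(1) by (intro M.smooth_fun_on_sum M.smooth_fun_on_mult oU) auto
  then show "smooth U (\<lambda>x. form_contract Q \<eta> x (frame_list e I x))"
  proof (rule M.smooth_fun_on_cong[OF oU, rotated])
    fix x assume "x \<in> U"
    with d(2) OmegaD[OF \<eta>] have
      "(\<lambda>vs. Q x (\<lambda>ws. \<eta> x (vs @ ws))) = (\<lambda>vs. \<Sum>J\<in>Pow N. d J x * \<eta> x (vs @ frame_list e J x))" by blast
    from fun_cong[OF this, of "frame_list e I x"]
    show "(\<Sum>J\<in>Pow N. d J x * \<eta> x (frame_list e I x @ frame_list e J x)) = form_contract Q \<eta> x (frame_list e I x)"
      by (simp add: form_contract_def)
  qed
qed

lemma Omega_comb:
  assumes "\<eta> \<in> Omega L" "\<theta> \<in> Omega L" "f \<in> CM" "g \<in> CM"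
  shows "(\<lambda>x vs. f x * \<eta> x vs + g x * \<theta> x vs) \<in> Omega L"
proof (rule OmegaI)
  show "(\<lambda>vs. f x * \<eta> x vs + g x * \<theta> x vs) \<in> Alt x" for x
    by (rule alt_forms_linear_comb2[OF OmegaD[OF assms(1)] OmegaD[OF assms(2)]])
  show "smooth U (\<lambda>x. f x * \<eta> x (frame_list e I x) + g x * \<theta> x (frame_list e I x))"
    if "is_frame U e" "I \<subseteq> N" for U e I
    by (intro M.smooth_fun_on_add M.smooth_fun_on_mult B.frame_open[OF that(1)] M.Cinf_on[OF assms(3)]
      M.Cinf_on[OF assms(4)] OmegaD_smooth[OF assms(1) that] OmegaD_smooth[OF assms(2) that])
qed

lemma Omega_sum:
  assumes "\<And>i. i \<in> I \<Longrightarrow> \<eta> i \<in> Omega L"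
  shows "(\<lambda>x vs. \<Sum>i\<in>I. \<eta> i x vs) \<in> Omega L"
proof (rule OmegaI)
  show "(\<lambda>vs. \<Sum>i\<in>I. \<eta> i x vs) \<in> Alt x" for x
    using alt_forms_lincomb[of I "\<lambda>i. \<eta> i x" "efib L x" "\<lambda>i. 1"] assms by (simp add: OmegaD)
  show "smooth U (\<lambda>x. \<Sum>i\<in>I. \<eta> i x (frame_list e J x))" if "is_frame U e" "J \<subseteq> N" for U e J
    by (rule M.smooth_fun_on_sum[OF B.frame_open[OF that(1)]]) (rule OmegaD_smooth[OF assms that])
qed

lemma pairing_comb:
  assumes "P \<in> Avec L" "\<eta> \<in> Omega L" "\<theta> \<in> Omega L"
  shows "pairing (\<lambda>x vs. f x * \<eta> x vs + g x * \<theta> x vs) P x = f x * pairing \<eta> P x + g x * pairing \<theta> P x"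
  unfolding pairing_def by (rule Avec_linear[OF assms(1) OmegaD[OF assms(2)] OmegaD[OF assms(3)]])

lemma pairing_wedge:
  assumes "\<eta> \<in> Omega L"
  shows "pairing \<eta> (mvec_wedge L P Q) = pairing (form_contract Q \<eta>) P"
  by (simp add: pairing_def mvec_wedge_def ext_wedge_def OmegaD[OF assms] form_contract_def)

lemma pairing_prefix: "pairing (form_prefix Vs \<eta>) Q = form_eval (form_contract Q \<eta>) Vs"
  by (simp add: pairing_def form_prefix_def form_eval_def form_contract_def)

lemma mvec_wedge_Avec:
  assumes P: "P \<in> Avec L" and Q: "Q \<in> Avec L"
  shows "mvec_wedge L P Q \<in> Avec L"
proof (rule AvecI)
  show "mvec_wedge L P Q x \<omega> = 0" if "\<omega> \<notin> Alt x" for x \<omega>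
    using that by (simp add: mvec_wedge_def ext_wedge_def)
  fix U e assume U: "is_frame U e"
  have oU: "open U" by (rule B.frame_open[OF U])
  obtain c where c: "smooth_coeffs U c" "expands U e P c"
    using Avec_coeffs[OF P(1) U] by blast
  obtain d where d: "smooth_coeffs U d" "\<forall>x\<in>U. \<forall>\<omega>\<in>Alt x.
      (\<lambda>vs. Q x (\<lambda>ws. \<omega> (vs @ ws))) = (\<lambda>vs. \<Sum>J\<in>Pow N. d J x * \<omega> (vs @ frame_list e J x))"
    using form_contract_coeffs[OF Q U] by blast
  \<comment> \<open>The m K are components of the product of the basis elements for I and J, taken
    from the expansion of the concatenated list. They absorb repeated indices and the sign of the
    sorting permutation.\<close>
  define R where "R I J m \<longleftrightarrow> (\<forall>K\<subseteq>N. smooth U (m K)) \<and> (\<forall>x\<in>U. \<forall>\<omega>\<in>Alt x.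
      \<omega> (frame_list e I x @ frame_list e J x) = (\<Sum>K\<in>Pow N. m K x * \<omega> (frame_list e K x)))" for I J m
  have ex: "\<exists>m. R I J m" if "I \<subseteq> N" "J \<subseteq> N" for I J
    using section_list_coeffs[where ss = "map e (sorted_list_of_set I) @ map e (sorted_list_of_set J)",
        OF U oU subset_refl frame_lists_section_on[OF U that]]
    by (simp add: R_def frame_list_def comp_def)
  define m where "m I J = (SOME m. R I J m)" for I J
  have m: "R I J (m I J)" if "I \<subseteq> N" "J \<subseteq> N" for I J
    unfolding m_def by (rule someI_ex[OF ex[OF that]])
  let ?k = "\<lambda>K x. \<Sum>I\<in>Pow N. \<Sum>J\<in>Pow N. c I x * d J x * m I J K x"
  have "smooth U (?k K)" if "K \<subseteq> N" for K
    using c(1) d(1) m that by (intro M.smooth_fun_on_sum M.smooth_fun_on_mult oU) (auto simp: R_def)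
  moreover have "mvec_wedge L P Q y \<omega> = (\<Sum>K\<in>Pow N. ?k K y * \<omega> (frame_list e K y))"
    if y: "y \<in> U" and w: "\<omega> \<in> Alt y" for y \<omega>
  proof -
    have con: "(\<lambda>vs. Q y (\<lambda>ws. \<omega> (vs @ ws))) = (\<lambda>vs. \<Sum>J\<in>Pow N. d J y * \<omega> (vs @ frame_list e J y))"
      using d(2) y w by blast
    have "mvec_wedge L P Q y \<omega> = P y (\<lambda>vs. Q y (\<lambda>ws. \<omega> (vs @ ws)))"
      using w by (simp add: mvec_wedge_def ext_wedge_def)
    also have "\<dots> = (\<Sum>I\<in>Pow N. c I y * Q y (\<lambda>ws. \<omega> (frame_list e I y @ ws)))"
      using c(2) y contract_alt_forms[OF Q w] by simp
    also have "\<dots> = (\<Sum>I\<in>Pow N. c I y * (\<Sum>J\<in>Pow N. d J y * \<omega> (frame_list e I y @ frame_list e J y)))"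
      using fun_cong[OF con] by simp
    also have "\<dots> = (\<Sum>I\<in>Pow N. \<Sum>J\<in>Pow N. \<Sum>K\<in>Pow N. c I y * d J y * m I J K y * \<omega> (frame_list e K y))"
      unfolding sum_distrib_left
    proof (intro sum.cong refl)
      fix I J assume "I \<in> Pow N" "J \<in> Pow N"
      then have "\<omega> (frame_list e I y @ frame_list e J y) = (\<Sum>K\<in>Pow N. m I J K y * \<omega> (frame_list e K y))"
        using m[of I J] y w unfolding R_def by blast
      then show "c I y * (d J y * \<omega> (frame_list e I y @ frame_list e J y)) =
          (\<Sum>K\<in>Pow N. c I y * d J y * m I J K y * \<omega> (frame_list e K y))"
        by (simp add: sum_distrib_left mult.assoc)
    qed
    also have "\<dots> = (\<Sum>I\<in>Pow N. \<Sum>K\<in>Pow N. \<Sum>J\<in>Pow N. c I y * d J y * m I J K y * \<omega> (frame_list e K y))"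
      by (intro sum.cong refl sum.swap)
    also have "\<dots> = (\<Sum>K\<in>Pow N. \<Sum>I\<in>Pow N. \<Sum>J\<in>Pow N. c I y * d J y * m I J K y * \<omega> (frame_list e K y))"
      by (rule sum.swap)
    also have "\<dots> = (\<Sum>K\<in>Pow N. ?k K y * \<omega> (frame_list e K y))"
      by (simp only: sum_distrib_right)
    finally show ?thesis .
  qed
  ultimately show "\<exists>c. smooth_coeffs U c \<and> expands U e (mvec_wedge L P Q) c"
    by (intro exI[of _ ?k]) blast
qed

section \<open>Homogeneous components\<close>

lemma pairing_mvec_part:
  "\<eta> \<in> Omega L \<Longrightarrow> pairing \<eta> (mvec_part L p P) = pairing (form_part p \<eta>) P"
  by (simp add: pairing_def mvec_part_def ext_part_def form_part_def OmegaD)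

lemma mvec_part_Avec:
  assumes P: "P \<in> Avec L"
  shows "mvec_part L p P \<in> Avec_deg L p"
proof -
  have co: "\<exists>c. smooth_coeffs U c \<and> (\<forall>I. card I \<noteq> p \<longrightarrow> c I = (\<lambda>x. 0)) \<and> expands U e (mvec_part L p P) c" if U: "is_frame U e" for U e
  proof -
    obtain c where c: "smooth_coeffs U c" "expands U e P c"
      using Avec_coeffs[OF P(1) U(1)] by blast
    let ?c = "\<lambda>I. if card I = p then c I else (\<lambda>x. 0)"
    have "\<forall>I\<subseteq>N. smooth U (?c I)" using c(1) M.smooth_fun_on_const[OF B.frame_open[OF U]] by simp
    moreover have "mvec_part L p P x \<omega> = (\<Sum>I\<in>Pow N. ?c I x * \<omega> (frame_list e I x))"
      if x: "x \<in> U" and w: "\<omega> \<in> Alt x" for x \<omega>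
    proof -
      have "mvec_part L p P x \<omega> = P x (\<lambda>vs. if length vs = p then \<omega> vs else 0)"
        using w by (simp add: mvec_part_def ext_part_def)
      also have "\<dots> = (\<Sum>I\<in>Pow N. c I x * (if length (frame_list e I x) = p then \<omega> (frame_list e I x) else 0))"
        using c(2) x alt_forms_part[OF w] by simp
      also have "\<dots> = (\<Sum>I\<in>Pow N. ?c I x * \<omega> (frame_list e I x))"
        by (intro sum.cong) (auto simp: frame_list_def)
      finally show ?thesis .
    qed
    ultimately show ?thesis by (intro exI[of _ ?c]) simp
  qed
  have out: "mvec_part L p P x \<omega> = 0" if "\<omega> \<notin> Alt x" for x \<omega>
    using that by (simp add: mvec_part_def ext_part_def)
  have "mvec_part L p P \<in> Avec L"
  proof (rule AvecI[OF out])
    fix U e assume "is_frame U e"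
    from co[OF this] show "\<exists>c. smooth_coeffs U c \<and> expands U e (mvec_part L p P) c"
      by (elim exE conjE) (intro exI conjI)
  qed
  moreover have "mvec_part L p P x \<in> ext_power p (efib L x)" for x
  proof -
    obtain U e where U: "is_frame U e" "x \<in> U" by (rule frame_at)
    obtain c where c: "\<forall>I. card I \<noteq> p \<longrightarrow> c I = (\<lambda>x. 0)" "expands U e (mvec_part L p P) c" using co[OF U(1)] by blast
    have "mvec_part L p P x = (\<Sum>I\<in>Pow N. c I x *\<^sub>R wedge_vecs (efib L x) (frame_list e I x))"
    proof
      show "mvec_part L p P x \<omega> = (\<Sum>I\<in>Pow N. c I x *\<^sub>R wedge_vecs (efib L x) (frame_list e I x)) \<omega>" for \<omega>
        using c(2) U(2) out by (cases "\<omega> \<in> Alt x") (simp_all add: sum_fun_apply wedge_vecs_def)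
    qed
    also have "\<dots> \<in> ext_power p (efib L x)"
      unfolding ext_power_def
    proof (intro span_sum)
      fix I assume I: "I \<in> Pow N"
      show "c I x *\<^sub>R wedge_vecs (efib L x) (frame_list e I x) \<in>
          span {wedge_vecs (efib L x) vs |vs. set vs \<subseteq> efib L x \<and> length vs = p}"
      proof (cases "card I = p")
        case True
        have "set (frame_list e I x) \<subseteq> efib L x" using I by (intro frame_list_in[OF U]) auto
        moreover have "length (frame_list e I x) = p" using True by (simp add: frame_list_def)
        ultimately show ?thesis by (intro span_scale span_base) blast
      next
        case False
        then have "c I x = 0" using c(1) by simp
        then show ?thesis by (simp add: span_zero)
      qed
    qed
    finally show ?thesis .
  qed
  ultimately show ?thesis by (simp add: Avec_deg_def)
qed

lemma Avec_deg_Avec: "P \<in> Avec_deg L p \<Longrightarrow> P \<in> Avec L"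
  by (simp add: Avec_deg_def)

lemma Avec_deg_part:
  assumes P: "P \<in> Avec_deg L p"
  shows "mvec_part L p P = P"
proof
  fix x
  have "P x \<in> span {wedge_vecs (efib L x) vs |vs. set vs \<subseteq> efib L x \<and> length vs = p}"
    using P by (simp add: Avec_deg_def ext_power_def)
  then have "ext_part (efib L x) p (P x) = P x"
  proof (induction rule: span_induct_alt)
    case base
    show ?case by (simp add: ext_part_def fun_eq_iff)
  next
    case (step c y z)
    then obtain vs where vs: "y = wedge_vecs (efib L x) vs" "length vs = p" by auto
    have y: "ext_part (efib L x) p y \<omega> = y \<omega>" for \<omega>
      using alt_forms_part[of \<omega> "efib L x" p] vs by (simp add: ext_part_def wedge_vecs_def)
    have z: "ext_part (efib L x) p z \<omega> = z \<omega>" for \<omega> by (simp add: step.IH)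
    show ?case
    proof
      fix \<omega>
      have "ext_part (efib L x) p (c *\<^sub>R y + z) \<omega> = c * ext_part (efib L x) p y \<omega> + ext_part (efib L x) p z \<omega>"
        by (simp add: ext_part_def)
      then show "ext_part (efib L x) p (c *\<^sub>R y + z) \<omega> = (c *\<^sub>R y + z) \<omega>" by (simp add: y z)
    qed
  qed
  then show "mvec_part L p P x = P x" by (simp add: mvec_part_def)
qed

text \<open>A frame index set is a subset of N, so its degree is at most the rank. This justifies
  the range of degrees in \<open>Lie_mvec\<close>.\<close>

lemma pairing_sum_parts:
  assumes P: "P \<in> Avec L" and \<eta>: "\<eta> \<in> Omega L"
  shows "(\<Sum>p\<le>card N. pairing \<eta> (mvec_part L p P) x) = pairing \<eta> P x"
proof -
  obtain U e where U: "is_frame U e" "x \<in> U" by (rule frame_at)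
  obtain c where c: "expands U e P c"
    using Avec_coeffs[OF P(1) U(1)] by blast
  have part: "form_part p \<eta> x \<in> Alt x" for p
    by (rule OmegaD[OF Omega_deg_Omega[OF Omega_part[OF \<eta>]]])
  have "(\<Sum>p\<le>card N. pairing \<eta> (mvec_part L p P) x) =
      (\<Sum>p\<le>card N. \<Sum>I\<in>Pow N. if p = card I then c I x * \<eta> x (frame_list e I x) else 0)"
  proof (rule sum.cong[OF refl])
    fix p
    have "pairing \<eta> (mvec_part L p P) x = (\<Sum>I\<in>Pow N. c I x * form_part p \<eta> x (frame_list e I x))"
      unfolding pairing_mvec_part[OF \<eta>] using c U(2) part by (simp add: pairing_def)
    also have "\<dots> = (\<Sum>I\<in>Pow N. if p = card I then c I x * \<eta> x (frame_list e I x) else 0)"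
      by (intro sum.cong) (auto simp: form_part_def frame_list_def)
    finally show "pairing \<eta> (mvec_part L p P) x = (\<Sum>I\<in>Pow N. if p = card I then c I x * \<eta> x (frame_list e I x) else 0)" .
  qed
  also have "\<dots> = (\<Sum>I\<in>Pow N. \<Sum>p\<le>card N. if p = card I then c I x * \<eta> x (frame_list e I x) else 0)"
    by (rule sum.swap)
  also have "\<dots> = (\<Sum>I\<in>Pow N. c I x * \<eta> x (frame_list e I x))"
    by (intro sum.cong) (auto simp: card_mono[OF B.finite_idx])
  also have "\<dots> = pairing \<eta> P x" using c U(2) OmegaD[OF \<eta>] by (simp add: pairing_def)
  finally show ?thesis .
qed


subsection \<open>Lie derivatives of derived forms\<close>

lemma form_eval_rev: "form_eval (form_rev \<eta>) Vs = form_eval \<eta> (rev Vs)"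
  by (simp add: form_eval_def form_rev_def rev_map)

lemma form_eval_part: "form_eval (form_part p \<eta>) Vs = (if length Vs = p then form_eval \<eta> Vs else (\<lambda>x. 0))"
  by (simp add: form_eval_def form_part_def)

lemma form_eval_prefix: "form_eval (form_prefix Us \<eta>) Vs = form_eval \<eta> (Us @ Vs)"
  by (simp add: form_eval_def form_prefix_def)

lemma Omega_part_in: "\<eta> \<in> Omega L \<Longrightarrow> form_part p \<eta> \<in> Omega L"
  by (rule Omega_deg_Omega[OF Omega_part])

lemma Lie_form_rev:
  assumes V: "V \<in> Sec L" and \<eta>: "\<eta> \<in> Omega L"
  shows "Lie_form L V (form_rev \<eta>) = form_rev (Lie_form L V \<eta>)"
proof (rule Lie_form_eqI[OF V Omega_rev[OF \<eta>]])
  show "form_rev (Lie_form L V \<eta>) \<in> Omega L"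
    by (rule Omega_rev[OF Lie_form_Omega[OF V \<eta>]])
  fix Vs assume "set Vs \<subseteq> Sec L"
  then have "form_eval (form_rev (Lie_form L V \<eta>)) Vs = lie_eval V \<eta> (rev Vs)"
    unfolding form_eval_rev by (intro form_eval_Lie_form V \<eta>) simp
  also have "\<dots> = lie_eval V (form_rev \<eta>) Vs"
    by (simp add: fun_eq_iff lie_eval_def slot_sum_rev form_eval_rev)
  finally show "form_eval (form_rev (Lie_form L V \<eta>)) Vs = lie_eval V (form_rev \<eta>) Vs" .
qed

lemma Lie_form_part:
  assumes V: "V \<in> Sec L" and \<eta>: "\<eta> \<in> Omega L"
  shows "Lie_form L V (form_part p \<eta>) = form_part p (Lie_form L V \<eta>)"
proof (rule Lie_form_eqI[OF V Omega_part_in[OF \<eta>]])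
  show "form_part p (Lie_form L V \<eta>) \<in> Omega L"
    by (rule Omega_part_in[OF Lie_form_Omega[OF V \<eta>]])
  show "form_eval (form_part p (Lie_form L V \<eta>)) Vs = lie_eval V (form_part p \<eta>) Vs" if "set Vs \<subseteq> Sec L" for Vs
    using form_eval_Lie_form[OF V \<eta> that]
    by (simp add: fun_eq_iff form_eval_part lie_eval_def slot_sum_def Lie_fun_const V)
qed

text \<open>The Lie derivative of the prefixed form brackets only the free slots. Compared with
  prefixing the Lie derivative of \<eta>, the bracket terms in the slots of \<open>Us\<close> must
  be added back.\<close>

lemma pairing_Lie_form_prefix:
  assumes V: "V \<in> Sec L" and \<eta>: "\<eta> \<in> Omega L" and Us: "set Us \<subseteq> Sec L" and Q: "Q \<in> Avec L"
  shows "pairing (Lie_form L V (form_prefix Us \<eta>)) Q x =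
    form_eval (form_contract Q (Lie_form L V \<eta>)) Us x +
    slot_sum (bracket L V) (\<lambda>Ws. form_eval (form_contract Q \<eta>) Ws x) Us"
proof -
  let ?U = "\<lambda>i. Us[i := bracket L V (Us ! i)]"
  define \<sigma> where "\<sigma> = (\<lambda>x ws. \<Sum>i<length Us. form_prefix (?U i) \<eta> x ws)"
  have L: "Lie_form L V \<eta> \<in> Omega L" by (rule Lie_form_Omega[OF V \<eta>])
  have U: "form_prefix (?U i) \<eta> \<in> Omega L" if "i < length Us" for i
    by (rule Omega_prefix[OF \<eta> slot_list_in[OF V Us that]])
  then have \<sigma>: "\<sigma> \<in> Omega L" unfolding \<sigma>_def by (intro Omega_sum) simp
  let ?\<theta> = "\<lambda>x ws. 1 * form_prefix Us (Lie_form L V \<eta>) x ws + 1 * \<sigma> x ws"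
  have "Lie_form L V (form_prefix Us \<eta>) = ?\<theta>"
  proof (rule Lie_form_eqI[OF V Omega_prefix[OF \<eta> Us]])
    show "?\<theta> \<in> Omega L"
      by (intro Omega_comb Omega_prefix L Us \<sigma> M.Cinf_const)
    fix Ws assume Ws: "set Ws \<subseteq> Sec L"
    show "form_eval ?\<theta> Ws = lie_eval V (form_prefix Us \<eta>) Ws"
    proof
      fix x
      have "form_eval ?\<theta> Ws x = form_eval (Lie_form L V \<eta>) (Us @ Ws) x + (\<Sum>i<length Us. form_eval \<eta> (?U i @ Ws) x)"
        by (simp add: form_eval_def form_prefix_def \<sigma>_def)
      also have "form_eval (Lie_form L V \<eta>) (Us @ Ws) x = lie_eval V \<eta> (Us @ Ws) x"
        using Us Ws by (simp add: form_eval_Lie_form[OF V \<eta>])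
      also have "\<dots> + (\<Sum>i<length Us. form_eval \<eta> (?U i @ Ws) x) = lie_eval V (form_prefix Us \<eta>) Ws x"
        unfolding lie_eval_def slot_sum_append form_eval_prefix
        by (simp add: slot_sum_def[of _ "\<lambda>us. form_eval \<eta> (us @ Ws) x"])
      finally show "form_eval ?\<theta> Ws x = lie_eval V (form_prefix Us \<eta>) Ws x" .
    qed
  qed
  then have "pairing (Lie_form L V (form_prefix Us \<eta>)) Q x =
      1 * pairing (form_prefix Us (Lie_form L V \<eta>)) Q x + 1 * pairing \<sigma> Q x"
    by (simp only: pairing_comb[OF Q Omega_prefix[OF L Us] \<sigma>])
  moreover have "pairing \<sigma> Q x = (\<Sum>i<length Us. pairing (form_prefix (?U i) \<eta>) Q x)"
    unfolding pairing_def \<sigma>_def by (rule Avec_sum_form[OF Q]) (simp add: OmegaD[OF U])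
  ultimately show ?thesis by (simp add: pairing_prefix slot_sum_def)
qed


subsection \<open>The Lie derivative of a multivector field\<close>

text \<open>A relation tested against forms of all degrees together. It keeps existence, uniqueness
  and the algebraic rules free of definite descriptions and of the special case of degree 0.\<close>

definition is_Lie_mvec :: "('m \<Rightarrow> 'v) \<Rightarrow> ('m, 'v) mvec \<Rightarrow> ('m, 'v) mvec \<Rightarrow> bool" where
  "is_Lie_mvec V P Q \<longleftrightarrow> Q \<in> Avec L \<and>
    (\<forall>\<eta>\<in>Omega L. \<forall>x. pairing \<eta> Q x = Lie_fun L V (pairing \<eta> P) x - pairing (Lie_form L V \<eta>) P x)"

lemma is_Lie_mvecD:
  assumes "is_Lie_mvec V P Q"
  shows "Q \<in> Avec L"
    and "\<eta> \<in> Omega L \<Longrightarrow> pairing \<eta> Q x = Lie_fun L V (pairing \<eta> P) x - pairing (Lie_form L V \<eta>) P x"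
  using assms by (simp_all add: is_Lie_mvec_def)

lemma is_Lie_mvec_unique:
  assumes "is_Lie_mvec V P Q" "is_Lie_mvec V P Q'"
  shows "Q = Q'"
  using Avec_eqI_at[OF is_Lie_mvecD(1)[OF assms(1)] is_Lie_mvecD(1)[OF assms(2)]]
  by (auto simp: is_Lie_mvecD(2)[OF assms(1)] is_Lie_mvecD(2)[OF assms(2)])

lemma Lie_mvec_exists_local:
  assumes V: "V \<in> Sec L" and P: "P \<in> Avec L"
  shows "\<exists>S Q. open S \<and> x0 \<in> S \<and> Q \<in> Avec L \<and> (\<forall>x\<in>S. \<forall>\<eta>\<in>Omega L.
    pairing \<eta> Q x = Lie_fun L V (pairing \<eta> P) x - pairing (Lie_form L V \<eta>) P x)"
proof -
  obtain U e \<beta> K S where "bumped_frame x0 U e \<beta> K S" by (rule bumped_frame_exists)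
  note f = bumped_frameD[OF this]
  obtain c where c: "smooth_coeffs U c" "expands U e P c"
    using Avec_coeffs[OF P f(1)] by blast
  define g where "g I x = \<beta> x * c I x" for I x
  define E where "E I = map (\<lambda>i. sec_scale \<beta> (e i)) (sorted_list_of_set I)" for I
  have g: "g I \<in> CM" if "I \<in> Pow N" for I
  proof -
    have "smooth (UNIV \<inter> U) (c I)" using c(1) that by simp
    from M.bump_mult_smooth[OF f(3-6) B.frame_open[OF f(1)] open_UNIV this]
    show ?thesis by (simp add: Cinf_def g_def[abs_def])
  qed
  have E: "set (E I) \<subseteq> Sec L" if "I \<in> Pow N" for I
    using that f(11) finite_subset[OF _ B.finite_idx, of I] by (auto simp: E_def)
  have Ex: "map (\<lambda>V. V x) (E I) = frame_list e I x" if "x \<in> S" for x I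
    using f(9)[OF that] by (simp add: E_def frame_list_def sec_scale_def)
  \<comment> \<open>On S the field P is the sum of the products of g I with the exterior product of
    E I; Q is its Leibniz derivative. All ingredients are global, so Q is a global field that has
    the required pairings on S.\<close>
  define Q where "Q = (\<lambda>x. \<Sum>I\<in>Pow N. Lie_fun L V (g I) x *\<^sub>R mvec_of L (E I) x +
    g I x *\<^sub>R (\<Sum>i<length (E I). mvec_of L ((E I)[i := bracket L V (E I ! i)]) x))"
  have "Q \<in> Avec L"
    unfolding Q_def
  proof (rule Avec_sum)
    fix I assume I: "I \<in> Pow N"
    show "(\<lambda>x. Lie_fun L V (g I) x *\<^sub>R mvec_of L (E I) x +
        g I x *\<^sub>R (\<Sum>i<length (E I). mvec_of L ((E I)[i := bracket L V (E I ! i)]) x)) \<in> Avec L"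
      by (intro Avec_comb mvec_of_Avec Avec_sum Lie_fun_Cinf g I V E slot_list_in) simp
  qed
  moreover have "pairing \<eta> Q x = Lie_fun L V (pairing \<eta> P) x - pairing (Lie_form L V \<eta>) P x"
    if x: "x \<in> S" and \<eta>: "\<eta> \<in> Omega L" for x \<eta>
  proof -
    have pP: "pairing \<theta> P y = (\<Sum>I\<in>Pow N. g I y * form_eval \<theta> (E I) y)" if "y \<in> S" "\<theta> \<in> Omega L" for \<theta> y
    proof -
      have "y \<in> U" using that f(10) by blast
      then have "pairing \<theta> P y = (\<Sum>I\<in>Pow N. c I y * \<theta> y (frame_list e I y))"
        using c(2) OmegaD[OF that(2)] by (simp add: pairing_def)
      then show ?thesis using f(9)[OF that(1)] by (simp add: g_def form_eval_def Ex[OF that(1)])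
    qed
    \<comment> \<open>The two functions agree only on S, so their derivatives at x are compared by
      locality.\<close>
    have "Lie_fun L V (pairing \<eta> P) x = Lie_fun L V (\<lambda>y. \<Sum>I\<in>Pow N. g I y * form_eval \<eta> (E I) y) x"
    proof (rule Lie_fun_local[OF V pairing_Cinf[OF \<eta> P] _ f(7) x])
      show "(\<lambda>y. \<Sum>I\<in>Pow N. g I y * form_eval \<eta> (E I) y) \<in> CM"
        by (intro M.Cinf_sum M.Cinf_mult g form_eval_Cinf E \<eta>)
    qed (rule pP[OF _ \<eta>])
    also have "\<dots> = (\<Sum>I\<in>Pow N. Lie_fun L V (\<lambda>y. g I y * form_eval \<eta> (E I) y) x)"
      by (rule Lie_fun_sum[OF V]) (intro M.Cinf_mult g form_eval_Cinf E \<eta>)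
    also have "\<dots> = (\<Sum>I\<in>Pow N. g I x * Lie_fun L V (form_eval \<eta> (E I)) x + form_eval \<eta> (E I) x * Lie_fun L V (g I) x)"
      by (intro sum.cong refl Lie_fun_mult V g form_eval_Cinf E \<eta>)
    finally have 1: "Lie_fun L V (pairing \<eta> P) x =
      (\<Sum>I\<in>Pow N. g I x * Lie_fun L V (form_eval \<eta> (E I)) x + form_eval \<eta> (E I) x * Lie_fun L V (g I) x)" .
    have "pairing (Lie_form L V \<eta>) P x = (\<Sum>I\<in>Pow N. g I x * lie_eval V \<eta> (E I) x)"
      using pP[OF x Lie_form_Omega[OF V \<eta>]] E
      by (simp add: form_eval_Lie_form[OF V \<eta>])
    moreover have "pairing \<eta> Q x = (\<Sum>I\<in>Pow N. Lie_fun L V (g I) x * pairing \<eta> (mvec_of L (E I)) x +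
        g I x * (\<Sum>i<length (E I). pairing \<eta> (mvec_of L ((E I)[i := bracket L V (E I ! i)])) x))"
      by (simp add: pairing_def Q_def sum_fun_apply)
    ultimately show ?thesis
      unfolding 1 by (simp add: pairing_mvec_of[OF \<eta>] lie_eval_def slot_sum_def
        sum_subtractf[symmetric] algebra_simps)
  qed
  ultimately show ?thesis using f(7,8) by blast
qed

lemma Lie_mvec_exists:
  assumes V: "V \<in> Sec L" and P: "P \<in> Avec L"
  obtains Q where "is_Lie_mvec V P Q"
proof -
  let ?R = "\<lambda>x0 S Q. open S \<and> x0 \<in> S \<and> Q \<in> Avec L \<and> (\<forall>x\<in>S. \<forall>\<eta>\<in>Omega L.
    pairing \<eta> Q x = Lie_fun L V (pairing \<eta> P) x - pairing (Lie_form L V \<eta>) P x)"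
  have "\<forall>x0. \<exists>p. ?R x0 (fst p) (snd p)" using Lie_mvec_exists_local[OF V P] by simp
  then obtain p where p: "\<forall>x0. ?R x0 (fst (p x0)) (snd (p x0))" using choice[of "\<lambda>x0 p. ?R x0 (fst p) (snd p)"] by blast
  define S where "S x = fst (p x)" for x
  define Q where "Q x = snd (p x)" for x
  have S: "open (S x)" "x \<in> S x" and Q: "Q x \<in> Avec L" for x using p by (auto simp: S_def Q_def)
  have pQ: "pairing \<eta> (Q x0) x = Lie_fun L V (pairing \<eta> P) x - pairing (Lie_form L V \<eta>) P x"
    if "x \<in> S x0" "\<eta> \<in> Omega L" for x0 x \<eta>
    using p that unfolding S_def Q_def by blast
  \<comment> \<open>The pairings prescribed at x do not mention x0, and pairings at a point
    determine the field there.\<close>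
  have glue: "Q x x = Q x0 x" if "x \<in> S x0" for x x0
    by (rule Avec_eqI_at[OF Q Q]) (simp add: pQ S that)
  have "(\<lambda>x. Q x x) \<in> Avec L"
  proof (rule AvecI_local)
    show "Q x x \<omega> = 0" if "\<omega> \<notin> Alt x" for x \<omega> by (rule Avec_outside[OF Q that])
    fix x0
    obtain U e where U: "is_frame U e" "x0 \<in> U" by (rule frame_at)
    obtain c where c: "smooth_coeffs U c" "expands U e (Q x0) c"
      using Avec_coeffs[OF Q U(1)] by blast
    have "open (S x0 \<inter> U)" by (intro open_Int S B.frame_open[OF U(1)])
    moreover have "\<forall>I\<subseteq>N. smooth (S x0 \<inter> U) (c I)"
      using c(1) M.smooth_fun_on_subset[of U _ "S x0 \<inter> U"] by simp
    moreover have "\<forall>y\<in>S x0 \<inter> U. \<forall>\<omega>\<in>Alt y. Q y y \<omega> = (\<Sum>I\<in>Pow N. c I y * \<omega> (frame_list e I y))"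
      using c(2) by (simp add: glue[of _ x0])
    ultimately show "\<exists>S U e c. is_frame U e \<and> open S \<and> x0 \<in> S \<and> S \<subseteq> U \<and> smooth_coeffs S c \<and>
      (\<forall>y\<in>S. \<forall>\<omega>\<in>Alt y. Q y y \<omega> = (\<Sum>I\<in>Pow N. c I y * \<omega> (frame_list e I y)))"
      using U S(2)[of x0] by (intro exI[of _ "S x0 \<inter> U"] exI[of _ U] exI[of _ e] exI[of _ c]) simp
  qed
  moreover have "pairing \<eta> (\<lambda>x. Q x x) x = Lie_fun L V (pairing \<eta> P) x - pairing (Lie_form L V \<eta>) P x"
    if "\<eta> \<in> Omega L" for \<eta> x
    using pQ[OF S(2) that, of x] by (simp add: pairing_def)
  ultimately have "is_Lie_mvec V P (\<lambda>x. Q x x)" by (simp add: is_Lie_mvec_def)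
  then show ?thesis by (rule that)
qed

lemma is_Lie_mvec_part:
  assumes V: "V \<in> Sec L" and Q: "is_Lie_mvec V P Q"
  shows "is_Lie_mvec V (mvec_part L p P) (mvec_part L p Q)"
proof -
  have "pairing \<eta> (mvec_part L p Q) x =
      Lie_fun L V (pairing \<eta> (mvec_part L p P)) x - pairing (Lie_form L V \<eta>) (mvec_part L p P) x"
    if \<eta>: "\<eta> \<in> Omega L" for \<eta> x
    unfolding pairing_mvec_part[OF \<eta>] pairing_mvec_part[OF Lie_form_Omega[OF V \<eta>]]
      Lie_form_part[OF V \<eta>, symmetric]
    by (rule is_Lie_mvecD(2)[OF Q Omega_part_in[OF \<eta>]])
  then show ?thesis
    using Avec_deg_Avec[OF mvec_part_Avec[OF is_Lie_mvecD(1)[OF Q], of p]] by (simp add: is_Lie_mvec_def)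
qed

text \<open>Lie derivatives of forms respect degrees, so the degree p part of Q solves the problem
  for the degree p part of P, which is P itself. By uniqueness it equals Q.\<close>

lemma is_Lie_mvec_deg:
  assumes V: "V \<in> Sec L" and P: "P \<in> Avec_deg L p" and Q: "is_Lie_mvec V P Q"
  shows "Q \<in> Avec_deg L p"
proof -
  have "is_Lie_mvec V P (mvec_part L p Q)"
    using is_Lie_mvec_part[OF V Q, of p] by (simp add: Avec_deg_part[OF P])
  then have "mvec_part L p Q = Q" using Q by (rule is_Lie_mvec_unique)
  then show ?thesis using mvec_part_Avec[OF is_Lie_mvecD(1)[OF Q], of p] by simp
qed

text \<open>In positive degree the definition tests only against forms of degree p. This agrees with
  testing against all forms, since an element of degree p pairs with a form through the degree p
  part of the form. In degree 0 the element is a function h times the empty product, and the claim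
  is the product rule.\<close>

lemma is_Lie_mvec_Lie_mvec_deg:
  assumes V: "V \<in> Sec L" and P: "P \<in> Avec_deg L p"
  shows "is_Lie_mvec V P (Lie_mvec_deg L p V P)"
proof (cases "p = 0")
  case False
  obtain Q where Q: "is_Lie_mvec V P Q" by (rule Lie_mvec_exists[OF V Avec_deg_Avec[OF P]])
  have "Lie_mvec_deg L p V P = (THE Q. Q \<in> Avec_deg L p \<and> (\<forall>\<eta>\<in>Omega_deg L p.
       pairing \<eta> Q = Lie_fun L V (pairing \<eta> P) - pairing (Lie_form L V \<eta>) P))"
    using False by (simp add: Lie_mvec_deg_def)
  also have "\<dots> = Q"
  proof (rule the_equality)
    show "Q \<in> Avec_deg L p \<and> (\<forall>\<eta>\<in>Omega_deg L p.
        pairing \<eta> Q = Lie_fun L V (pairing \<eta> P) - pairing (Lie_form L V \<eta>) P)"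
      using is_Lie_mvec_deg[OF V P Q] by (auto simp: fun_eq_iff is_Lie_mvecD(2)[OF Q] dest: Omega_deg_Omega)
    fix R assume R: "R \<in> Avec_deg L p \<and> (\<forall>\<eta>\<in>Omega_deg L p.
        pairing \<eta> R = Lie_fun L V (pairing \<eta> P) - pairing (Lie_form L V \<eta>) P)"
    have "pairing \<eta> R x = pairing \<eta> Q x" if \<eta>: "\<eta> \<in> Omega L" for \<eta> x
    proof -
      have "pairing \<eta> R x = pairing (form_part p \<eta>) R x"
        using R pairing_mvec_part[OF \<eta>, of p R] by (simp add: Avec_deg_part)
      also have "\<dots> = Lie_fun L V (pairing (form_part p \<eta>) P) x - pairing (Lie_form L V (form_part p \<eta>)) P x"
        using R Omega_part[OF \<eta>, of p] by simp
      also have "\<dots> = pairing (form_part p \<eta>) Q x"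
        by (simp only: is_Lie_mvecD(2)[OF Q Omega_part_in[OF \<eta>]])
      also have "\<dots> = pairing \<eta> Q x"
        using pairing_mvec_part[OF \<eta>, of p Q] by (simp add: Avec_deg_part[OF is_Lie_mvec_deg[OF V P Q]])
      finally show ?thesis .
    qed
    then show "R = Q"
      using R by (intro ext[OF Avec_eqI_at] Avec_deg_Avec is_Lie_mvecD(1)[OF Q]) auto
  qed
  finally show ?thesis using Q by simp
next
  case True
  let ?one = "\<lambda>x vs. if vs = [] then 1 else 0 :: real"
  have one: "?one \<in> Omega L"
  proof (rule OmegaI)
    show "(\<lambda>vs. if vs = [] then 1 else 0) \<in> Alt x" for x
      by (rule alt_formsI) auto
    show "smooth U (\<lambda>x. if frame_list e I x = [] then 1 else 0)" if "is_frame U e" "I \<subseteq> N" for U e I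
      using M.smooth_fun_on_const[OF B.frame_open[OF that(1)], of "if sorted_list_of_set I = [] then 1 else 0"]
      by (simp add: frame_list_def)
  qed
  define h where "h = pairing ?one P"
  have h: "h \<in> CM" unfolding h_def by (rule pairing_Cinf[OF one Avec_deg_Avec[OF P]])
  have pP: "pairing \<eta> P x = h x * form_eval \<eta> [] x" if \<eta>: "\<eta> \<in> Omega L" for \<eta> x
  proof -
    have "pairing \<eta> P x = pairing (form_part 0 \<eta>) P x"
      using P True pairing_mvec_part[OF \<eta>, of 0 P] by (simp add: Avec_deg_part)
    also have "form_part 0 \<eta> = (\<lambda>x vs. form_eval \<eta> [] x * ?one x vs + 0 * ?one x vs)"
      by (auto simp: fun_eq_iff form_part_def form_eval_def)
    finally show ?thesis
      using pairing_comb[OF Avec_deg_Avec[OF P] one one, of "form_eval \<eta> []" "\<lambda>x. 0" x] by (simp add: h_def)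
  qed
  have "is_Lie_mvec V P (mvec_fun L (Lie_fun L V h))"
    unfolding is_Lie_mvec_def
  proof (intro conjI ballI allI)
    show "mvec_fun L (Lie_fun L V h) \<in> Avec L"
      unfolding mvec_fun_def sec_scale_def by (intro Avec_scale mvec_of_Avec Lie_fun_Cinf V h) simp
    fix \<eta> x assume \<eta>: "\<eta> \<in> Omega L"
    have "pairing \<eta> (mvec_fun L (Lie_fun L V h)) x = Lie_fun L V h x * pairing \<eta> (mvec_of L []) x"
      by (simp add: pairing_def mvec_fun_def sec_scale_def)
    moreover have "pairing \<eta> P = (\<lambda>x. h x * form_eval \<eta> [] x)" using pP[OF \<eta>] by blast
    moreover have "Lie_fun L V (\<lambda>x. h x * form_eval \<eta> [] x) x =
        h x * Lie_fun L V (form_eval \<eta> []) x + form_eval \<eta> [] x * Lie_fun L V h x"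
      by (intro Lie_fun_mult V h form_eval_Cinf \<eta>) simp
    moreover have "form_eval (Lie_form L V \<eta>) [] x = Lie_fun L V (form_eval \<eta> []) x"
      by (simp add: form_eval_Lie_form[OF V \<eta>] lie_eval_def)
    ultimately show "pairing \<eta> (mvec_fun L (Lie_fun L V h)) x =
        Lie_fun L V (pairing \<eta> P) x - pairing (Lie_form L V \<eta>) P x"
      by (simp add: pairing_mvec_of[OF \<eta>] pP[OF Lie_form_Omega[OF V \<eta>]])
  qed
  then show ?thesis using True by (simp add: Lie_mvec_deg_def h_def)
qed

lemma is_Lie_mvec_Lie_mvec:
  assumes V: "V \<in> Sec L" and P: "P \<in> Avec L"
  shows "is_Lie_mvec V P (Lie_mvec L V P)"
proof -
  let ?Q = "\<lambda>p. Lie_mvec_deg L p V (mvec_part L p P)"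
  have Q: "is_Lie_mvec V (mvec_part L p P) (?Q p)" for p
    by (rule is_Lie_mvec_Lie_mvec_deg[OF V mvec_part_Avec[OF P]])
  have eq: "Lie_mvec L V P = (\<lambda>x. \<Sum>p\<le>card N. ?Q p x)"
    by (simp add: Lie_mvec_def fun_eq_iff sum_fun_apply)
  show ?thesis
    unfolding is_Lie_mvec_def eq
  proof (intro conjI ballI allI)
    show "(\<lambda>x. \<Sum>p\<le>card N. ?Q p x) \<in> Avec L" by (intro Avec_sum is_Lie_mvecD(1)[OF Q])
    fix \<eta> x assume \<eta>: "\<eta> \<in> Omega L"
    have "pairing \<eta> (\<lambda>x. \<Sum>p\<le>card N. ?Q p x) x = (\<Sum>p\<le>card N. pairing \<eta> (?Q p) x)"
      by (simp add: pairing_def sum_fun_apply)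
    also have "\<dots> = (\<Sum>p\<le>card N. Lie_fun L V (pairing \<eta> (mvec_part L p P)) x) -
        (\<Sum>p\<le>card N. pairing (Lie_form L V \<eta>) (mvec_part L p P) x)"
      by (simp only: is_Lie_mvecD(2)[OF Q \<eta>] sum_subtractf)
    also have "(\<Sum>p\<le>card N. Lie_fun L V (pairing \<eta> (mvec_part L p P)) x) =
        Lie_fun L V (\<lambda>x. \<Sum>p\<le>card N. pairing \<eta> (mvec_part L p P) x) x"
      by (rule Lie_fun_sum[OF V, symmetric]) (intro pairing_Cinf \<eta> Avec_deg_Avec[OF mvec_part_Avec[OF P]])
    also have "(\<lambda>x. \<Sum>p\<le>card N. pairing \<eta> (mvec_part L p P) x) = pairing \<eta> P"
      by (simp add: pairing_sum_parts[OF P \<eta>])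
    also have "(\<Sum>p\<le>card N. pairing (Lie_form L V \<eta>) (mvec_part L p P) x) = pairing (Lie_form L V \<eta>) P x"
      by (rule pairing_sum_parts[OF P Lie_form_Omega[OF V \<eta>]])
    finally show "pairing \<eta> (\<lambda>x. \<Sum>p\<le>card N. ?Q p x) x =
        Lie_fun L V (pairing \<eta> P) x - pairing (Lie_form L V \<eta>) P x" .
  qed
qed

lemma Lie_mvec_eqI: "V \<in> Sec L \<Longrightarrow> P \<in> Avec L \<Longrightarrow> is_Lie_mvec V P Q \<Longrightarrow> Lie_mvec L V P = Q"
  by (rule is_Lie_mvec_unique[OF is_Lie_mvec_Lie_mvec])


subsection \<open>Properties of the Lie derivative\<close>

text \<open>Pairing with a product of sections is evaluation on them, so this is the defining
  formula of \<open>Lie_form L V \<eta>\<close> solved for its bracket terms.\<close>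

lemma is_Lie_mvec_of:
  assumes V: "V \<in> Sec L" and Vs: "set Vs \<subseteq> Sec L"
  shows "is_Lie_mvec V (mvec_of L Vs) (\<Sum>i<length Vs. mvec_of L (Vs[i := bracket L V (Vs ! i)]))"
proof -
  have "(\<lambda>x. \<Sum>i<length Vs. mvec_of L (Vs[i := bracket L V (Vs ! i)]) x) \<in> Avec L"
    by (intro Avec_sum mvec_of_Avec slot_list_in V Vs) simp
  moreover have "pairing \<eta> (\<lambda>x. \<Sum>i<length Vs. mvec_of L (Vs[i := bracket L V (Vs ! i)]) x) x =
      Lie_fun L V (pairing \<eta> (mvec_of L Vs)) x - pairing (Lie_form L V \<eta>) (mvec_of L Vs) x"
    if \<eta>: "\<eta> \<in> Omega L" for \<eta> x
  proof -
    have "pairing \<eta> (\<lambda>x. \<Sum>i<length Vs. mvec_of L (Vs[i := bracket L V (Vs ! i)]) x) x =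
        (\<Sum>i<length Vs. pairing \<eta> (mvec_of L (Vs[i := bracket L V (Vs ! i)])) x)"
      by (simp add: pairing_def sum_fun_apply)
    then show ?thesis
      by (simp add: pairing_mvec_of \<eta> Lie_form_Omega[OF V \<eta>]
        form_eval_Lie_form[OF V \<eta> Vs] lie_eval_def slot_sum_def)
  qed
  moreover have "(\<Sum>i<length Vs. mvec_of L (Vs[i := bracket L V (Vs ! i)])) =
      (\<lambda>x. \<Sum>i<length Vs. mvec_of L (Vs[i := bracket L V (Vs ! i)]) x)"
    by (simp add: fun_eq_iff sum_fun_apply)
  ultimately show ?thesis by (simp only: is_Lie_mvec_def) blast
qed

lemma is_Lie_mvec_linear:
  assumes V: "V \<in> Sec L" and P: "P \<in> Avec L" "Q \<in> Avec L"
    and P': "is_Lie_mvec V P P'" "is_Lie_mvec V Q Q'"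
  shows "is_Lie_mvec V (a *\<^sub>R P + b *\<^sub>R Q) (a *\<^sub>R P' + b *\<^sub>R Q')"
proof -
  have comb: "a *\<^sub>R R + b *\<^sub>R T = (\<lambda>x. a *\<^sub>R R x + b *\<^sub>R T x)" for R T :: "('m, 'v) mvec"
    by (simp add: fun_eq_iff)
  have pc: "pairing \<theta> (\<lambda>x. a *\<^sub>R R x + b *\<^sub>R T x) x = a * pairing \<theta> R x + b * pairing \<theta> T x"
    for \<theta> R x and T :: "('m, 'v) mvec"
    by (simp add: pairing_def)
  have "(\<lambda>x. a *\<^sub>R P' x + b *\<^sub>R Q' x) \<in> Avec L"
    by (intro Avec_comb[where f = "\<lambda>x. a" and g = "\<lambda>x. b"] M.Cinf_const is_Lie_mvecD(1)[OF P'(1)] is_Lie_mvecD(1)[OF P'(2)])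
  moreover have "pairing \<eta> (\<lambda>x. a *\<^sub>R P' x + b *\<^sub>R Q' x) x = Lie_fun L V (pairing \<eta> (\<lambda>x. a *\<^sub>R P x + b *\<^sub>R Q x)) x -
      pairing (Lie_form L V \<eta>) (\<lambda>x. a *\<^sub>R P x + b *\<^sub>R Q x) x" if \<eta>: "\<eta> \<in> Omega L" for \<eta> x
  proof -
    have "pairing \<eta> (\<lambda>x. a *\<^sub>R P x + b *\<^sub>R Q x) = (\<lambda>x. a * pairing \<eta> P x + b * pairing \<eta> Q x)"
      by (simp add: fun_eq_iff pc)
    then show ?thesis
      by (simp add: pc Lie_fun_comb[OF V pairing_Cinf[OF \<eta> P(1)] pairing_Cinf[OF \<eta> P(2)]]
        is_Lie_mvecD(2)[OF P'(1) \<eta>] is_Lie_mvecD(2)[OF P'(2) \<eta>] algebra_simps)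
  qed
  ultimately show ?thesis unfolding comb is_Lie_mvec_def by blast
qed

section \<open>Compatibility with contractions and wedge products\<close>

text \<open>On sections Vs the contracted form is the pairing of Q with a prefixed form, to which
  the characterization of Q' applies. The bracket terms from \<open>pairing_Lie_form_prefix\<close>
  are those required by \<open>lie_eval\<close>. Both the wedge rule and the interior product rule
  rest on this.\<close>

lemma Lie_form_contract:
  assumes V: "V \<in> Sec L" and Q: "Q \<in> Avec L" and \<eta>: "\<eta> \<in> Omega L" and Q': "is_Lie_mvec V Q Q'"
  shows "Lie_form L V (form_contract Q \<eta>) =
    (\<lambda>x vs. 1 * form_contract Q' \<eta> x vs + 1 * form_contract Q (Lie_form L V \<eta>) x vs)" (is "_ = ?\<theta>")
proof (rule Lie_form_eqI[OF V Omega_contract[OF Q \<eta>]])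
  show "?\<theta> \<in> Omega L"
    by (intro Omega_comb Omega_contract Q \<eta> is_Lie_mvecD(1)[OF Q'] Lie_form_Omega V M.Cinf_const)
  fix Vs assume Vs: "set Vs \<subseteq> Sec L"
  show "form_eval ?\<theta> Vs = lie_eval V (form_contract Q \<eta>) Vs"
  proof
    fix x
    have "form_eval ?\<theta> Vs x = pairing (form_prefix Vs \<eta>) Q' x + form_eval (form_contract Q (Lie_form L V \<eta>)) Vs x"
      unfolding pairing_prefix by (simp add: form_eval_def)
    also have "pairing (form_prefix Vs \<eta>) Q' x =
        Lie_fun L V (pairing (form_prefix Vs \<eta>) Q) x - pairing (Lie_form L V (form_prefix Vs \<eta>)) Q x"
      by (rule is_Lie_mvecD(2)[OF Q' Omega_prefix[OF \<eta> Vs]])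
    finally show "form_eval ?\<theta> Vs x = lie_eval V (form_contract Q \<eta>) Vs x"
      by (simp add: pairing_Lie_form_prefix[OF V \<eta> Vs Q] pairing_prefix lie_eval_def)
  qed
qed

lemma is_Lie_mvec_wedge:
  assumes V: "V \<in> Sec L" and P: "P \<in> Avec L" "Q \<in> Avec L"
    and P': "is_Lie_mvec V P P'" "is_Lie_mvec V Q Q'"
  shows "is_Lie_mvec V (mvec_wedge L P Q) (mvec_wedge L P' Q + mvec_wedge L P Q')"
proof -
  have in': "P' \<in> Avec L" "Q' \<in> Avec L" using P' by (simp_all add: is_Lie_mvecD)
  have eq: "mvec_wedge L P' Q + mvec_wedge L P Q' = (\<lambda>x. mvec_wedge L P' Q x + mvec_wedge L P Q' x)"
    by (simp add: fun_eq_iff)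
  have "(\<lambda>x. mvec_wedge L P' Q x + mvec_wedge L P Q' x) \<in> Avec L"
    by (intro Avec_add mvec_wedge_Avec P in')
  moreover have "pairing \<eta> (\<lambda>x. mvec_wedge L P' Q x + mvec_wedge L P Q' x) x =
      Lie_fun L V (pairing \<eta> (mvec_wedge L P Q)) x - pairing (Lie_form L V \<eta>) (mvec_wedge L P Q) x"
    if \<eta>: "\<eta> \<in> Omega L" for \<eta> x
  proof -
    have L: "Lie_form L V \<eta> \<in> Omega L" by (rule Lie_form_Omega[OF V \<eta>])
    have "pairing \<eta> (\<lambda>x. mvec_wedge L P' Q x + mvec_wedge L P Q' x) x =
        pairing \<eta> (mvec_wedge L P' Q) x + pairing \<eta> (mvec_wedge L P Q') x"
      by (simp add: pairing_def)
    moreover have "pairing (Lie_form L V (form_contract Q \<eta>)) P x =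
        1 * pairing (form_contract Q' \<eta>) P x + 1 * pairing (form_contract Q (Lie_form L V \<eta>)) P x"
      unfolding Lie_form_contract[OF V P(2) \<eta> P'(2)]
      by (rule pairing_comb[OF P(1) Omega_contract[OF in'(2) \<eta>] Omega_contract[OF P(2) L]])
    ultimately show ?thesis
      using is_Lie_mvecD(2)[OF P'(1) Omega_contract[OF P(2) \<eta>], of x]
      by (simp add: pairing_wedge \<eta> L)
  qed
  ultimately show ?thesis unfolding eq is_Lie_mvec_def by blast
qed

lemma int_prod_contract: "int_prod P \<eta> = form_rev (form_contract P (form_rev \<eta>))"
  by (simp add: fun_eq_iff int_prod_def ext_int_def form_rev_def form_contract_def)

lemma Lie_form_int_prod:
  assumes V: "V \<in> Sec L" and P: "P \<in> Avec L" and \<eta>: "\<eta> \<in> Omega L" and P': "is_Lie_mvec V P P'"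
  shows "Lie_form L V (int_prod P \<eta>) = int_prod P' \<eta> + int_prod P (Lie_form L V \<eta>)"
proof -
  have "Lie_form L V (int_prod P \<eta>) = form_rev (Lie_form L V (form_contract P (form_rev \<eta>)))"
    unfolding int_prod_contract by (intro Lie_form_rev V Omega_contract P Omega_rev \<eta>)
  also have "\<dots> = int_prod P' \<eta> + int_prod P (Lie_form L V \<eta>)"
    unfolding int_prod_contract Lie_form_contract[OF V P Omega_rev[OF \<eta>] P'] Lie_form_rev[OF V \<eta>]
    by (simp add: fun_eq_iff form_rev_def)
  finally show ?thesis .
qed

section \<open>Commutators of Lie derivatives\<close>

lemma slot_sum_cong:
  "(\<And>i. i < length vs \<Longrightarrow> F (vs[i := D (vs ! i)]) = G (vs[i := D (vs ! i)])) \<Longrightarrow> slot_sum D F vs = slot_sum D G vs"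
  by (simp add: slot_sum_def)

text \<open>The two terms combining a derivative of a value with a bracket are together symmetric in
  V and W. In the commutator only the pure second derivatives and the double slot sums
  survive.\<close>

lemma lie_eval_Lie_form:
  assumes V: "V \<in> Sec L" and W: "W \<in> Sec L" and \<eta>: "\<eta> \<in> Omega L" and Vs: "set Vs \<subseteq> Sec L"
  shows "lie_eval V (Lie_form L W \<eta>) Vs x = Lie_fun L V (Lie_fun L W (form_eval \<eta> Vs)) x
    - slot_sum (bracket L W) (\<lambda>Ws. Lie_fun L V (form_eval \<eta> Ws) x) Vs
    - slot_sum (bracket L V) (\<lambda>Ws. Lie_fun L W (form_eval \<eta> Ws) x) Vs
    + slot_sum (bracket L V) (slot_sum (bracket L W) (\<lambda>Ws. form_eval \<eta> Ws x)) Vs"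
proof -
  have "form_eval (Lie_form L W \<eta>) Vs =
      (\<lambda>x. Lie_fun L W (form_eval \<eta> Vs) x - (\<Sum>i<length Vs. form_eval \<eta> (Vs[i := bracket L W (Vs ! i)]) x))"
    unfolding form_eval_Lie_form[OF W \<eta> Vs] by (simp add: fun_eq_iff lie_eval_def slot_sum_def)
  then have "Lie_fun L V (form_eval (Lie_form L W \<eta>) Vs) x = Lie_fun L V (Lie_fun L W (form_eval \<eta> Vs)) x -
      Lie_fun L V (\<lambda>x. \<Sum>i<length Vs. form_eval \<eta> (Vs[i := bracket L W (Vs ! i)]) x) x"
    by (simp only:) (intro Lie_fun_diff V Lie_fun_Cinf W form_eval_Cinf \<eta> Vs M.Cinf_sum slot_list_in, simp)
  also have "Lie_fun L V (\<lambda>x. \<Sum>i<length Vs. form_eval \<eta> (Vs[i := bracket L W (Vs ! i)]) x) x =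
      slot_sum (bracket L W) (\<lambda>Ws. Lie_fun L V (form_eval \<eta> Ws) x) Vs"
    unfolding slot_sum_def by (rule Lie_fun_sum[OF V]) (simp add: form_eval_Cinf \<eta> Vs W slot_list_in)
  finally have 1: "Lie_fun L V (form_eval (Lie_form L W \<eta>) Vs) x = Lie_fun L V (Lie_fun L W (form_eval \<eta> Vs)) x -
      slot_sum (bracket L W) (\<lambda>Ws. Lie_fun L V (form_eval \<eta> Ws) x) Vs" .
  have "slot_sum (bracket L V) (\<lambda>Ws. form_eval (Lie_form L W \<eta>) Ws x) Vs =
      slot_sum (bracket L V) (\<lambda>Ws. lie_eval W \<eta> Ws x) Vs"
    by (rule slot_sum_cong) (simp add: form_eval_Lie_form[OF W \<eta>] slot_list_in V Vs)
  also have "\<dots> = slot_sum (bracket L V) (\<lambda>Ws. Lie_fun L W (form_eval \<eta> Ws) x) Vs -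
      slot_sum (bracket L V) (slot_sum (bracket L W) (\<lambda>Ws. form_eval \<eta> Ws x)) Vs"
    by (simp add: lie_eval_def slot_sum_def[of "bracket L V"] sum_subtractf)
  finally show ?thesis by (simp add: lie_eval_def 1)
qed

text \<open>The second derivatives of functions give the derivative along the bracket by
  \<open>Lie_fun_bracket\<close>. The double slot sums combine by
  \<open>slot_sum_commutator\<close>, whose hypothesis is the Jacobi identity inserted in one
  slot.\<close>

lemma Lie_form_bracket:
  assumes V: "V \<in> Sec L" and W: "W \<in> Sec L" and \<eta>: "\<eta> \<in> Omega L"
  shows "Lie_form L (bracket L V W) \<eta> =
    (\<lambda>x vs. 1 * Lie_form L V (Lie_form L W \<eta>) x vs + (-1) * Lie_form L W (Lie_form L V \<eta>) x vs)" (is "_ = ?\<theta>")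
proof (rule Lie_form_eqI[OF bracket_closed[OF V W] \<eta>])
  have LV: "Lie_form L V \<eta> \<in> Omega L" and LW: "Lie_form L W \<eta> \<in> Omega L"
    by (rule Lie_form_Omega[OF _ \<eta>], fact)+
  show "?\<theta> \<in> Omega L"
    by (intro Omega_comb Lie_form_Omega V W \<eta> M.Cinf_const)
  fix Vs assume Vs: "set Vs \<subseteq> Sec L"
  show "form_eval ?\<theta> Vs = lie_eval (bracket L V W) \<eta> Vs"
  proof
    fix x
    let ?F = "\<lambda>Ws. form_eval \<eta> Ws x"
    have "form_eval ?\<theta> Vs x = form_eval (Lie_form L V (Lie_form L W \<eta>)) Vs x -
        form_eval (Lie_form L W (Lie_form L V \<eta>)) Vs x" by (simp add: form_eval_def)
    also have "\<dots> = lie_eval V (Lie_form L W \<eta>) Vs x - lie_eval W (Lie_form L V \<eta>) Vs x"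
      by (simp only: form_eval_Lie_form[OF V LW Vs] form_eval_Lie_form[OF W LV Vs])
    also have "\<dots> = Lie_fun L (bracket L V W) (form_eval \<eta> Vs) x -
        (slot_sum (bracket L W) (slot_sum (bracket L V) ?F) Vs - slot_sum (bracket L V) (slot_sum (bracket L W) ?F) Vs)"
      by (simp add: lie_eval_Lie_form V W \<eta> Vs Lie_fun_bracket form_eval_Cinf)
    also have "slot_sum (bracket L W) (slot_sum (bracket L V) ?F) Vs - slot_sum (bracket L V) (slot_sum (bracket L W) ?F) Vs =
        slot_sum (bracket L (bracket L V W)) ?F Vs"
    proof (rule slot_sum_commutator[OF _ Vs])
      fix us A ws assume A: "A \<in> Sec L"
      have "form_eval \<eta> (us @ bracket L V (bracket L W A) # ws) - form_eval \<eta> (us @ bracket L W (bracket L V A) # ws) =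
          form_eval \<eta> (us @ bracket L (bracket L V W) A # ws)"
        unfolding bracket_jacobi_commutator[OF V W A, symmetric]
        by (intro form_eval_diff \<eta> bracket_closed V W A)
      from fun_cong[OF this, of x]
      show "?F (us @ bracket L V (bracket L W A) # ws) - ?F (us @ bracket L W (bracket L V A) # ws) =
          ?F (us @ bracket L (bracket L V W) A # ws)" by simp
    qed
    finally show "form_eval ?\<theta> Vs x = lie_eval (bracket L V W) \<eta> Vs x" by (simp only: lie_eval_def)
  qed
qed

text \<open>Passing to forms reverses the order: the pairing of \<eta> with the derivative along V
  of the derivative along W contains W applied after V to \<eta>. This reversal produces the minus
  sign in the characterization.\<close>

lemma is_Lie_mvec_bracket:
  assumes V: "V \<in> Sec L" and W: "W \<in> Sec L" and P: "P \<in> Avec L"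
    and PV: "is_Lie_mvec V P PV" "is_Lie_mvec W PV PWV"
    and PW: "is_Lie_mvec W P PW" "is_Lie_mvec V PW PVW"
  shows "is_Lie_mvec (bracket L V W) P (PVW - PWV)"
proof -
  have eq: "PVW - PWV = (\<lambda>x. 1 *\<^sub>R PVW x + (-1) *\<^sub>R PWV x)" by (simp add: fun_eq_iff)
  have "(\<lambda>x. 1 *\<^sub>R PVW x + (-1) *\<^sub>R PWV x) \<in> Avec L"
    by (intro Avec_comb[where f = "\<lambda>x. 1" and g = "\<lambda>x. -1"] M.Cinf_const is_Lie_mvecD(1)[OF PW(2)] is_Lie_mvecD(1)[OF PV(2)])
  moreover have "pairing \<eta> (\<lambda>x. 1 *\<^sub>R PVW x + (-1) *\<^sub>R PWV x) x =
      Lie_fun L (bracket L V W) (pairing \<eta> P) x - pairing (Lie_form L (bracket L V W) \<eta>) P x"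
    if \<eta>: "\<eta> \<in> Omega L" for \<eta> x
  proof -
    have LV: "Lie_form L V \<eta> \<in> Omega L" and LW: "Lie_form L W \<eta> \<in> Omega L"
      by (rule Lie_form_Omega[OF _ \<eta>], fact)+
    \<comment> \<open>The two middle terms are together symmetric in A and B and cancel in the
      difference.\<close>
    have two: "pairing \<eta> R2 x = Lie_fun L A (Lie_fun L B (pairing \<eta> P)) x - Lie_fun L A (pairing (Lie_form L B \<eta>) P) x
        - Lie_fun L B (pairing (Lie_form L A \<eta>) P) x + pairing (Lie_form L B (Lie_form L A \<eta>)) P x"
      if "A \<in> Sec L" "B \<in> Sec L" "is_Lie_mvec B P R1" "is_Lie_mvec A R1 R2" for A B R1 R2
    proof -
      have LA: "Lie_form L A \<eta> \<in> Omega L" and LB: "Lie_form L B \<eta> \<in> Omega L"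
        by (rule Lie_form_Omega[OF _ \<eta>], fact)+
      have "pairing \<eta> R1 = (\<lambda>x. Lie_fun L B (pairing \<eta> P) x - pairing (Lie_form L B \<eta>) P x)"
        using is_Lie_mvecD(2)[OF that(3) \<eta>] by blast
      then have "Lie_fun L A (pairing \<eta> R1) x =
          Lie_fun L A (Lie_fun L B (pairing \<eta> P)) x - Lie_fun L A (pairing (Lie_form L B \<eta>) P) x"
        by (simp only:) (intro Lie_fun_diff Lie_fun_Cinf pairing_Cinf that \<eta> P LB)
      then show ?thesis
        by (simp add: is_Lie_mvecD(2)[OF that(4) \<eta>] is_Lie_mvecD(2)[OF that(3) LA])
    qed
    have "pairing \<eta> (\<lambda>x. 1 *\<^sub>R PVW x + (-1) *\<^sub>R PWV x) x = pairing \<eta> PVW x - pairing \<eta> PWV x"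
      by (simp add: pairing_def)
    moreover have "pairing (Lie_form L (bracket L V W) \<eta>) P x =
        1 * pairing (Lie_form L V (Lie_form L W \<eta>)) P x + (-1) * pairing (Lie_form L W (Lie_form L V \<eta>)) P x"
      unfolding Lie_form_bracket[OF V W \<eta>]
      by (rule pairing_comb[OF P Lie_form_Omega[OF V LW] Lie_form_Omega[OF W LV]])
    ultimately show ?thesis
      by (simp add: two[OF V W PW] two[OF W V PV] Lie_fun_bracket[OF V W pairing_Cinf[OF \<eta> P]])
  qed
  ultimately show ?thesis unfolding eq is_Lie_mvec_def by blast
qed

section \<open>Dependence on multiplication of the section by a function\<close>

text \<open>The formula for the Lie derivative along fV, solved for the wedge product. This presents
  the wedge as a combination of two Lie derivatives, hence of elements of \<open>Omega\<close>, and
  \<open>pairing_comb\<close> applies to it directly.\<close>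

lemma form_wedge_d_anchor:
  assumes V: "V \<in> Sec L" and f: "f \<in> CM" and \<eta>: "\<eta> \<in> Omega L"
  shows "form_wedge (d_anchor L f) (int_prod (mvec_of L [V]) \<eta>) =
    (\<lambda>x vs. 1 * Lie_form L (sec_scale f V) \<eta> x vs + (- f x) * Lie_form L V \<eta> x vs)"
proof (intro ext)
  fix x vs
  have fV: "sec_scale f V \<in> Sec L" by (rule sec_scale_in[OF V f])
  have int: "int_prod (mvec_of L [V]) \<eta> x = (\<lambda>ws. \<eta> x (V x # ws))"
    by (simp add: fun_eq_iff int_prod_sec[OF \<eta>])
  have one: "d_anchor L f x us = 0" if "length us \<noteq> 1" for us using that by (simp add: d_anchor_def)
  show "form_wedge (d_anchor L f) (int_prod (mvec_of L [V]) \<eta>) x vs =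
      1 * Lie_form L (sec_scale f V) \<eta> x vs + (- f x) * Lie_form L V \<eta> x vs"
  proof (cases "set vs \<subseteq> efib L x")
    case True
    then obtain Vs where Vs: "set Vs \<subseteq> Sec L" "map (\<lambda>V. V x) Vs = vs" by (rule sections_through)
    have nth: "vs ! i = (Vs ! i) x" "Vs ! i \<in> Sec L" if "i < length Vs" for i
      using Vs that by (auto simp: subset_iff)
    have upd: "form_eval \<eta> (Vs[i := A]) x = \<eta> x (vs[i := A x])" for i A
      by (simp add: form_eval_def map_update Vs(2))
    \<comment> \<open>The bracket of fV with a section has a correction along V from differentiating
      f; summed over the slots, these corrections are the wedge product.\<close>
    have slot: "form_eval \<eta> (Vs[i := bracket L (sec_scale f V) (Vs ! i)]) x =
        f x * form_eval \<eta> (Vs[i := bracket L V (Vs ! i)]) x - Lie_fun L (Vs ! i) f x * \<eta> x (vs[i := V x])"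
      if i: "i < length Vs" for i
    proof -
      let ?us = "take i Vs" and ?ws = "drop (Suc i) Vs" and ?A = "Vs ! i"
      have A: "?A \<in> Sec L" by (rule nth(2)[OF i])
      have "form_eval \<eta> (?us @ (sec_scale f (bracket L V ?A) - sec_scale (Lie_fun L ?A f) V) # ?ws) =
          form_eval \<eta> (?us @ sec_scale f (bracket L V ?A) # ?ws) - form_eval \<eta> (?us @ sec_scale (Lie_fun L ?A f) V # ?ws)"
        by (rule form_eval_diff[symmetric]) (intro \<eta> sec_scale_in bracket_closed V A f Lie_fun_Cinf)+
      then have "form_eval \<eta> (?us @ bracket L (sec_scale f V) ?A # ?ws) x =
          form_eval \<eta> (?us @ sec_scale f (bracket L V ?A) # ?ws) x - form_eval \<eta> (?us @ sec_scale (Lie_fun L ?A f) V # ?ws) x"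
        unfolding bracket_scale_left[OF V A f] by simp
      then show ?thesis
        using i by (simp add: upd[symmetric] upd_conv_take_nth_drop form_eval_scale[OF \<eta> V]
          form_eval_scale[OF \<eta> bracket_closed[OF V A]])
    qed
    have "Lie_form L (sec_scale f V) \<eta> x vs = form_eval (Lie_form L (sec_scale f V) \<eta>) Vs x"
      by (simp add: form_eval_def Vs(2))
    also have "\<dots> = f x * Lie_fun L V (form_eval \<eta> Vs) x -
        (\<Sum>i<length Vs. f x * form_eval \<eta> (Vs[i := bracket L V (Vs ! i)]) x - Lie_fun L (Vs ! i) f x * \<eta> x (vs[i := V x]))"
      unfolding form_eval_Lie_form[OF fV \<eta> Vs(1)] lie_eval_def slot_sum_def Lie_fun_sec_scale[OF V]
      by (simp add: slot)
    also have "\<dots> = f x * form_eval (Lie_form L V \<eta>) Vs x + (\<Sum>i<length Vs. Lie_fun L (Vs ! i) f x * \<eta> x (vs[i := V x]))"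
      unfolding form_eval_Lie_form[OF V \<eta> Vs(1)] lie_eval_def slot_sum_def
      by (simp add: sum_subtractf sum_distrib_left algebra_simps)
    also have "form_eval (Lie_form L V \<eta>) Vs x = Lie_form L V \<eta> x vs"
      by (simp add: form_eval_def Vs(2))
    finally have "Lie_form L (sec_scale f V) \<eta> x vs =
        f x * Lie_form L V \<eta> x vs + (\<Sum>i<length Vs. Lie_fun L (Vs ! i) f x * \<eta> x (vs[i := V x]))" .
    moreover have "form_wedge (d_anchor L f) (int_prod (mvec_of L [V]) \<eta>) x vs =
        (\<Sum>i<length vs. d_anchor L f x [vs ! i] * \<eta> x (vs[i := V x]))"
      unfolding form_wedge_def int by (rule alt_wedge_one_form_insert[OF one OmegaD[OF \<eta>] sec_in[OF V] True])
    moreover have "(\<Sum>i<length vs. d_anchor L f x [vs ! i] * \<eta> x (vs[i := V x])) =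
        (\<Sum>i<length Vs. Lie_fun L (Vs ! i) f x * \<eta> x (vs[i := V x]))"
    proof (rule sum.cong)
      show "{..<length vs} = {..<length Vs}" using Vs(2) by auto
      fix i assume "i \<in> {..<length Vs}"
      then show "d_anchor L f x [vs ! i] * \<eta> x (vs[i := V x]) = Lie_fun L (Vs ! i) f x * \<eta> x (vs[i := V x])"
        using nth[of i] sec_in[of "Vs ! i" x] by (simp add: d_anchor_def Lie_fun_def)
    qed
    ultimately show ?thesis by simp
  next
    case False
    have "form_wedge (d_anchor L f) (int_prod (mvec_of L [V]) \<eta>) x vs =
        (\<Sum>i<length vs. (-1) ^ i * d_anchor L f x [vs ! i] * \<eta> x (V x # take i vs @ drop (Suc i) vs))"
      unfolding form_wedge_def int by (rule alt_wedge_one_form[OF one])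
    \<comment> \<open>Some entry lies outside the fibre. For each i it is either
      \<open>vs ! i\<close>, where \<open>d_anchor\<close> has its default value 0, or it remains in
      the list given to \<eta>, which then vanishes.\<close>
    also have "\<dots> = 0"
    proof (rule sum.neutral, rule ballI)
      fix i assume "i \<in> {..<length vs}"
      then have "set vs = insert (vs ! i) (set (take i vs @ drop (Suc i) vs))"
        using arg_cong[OF id_take_nth_drop[of i vs], of set] by auto
      then have "vs ! i \<notin> efib L x \<or> \<not> set (V x # take i vs @ drop (Suc i) vs) \<subseteq> efib L x" using False by auto
      then show "(-1) ^ i * d_anchor L f x [vs ! i] * \<eta> x (V x # take i vs @ drop (Suc i) vs) = 0"
        using alt_formsD(1)[OF OmegaD[OF \<eta>]] by (auto simp: d_anchor_def)
    qed
    finally show ?thesis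
      using alt_formsD(1)[OF OmegaD[OF Lie_form_Omega[OF fV \<eta>]] False]
        alt_formsD(1)[OF OmegaD[OF Lie_form_Omega[OF V \<eta>]] False] by simp
  qed
qed

lemma pairing_Lie_mvec_sec_scale:
  assumes V: "V \<in> Sec L" and f: "f \<in> CM" and P: "P \<in> Avec L" and \<eta>: "\<eta> \<in> Omega L"
    and Q: "is_Lie_mvec V P Q" "is_Lie_mvec (sec_scale f V) P R"
  shows "pairing \<eta> R x = f x * pairing \<eta> Q x -
    pairing (form_wedge (d_anchor L f) (int_prod (mvec_of L [V]) \<eta>)) P x"
proof -
  have fV: "sec_scale f V \<in> Sec L" by (rule sec_scale_in[OF V f])
  have "pairing (form_wedge (d_anchor L f) (int_prod (mvec_of L [V]) \<eta>)) P x =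
      1 * pairing (Lie_form L (sec_scale f V) \<eta>) P x + (- f x) * pairing (Lie_form L V \<eta>) P x"
    unfolding form_wedge_d_anchor[OF V f \<eta>]
    by (rule pairing_comb[OF P Lie_form_Omega[OF fV \<eta>] Lie_form_Omega[OF V \<eta>]])
  then show ?thesis
    by (simp add: is_Lie_mvecD(2)[OF Q(1) \<eta>] is_Lie_mvecD(2)[OF Q(2) \<eta>] Lie_fun_sec_scale[OF V] algebra_simps)
qed

end

text \<open>Being a derivation of degree 0 comprises three clauses: preservation of each degree,
  real linearity and the Leibniz rule. The equations between multivector fields follow from
  uniqueness once the right-hand side is known to satisfy \<open>is_Lie_mvec\<close>.\<close>

theorem proposition5p1p6:
  fixes L :: "('m::{t2_space,second_countable_topology}, 'v::real_vector) algebroid"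
  assumes "lie_algebroid L"
  shows
    "(\<forall>V\<in>Sec L. \<forall>W\<in>Sec L. Lie_mvec L V (mvec_of L [W]) = mvec_of L [bracket L V W]) \<and>
     (\<forall>V\<in>Sec L. \<forall>Vs. set Vs \<subseteq> Sec L \<longrightarrow>
        Lie_mvec L V (mvec_of L Vs) =
          (\<Sum>i<length Vs. mvec_of L (Vs[i := bracket L V (Vs ! i)]))) \<and>
     (\<forall>V\<in>Sec L.
        (\<forall>p. \<forall>P\<in>Avec_deg L p. Lie_mvec L V P \<in> Avec_deg L p) \<and>
        (\<forall>P\<in>Avec L. \<forall>Q\<in>Avec L. \<forall>a b.
           Lie_mvec L V (a *\<^sub>R P + b *\<^sub>R Q) = a *\<^sub>R Lie_mvec L V P + b *\<^sub>R Lie_mvec L V Q) \<and>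
        (\<forall>P\<in>Avec L. \<forall>Q\<in>Avec L.
           Lie_mvec L V (mvec_wedge L P Q) =
             mvec_wedge L (Lie_mvec L V P) Q + mvec_wedge L P (Lie_mvec L V Q))) \<and>
     (\<forall>V\<in>Sec L. \<forall>P\<in>Avec L. \<forall>\<eta>\<in>Omega L.
        Lie_form L V (int_prod P \<eta>) =
          int_prod (Lie_mvec L V P) \<eta> + int_prod P (Lie_form L V \<eta>)) \<and>
     (\<forall>V\<in>Sec L. \<forall>P\<in>Avec L. \<forall>\<eta>\<in>Omega L.
        Lie_fun L V (pairing \<eta> P) =
          pairing (Lie_form L V \<eta>) P + pairing \<eta> (Lie_mvec L V P)) \<and>
     (\<forall>V\<in>Sec L. \<forall>W\<in>Sec L. \<forall>P\<in>Avec L.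
        Lie_mvec L (bracket L V W) P =
          Lie_mvec L V (Lie_mvec L W P) - Lie_mvec L W (Lie_mvec L V P)) \<and>
     (\<forall>V\<in>Sec L. \<forall>f\<in>Cinf (base L). \<forall>P\<in>Avec L. \<forall>\<eta>\<in>Omega L.
        pairing \<eta> (Lie_mvec L (sec_scale f V) P) =
          (\<lambda>x. f x * pairing \<eta> (Lie_mvec L V P) x) -
          pairing (form_wedge (d_anchor L f) (int_prod (mvec_of L [V]) \<eta>)) P)"
proof -
  interpret lie_algebroid L by (rule assms)
  note lie = is_Lie_mvec_Lie_mvec
  show ?thesis
  proof (intro conjI ballI allI impI)
    fix V W assume V: "V \<in> Sec L" and W: "W \<in> Sec L"
    show "Lie_mvec L V (mvec_of L [W]) = mvec_of L [bracket L V W]"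
      by (rule Lie_mvec_eqI[OF V mvec_of_Avec]) (use W is_Lie_mvec_of[OF V, of "[W]"] in simp_all)
  next
    fix V Vs assume V: "V \<in> Sec L" and Vs: "set Vs \<subseteq> Sec L"
    show "Lie_mvec L V (mvec_of L Vs) = (\<Sum>i<length Vs. mvec_of L (Vs[i := bracket L V (Vs ! i)]))"
      by (rule Lie_mvec_eqI[OF V mvec_of_Avec[OF Vs] is_Lie_mvec_of[OF V Vs]])
  next
    fix V p P assume V: "V \<in> Sec L" and P: "P \<in> Avec_deg L p"
    show "Lie_mvec L V P \<in> Avec_deg L p"
      by (rule is_Lie_mvec_deg[OF V P lie[OF V Avec_deg_Avec[OF P]]])
  next
    fix V P Q and a b :: real assume V: "V \<in> Sec L" and P: "P \<in> Avec L" and Q: "Q \<in> Avec L"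
    have "(\<lambda>x. a *\<^sub>R P x + b *\<^sub>R Q x) \<in> Avec L"
      by (intro Avec_comb[where f = "\<lambda>x. a" and g = "\<lambda>x. b"] P Q M.Cinf_const)
    moreover have "a *\<^sub>R P + b *\<^sub>R Q = (\<lambda>x. a *\<^sub>R P x + b *\<^sub>R Q x)" by (simp add: fun_eq_iff)
    ultimately have "a *\<^sub>R P + b *\<^sub>R Q \<in> Avec L" by (simp only:)
    then show "Lie_mvec L V (a *\<^sub>R P + b *\<^sub>R Q) = a *\<^sub>R Lie_mvec L V P + b *\<^sub>R Lie_mvec L V Q"
      by (rule Lie_mvec_eqI[OF V _ is_Lie_mvec_linear[OF V P Q lie[OF V P] lie[OF V Q]]])
  next
    fix V P Q assume V: "V \<in> Sec L" and P: "P \<in> Avec L" and Q: "Q \<in> Avec L"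
    show "Lie_mvec L V (mvec_wedge L P Q) =
        mvec_wedge L (Lie_mvec L V P) Q + mvec_wedge L P (Lie_mvec L V Q)"
      by (rule Lie_mvec_eqI[OF V mvec_wedge_Avec[OF P Q] is_Lie_mvec_wedge[OF V P Q lie[OF V P] lie[OF V Q]]])
  next
    fix V P \<eta> assume V: "V \<in> Sec L" and P: "P \<in> Avec L" and \<eta>: "\<eta> \<in> Omega L"
    show "Lie_form L V (int_prod P \<eta>) = int_prod (Lie_mvec L V P) \<eta> + int_prod P (Lie_form L V \<eta>)"
      by (rule Lie_form_int_prod[OF V P \<eta> lie[OF V P]])
    show "Lie_fun L V (pairing \<eta> P) = pairing (Lie_form L V \<eta>) P + pairing \<eta> (Lie_mvec L V P)"
      by (simp add: fun_eq_iff is_Lie_mvecD(2)[OF lie[OF V P] \<eta>])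
  next
    fix V W P assume V: "V \<in> Sec L" and W: "W \<in> Sec L" and P: "P \<in> Avec L"
    note VP = lie[OF V P] and WP = lie[OF W P]
    show "Lie_mvec L (bracket L V W) P = Lie_mvec L V (Lie_mvec L W P) - Lie_mvec L W (Lie_mvec L V P)"
      by (rule Lie_mvec_eqI[OF bracket_closed[OF V W] P is_Lie_mvec_bracket[OF V W P
            VP lie[OF W is_Lie_mvecD(1)[OF VP]] WP lie[OF V is_Lie_mvecD(1)[OF WP]]]])
  next
    fix V f P \<eta> assume V: "V \<in> Sec L" and f: "f \<in> Cinf (base L)" and P: "P \<in> Avec L" and \<eta>: "\<eta> \<in> Omega L"
    show "pairing \<eta> (Lie_mvec L (sec_scale f V) P) = (\<lambda>x. f x * pairing \<eta> (Lie_mvec L V P) x) -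
        pairing (form_wedge (d_anchor L f) (int_prod (mvec_of L [V]) \<eta>)) P"
      using pairing_Lie_mvec_sec_scale[OF V f P \<eta> lie[OF V P] lie[OF sec_scale_in[OF V f] P]]
      by (simp add: fun_eq_iff)
  qed
qed

end
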